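(* Let $n,m,l\in\mathbb{N}$, let $\Phi:\mathbb{M}_n\to\mathbb{M}_l$ and $\Psi:\mathbb{M}_m\to\mathbb{M}_l$ be strictly positive linear maps, let $f$ be a non-decreasing function on $(0,\infty)$ and $1<p\le2$, and assume that $x\mapsto f(x^{p-1})$ is convex on $(0,\infty)$. Let $q\in[-1,0]$. (1) If $\Phi$ is completely positive, then $(A,B)\in\mathbb{P}_n\times\mathbb{P}_m\mapsto\mathrm{Tr}\, f\bigl(\Phi(A^p)^{1/2}\Psi(B^q)\Phi(A^p)^{1/2}\bigr)$ is jointly convex. (2) If $n=l$ and $\Phi=\mathrm{id}$, then $(A,B)\in\mathbb{P}_n\times\mathbb{P}_m\mapsto\mathrm{Tr}\, f\bigl((\Phi(A^{-p})^{1/2}\Psi(B^{-q})\Phi(A^{-p})^{1/2})^{-1}\bigr)$ is jointly convex.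
   Context: $\mathbb{M}_n$: $n\times n$ complex matrices; $\mathbb{P}_n$: positive definite ones; $\mathrm{Tr}$: usual trace. A linear map is strictly positive if it maps positive definite matrices to positive definite matrices. *)

theory Defs
  imports "HOL-Analysis.Convex" "Jordan_Normal_Form.Matrix" "Jordan_Normal_Form.Schur_Decomposition"
begin

text \<open>Matrices over the complex numbers, using the Jordan_Normal_Form matrix type
  (dimensions are values, so n, m, l can be arbitrary natural numbers).\<close>

definition mtrace :: "complex mat \<Rightarrow> complex" where
  "mtrace A = (\<Sum>i<dim_row A. A $$ (i,i))"

definition hermitian_mat :: "nat \<Rightarrow> complex mat \<Rightarrow> bool" where
  "hermitian_mat n A \<longleftrightarrow> A \<in> carrier_mat n n \<and> mat_adjoint A = A"

definition posdef_mat :: "nat \<Rightarrow> complex mat \<Rightarrow> bool" where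
  "posdef_mat n A \<longleftrightarrow> hermitian_mat n A \<and>
     (\<forall>v \<in> carrier_vec n. v \<noteq> 0\<^sub>v n \<longrightarrow> Re (conjugate v \<bullet> (A *\<^sub>v v)) > 0)"

definition possemidef_mat :: "nat \<Rightarrow> complex mat \<Rightarrow> bool" where
  "possemidef_mat n A \<longleftrightarrow> hermitian_mat n A \<and>
     (\<forall>v \<in> carrier_vec n. Re (conjugate v \<bullet> (A *\<^sub>v v)) \<ge> 0)"

definition unitary_mat :: "nat \<Rightarrow> complex mat \<Rightarrow> bool" where
  "unitary_mat n U \<longleftrightarrow> U \<in> carrier_mat n n \<and> U * mat_adjoint U = 1\<^sub>m n \<and> mat_adjoint U * U = 1\<^sub>m n"

definition mat_fun :: "(real \<Rightarrow> real) \<Rightarrow> complex mat \<Rightarrow> complex mat" where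
  "mat_fun f A = (SOME B. \<exists>U (lam :: real list).
      unitary_mat (dim_row A) U \<and> length lam = dim_row A \<and>
      A = U * mk_diagonal (map complex_of_real lam) * mat_adjoint U \<and>
      B = U * mk_diagonal (map (complex_of_real \<circ> f) lam) * mat_adjoint U)"

definition mat_powr :: "complex mat \<Rightarrow> real \<Rightarrow> complex mat" where
  "mat_powr A p = mat_fun (\<lambda>x. x powr p) A"

definition mat_inv :: "complex mat \<Rightarrow> complex mat" where
  "mat_inv A = (THE B. B \<in> carrier_mat (dim_row A) (dim_row A) \<and>
                       A * B = 1\<^sub>m (dim_row A) \<and> B * A = 1\<^sub>m (dim_row A))"

definition linear_mat_map :: "nat \<Rightarrow> nat \<Rightarrow> (complex mat \<Rightarrow> complex mat) \<Rightarrow> bool" where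
  "linear_mat_map n l \<Phi> \<longleftrightarrow>
     (\<forall>X \<in> carrier_mat n n. \<Phi> X \<in> carrier_mat l l) \<and>
     (\<forall>X \<in> carrier_mat n n. \<forall>Y \<in> carrier_mat n n. \<Phi> (X + Y) = \<Phi> X + \<Phi> Y) \<and>
     (\<forall>c. \<forall>X \<in> carrier_mat n n. \<Phi> (c \<cdot>\<^sub>m X) = c \<cdot>\<^sub>m \<Phi> X)"

definition strictly_positive_map :: "nat \<Rightarrow> nat \<Rightarrow> (complex mat \<Rightarrow> complex mat) \<Rightarrow> bool" where
  "strictly_positive_map n l \<Phi> \<longleftrightarrow> (\<forall>X. posdef_mat n X \<longrightarrow> posdef_mat l (\<Phi> X))"

definition mat_block :: "nat \<Rightarrow> complex mat \<Rightarrow> nat \<Rightarrow> nat \<Rightarrow> complex mat" where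
  "mat_block n M i j = mat n n (\<lambda>(a,b). M $$ (i*n + a, j*n + b))"

text \<open>id_k \<otimes> \<Phi>, for \<Phi> : M_n \<rightarrow> M_l, applied to a k\<times>k block matrix with n\<times>n blocks.\<close>
definition ampliation :: "nat \<Rightarrow> nat \<Rightarrow> nat \<Rightarrow> (complex mat \<Rightarrow> complex mat) \<Rightarrow> complex mat \<Rightarrow> complex mat" where
  "ampliation k n l \<Phi> M = mat (k*l) (k*l)
     (\<lambda>(r,s). \<Phi> (mat_block n M (r div l) (s div l)) $$ (r mod l, s mod l))"

definition completely_positive_map :: "nat \<Rightarrow> nat \<Rightarrow> (complex mat \<Rightarrow> complex mat) \<Rightarrow> bool" where
  "completely_positive_map n l \<Phi> \<longleftrightarrow>
     (\<forall>k M. possemidef_mat (k*n) M \<longrightarrow> possemidef_mat (k*l) (ampliation k n l \<Phi> M))"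

definition jointly_convex_on_posdef ::
  "nat \<Rightarrow> nat \<Rightarrow> (complex mat \<Rightarrow> complex mat \<Rightarrow> real) \<Rightarrow> bool" where
  "jointly_convex_on_posdef n m F \<longleftrightarrow>
     (\<forall>A1 A2 B1 B2 t. posdef_mat n A1 \<longrightarrow> posdef_mat n A2 \<longrightarrow>
        posdef_mat m B1 \<longrightarrow> posdef_mat m B2 \<longrightarrow> 0 \<le> t \<longrightarrow> t \<le> 1 \<longrightarrow>
        F (complex_of_real t \<cdot>\<^sub>m A1 + complex_of_real (1 - t) \<cdot>\<^sub>m A2)
          (complex_of_real t \<cdot>\<^sub>m B1 + complex_of_real (1 - t) \<cdot>\<^sub>m B2)
        \<le> t * F A1 B1 + (1 - t) * F A2 B2)"

end

theory Submission
  imports "HOL-Analysis.Equivalence_Lebesgue_Henstock_Integration" Defs "Jordan_Normal_Form.Spectral_Radius"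
begin

text \<open>
  Put \<open>g x = f (x powr (p - 1))\<close>, which is convex and non-decreasing, and let
  \<open>N = T\<^sup>1\<^sup>/\<^sup>2 C\<^sup>-\<^sup>1 T\<^sup>1\<^sup>/\<^sup>2\<close> for positive definite \<open>T\<close> and \<open>C\<close>. Then
  \<open>Tr f(N) = sup\<^sub>Z inf\<^sub>X (Tr X\<^sup>1\<^sup>-\<^sup>p Z\<^sup>*TZ + Tr g(X) - Tr Z\<^sup>*CZ)\<close>:
  an optimal \<open>Z\<close> comes from a subgradient of \<open>g\<close> and Klein's inequality, and for given invertible \<open>Z\<close>
  a good \<open>X\<close> is a unitary conjugate of \<open>N\<^sup>1\<^sup>/\<^sup>(\<^sup>p\<^sup>-\<^sup>1\<^sup>)\<close> obtained from the polar decomposition of \<open>T\<^sup>1\<^sup>/\<^sup>2 Z\<close>.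
  With \<open>T = \<Phi>(A\<^sup>p)\<close> the first term is jointly convex in \<open>(A, X)\<close> by Ando's convexity theorem and the
  Kraus representation of \<open>\<Phi>\<close>, the second is convex in \<open>X\<close>, and the third is concave in \<open>B\<close>
  when \<open>C = \<Psi>(B\<^sup>q)\<^sup>-\<^sup>1\<close> or \<open>C = \<Psi>(B\<^sup>-\<^sup>q)\<close>. A partial infimum of a jointly convex function is convex,
  and so is a supremum of convex functions.

  Ando's theorem and operator concavity of powers both follow from
  \<open>u\<^sup>r = c \<integral> s\<^sup>r\<^sup>-\<^sup>1 u / (u + s) ds\<close>, which reduces them to the joint convexity of \<open>a\<^sup>2 / (\<mu>a + \<nu>x)\<close>.
\<close>

text \<open>The product N couples \<open>A\<close> and \<open>B\<close> through matrices that do not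
  commute, so no convexity is visible in it. For fixed \<open>Z\<close> the variational expression
  separates: one term sees only \<open>A\<close> and \<open>X\<close>, one only \<open>X\<close>,
  one only \<open>B\<close>. Its exponents come from the scalar case: at x = \<nu>^(1/(p-1)) one has
  x^(1-p) = 1/\<nu> and g x = f \<nu>, so for every \<open>Z\<close> the first and last terms cancel
  and f \<nu> remains. For T = A^p the first term is homogeneous of degree one in (A, X), and 1 < p
  \<le> 2 is the range in which Ando's theorem makes it jointly convex. Monotonicity of f enters as
  nonnegativity of the subgradients of g: the optimal \<open>Z\<close> is built from the square root
  of a multiple of a subgradient. Only three evaluations are compared. A \<open>Z\<close> that is
  good at the mixed point bounds the left-hand side for every \<open>X\<close>. With that same
  \<open>Z\<close>, matrices \<open>X1\<close> and \<open>X2\<close> are found for which the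
  expressions at the two end points equal the traces on the right. The bound is then used at the
  mixture of \<open>X1\<close> and \<open>X2\<close>.\<close>

unbundle no vec_syntax

subsection \<open>Scalar inequalities and an integral representation of powers\<close>

text \<open>The substitution s \<rightarrow> u s shows that the integral scales as
  \<open>u powr r\<close>, so \<open>c\<close> is its value at \<open>u = 1\<close> (classically
  \<pi> / sin(\<pi> r)); only \<open>0 < c\<close> and finiteness matter. Finiteness follows by
  comparison with \<open>s powr (r - 1)\<close> near 0 and \<open>s powr (r - 2)\<close> near
  infinity, and \<open>c\<close> is nonzero because the integrand is positive on (0, 1).\<close>

lemma powr_integral_representation:
  fixes r :: real
  assumes r: "0 < r" "r < 1"
  obtains c where "c > 0"
    "\<And>u. u > 0 \<Longrightarrow> ((\<lambda>s. s powr (r - 1) * (u / (u + s))) has_integral c * u powr r) {0<..}"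
proof -
  define h :: "real \<Rightarrow> real \<Rightarrow> real"
    where "h u s = indicat_real {0<..} s * (s powr (r - 1) * (u / (u + s)))" for u s
  define J where "J u = (\<integral>\<^sup>+ s. ennreal (h u s) \<partial>lborel)" for u
  have h_meas [measurable]: "h u \<in> borel_measurable borel" for u
    unfolding h_def by measurable
  have h_nonneg: "0 \<le> h u s" if "u > 0" for u s
    using that by (auto simp: h_def indicator_def)
  have J_scale: "J u = ennreal (u powr r) * J 1" if u: "u > 0" for u
  proof -
    have "J u = ennreal \<bar>u\<bar> * (\<integral>\<^sup>+ s. ennreal (h u (0 + u * s)) \<partial>lborel)"
      unfolding J_def using u by (intro nn_integral_real_affine) auto
    also have "(\<lambda>s. ennreal (h u (0 + u * s))) = (\<lambda>s. ennreal (u powr (r - 1)) * ennreal (h 1 s))"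
    proof
      fix s
      have "u / (u + u * s) = 1 / (1 + s)"
        using u by (metis distrib_left mult.right_neutral nonzero_mult_divide_mult_cancel_left less_irrefl)
      hence "h u (0 + u * s) = u powr (r - 1) * h 1 s"
        using u by (auto simp: h_def indicator_def powr_mult zero_less_mult_iff)
      thus "ennreal (h u (0 + u * s)) = ennreal (u powr (r - 1)) * ennreal (h 1 s)"
        by (simp add: ennreal_mult h_nonneg)
    qed
    also have "(\<integral>\<^sup>+ s. ennreal (u powr (r - 1)) * ennreal (h 1 s) \<partial>lborel)
      = ennreal (u powr (r - 1)) * J 1"
      unfolding J_def by (intro nn_integral_cmult) measurable
    finally show ?thesis
      using u by (simp add: mult.assoc[symmetric] ennreal_mult'[symmetric] powr_mult_base)
  qed
  have "J 1 \<le> (\<integral>\<^sup>+ s. ennreal (indicat_real {0..1} s * s powr (r - 1))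
      + ennreal (indicat_real {1..} s * s powr (r - 2)) \<partial>lborel)"
    unfolding J_def
  proof (rule nn_integral_mono)
    fix s :: real
    show "ennreal (h 1 s) \<le> ennreal (indicat_real {0..1} s * s powr (r - 1))
      + ennreal (indicat_real {1..} s * s powr (r - 2))"
    proof (cases "0 < s")
      case s: True
      have "s powr (r - 2) = s powr (r - 1) * (1 / s)"
        using s powr_diff[of s "r - 1" 1] by simp
      moreover have "s powr (r - 1) * (1 / (1 + s)) \<le> s powr (r - 1) * 1"
        "s powr (r - 1) * (1 / (1 + s)) \<le> s powr (r - 1) * (1 / s)"
        using s by (intro mult_left_mono; simp add: field_simps)+
      ultimately have "h 1 s \<le> indicat_real {0..1} s * s powr (r - 1)
          + indicat_real {1..} s * s powr (r - 2)"
        using s by (auto simp: h_def indicator_def)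
      hence "ennreal (h 1 s) \<le> ennreal (indicat_real {0..1} s * s powr (r - 1)
          + indicat_real {1..} s * s powr (r - 2))"
        by (rule ennreal_leI)
      thus ?thesis by (subst (asm) ennreal_plus) auto
    qed (simp add: h_def)
  qed
  also have "\<dots> = (\<integral>\<^sup>+ s. ennreal (indicat_real {0..1} s * s powr (r - 1)) \<partial>lborel)
      + (\<integral>\<^sup>+ s. ennreal (indicat_real {1..} s * s powr (r - 2)) \<partial>lborel)"
    by (intro nn_integral_add) measurable
  also have "\<dots> < \<infinity>"
    using nn_integral_has_integral_lebesgue[OF _ has_integral_powr_from_0[of "r - 1" 1]]
      nn_integral_has_integral_lebesgue[OF _ has_integral_powr_to_inf[of "r - 2" 1]] r
    by simp
  finally have J_fin: "J 1 < \<infinity>" .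
  have "J 1 \<noteq> 0"
  proof
    assume "J 1 = 0"
    hence "AE s in lborel. ennreal (h 1 s) = 0"
      unfolding J_def by (subst (asm) nn_integral_0_iff_AE) auto
    hence "AE s in lborel. s \<notin> {0<..<1::real}"
      by eventually_elim
        (auto simp: h_def ennreal_eq_0_iff indicator_def divide_le_0_iff not_le dest: powr_gt_zero[THEN iffD2])
    hence "emeasure lborel {0<..<1::real} = 0"
      by (subst (asm) AE_iff_measurable[of "{0<..<1}"]) auto
    thus False by simp
  qed
  with J_fin obtain c where c: "c > 0" "J 1 = ennreal c"
    by (metis ennreal_cases ennreal_0 infinity_ennreal_def less_irrefl less_le)
  have "((\<lambda>s. s powr (r - 1) * (u / (u + s))) has_integral c * u powr r) {0<..}" if u: "u > 0" for u
  proof -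
    have "(h u has_integral c * u powr r) UNIV"
      using J_scale[OF u] c u h_nonneg[OF u] unfolding J_def
      by (intro nn_integral_has_integral) (auto simp: ennreal_mult'[symmetric] mult.commute)
    moreover have "h u = (\<lambda>s. if s \<in> {0<..} then s powr (r - 1) * (u / (u + s)) else 0)"
      by (auto simp: h_def)
    ultimately show ?thesis
      by (simp only: has_integral_restrict_UNIV)
  qed
  with c(1) show thesis by (rule that)
qed

text \<open>The infimum of the difference quotients to the right of \<open>x\<close> is the right
  derivative, which is a subgradient; for a non-decreasing \<open>g\<close> all these quotients are
  nonnegative, hence so is their infimum.\<close>

lemma convex_subgradient_exists:
  fixes g :: "real \<Rightarrow> real"
  assumes conv: "convex_on {0<..} g" and mono: "mono_on {0<..} g"
  obtains d where "\<And>x. x > 0 \<Longrightarrow> d x \<ge> 0"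
    "\<And>x y. x > 0 \<Longrightarrow> y > 0 \<Longrightarrow> g y \<ge> g x + d x * (y - x)"
proof -
  define d where "d x = (INF t\<in>{x<..} \<inter> {0<..}. (g x - g t) / (x - t))" for x
  have "d x \<ge> 0" if "x > 0" for x
    unfolding d_def
  proof (rule cINF_greatest)
    show "{x<..} \<inter> {0<..} \<noteq> {}"
      using gt_ex[of x] that by (metis Int_iff emptyE greaterThan_iff less_trans)
    show "0 \<le> (g x - g t) / (x - t)" if "t \<in> {x<..} \<inter> {0<..}" for t
      using that \<open>x > 0\<close> mono by (auto simp: mono_on_def divide_simps)
  qed
  moreover have "g y \<ge> g x + d x * (y - x)" if "x > 0" "y > 0" for x y
    unfolding d_def using that by (intro convex_le_Inf_differential[OF conv]) (auto simp: interior_open)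
  ultimately show thesis by (rule that)
qed

text \<open>The tangent at \<open>u = 1\<close> of the convex function \<open>u powr (-a)\<close>,
  from \<open>ln u \<le> u - 1\<close> followed by \<open>1 + y \<le> exp y\<close>.\<close>

lemma powr_neg_ge_tangent:
  fixes u a :: real
  assumes "u > 0" "a > 0"
  shows "u powr (-a) \<ge> 1 - a * (u - 1)"
proof -
  have "1 - a * (u - 1) \<le> 1 - a * ln u"
    using assms ln_le_minus_one[of u] by simp
  also have "\<dots> \<le> exp (- a * ln u)"
    using exp_ge_add_one_self[of "- a * ln u"] by simp
  finally show ?thesis using assms by (simp add: powr_def)
qed

subsection \<open>Matrix algebra and the spectral theorem\<close>

abbreviation adj :: "complex mat \<Rightarrow> complex mat" (\<open>_\<^sup>H\<close> [1000] 999)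
  where "A\<^sup>H \<equiv> mat_adjoint A"

lemma adj_dim [simp]: "dim_row (A\<^sup>H) = dim_col A" "dim_col (A\<^sup>H) = dim_row A"
  by (auto simp: mat_adjoint_def)

lemma adj_index [simp]: "i < dim_col A \<Longrightarrow> j < dim_row A \<Longrightarrow> A\<^sup>H $$ (i, j) = cnj (A $$ (j, i))"
  by (simp add: mat_adjoint_def mat_of_rows_def)

lemma mult_index: "i < dim_row A \<Longrightarrow> j < dim_col B \<Longrightarrow> dim_col A = dim_row B \<Longrightarrow>
    (A * B) $$ (i, j) = (\<Sum>k<dim_row B. A $$ (i, k) * B $$ (k, j))"
  for A B :: "complex mat"
  by (simp add: scalar_prod_def atLeast0LessThan)

declare index_mult_mat(1) [simp del]

text \<open>Dimension equations in place of carrier sets let rewriting discharge the side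
  conditions. Used from left to right it nests products to the right, which is the normal form of
  products throughout.\<close>

lemma mult_assoc_dim: "dim_col A = dim_row B \<Longrightarrow> dim_col B = dim_row C \<Longrightarrow> A * B * C = A * (B * C)"
  for A B C :: "complex mat"
  by (rule assoc_mult_mat[of _ "dim_row A" "dim_col A" _ "dim_col B" _ "dim_col C"]) auto

lemma one_mult_dim [simp]:
  "dim_row A = n \<Longrightarrow> 1\<^sub>m n * A = A" "dim_col A = n \<Longrightarrow> A * 1\<^sub>m n = A" for A :: "complex mat"
  by (auto intro!: left_mult_one_mat[of _ _ "dim_col A"] right_mult_one_mat[of _ "dim_row A"])

lemma mult_add_dim:
  fixes A B C D :: "complex mat"
  assumes "dim_row A = dim_row B" "dim_col A = dim_col B"
  shows "dim_col C = dim_row B \<Longrightarrow> C * (A + B) = C * A + C * B"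
    "dim_row D = dim_col B \<Longrightarrow> (A + B) * D = A * D + B * D"
proof -
  have c: "A \<in> carrier_mat (dim_row B) (dim_col B)" "B \<in> carrier_mat (dim_row B) (dim_col B)"
    using assms by (auto intro: carrier_matI)
  show "C * (A + B) = C * A + C * B" if "dim_col C = dim_row B"
    using that by (intro mult_add_distrib_mat[OF _ c] carrier_matI) auto
  show "(A + B) * D = A * D + B * D" if "dim_row D = dim_col B"
    using that by (intro add_mult_distrib_mat[OF c] carrier_matI) auto
qed

lemma mult_smult_dim:
  "dim_col A = dim_row B \<Longrightarrow> A * (c \<cdot>\<^sub>m B) = c \<cdot>\<^sub>m (A * B)"
  "dim_col A = dim_row B \<Longrightarrow> (c \<cdot>\<^sub>m A) * B = c \<cdot>\<^sub>m (A * B)"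
  for A B :: "complex mat"
  by (auto intro!: mult_smult_distrib[of _ "dim_row A" "dim_col A" _ "dim_col B"]
      mult_smult_assoc_mat[of _ "dim_row A" "dim_col A" _ "dim_col B"])

lemma adj_adj [simp]: "(A\<^sup>H)\<^sup>H = A"
  by (rule eq_matI) auto

lemma adj_mult: "dim_col A = dim_row B \<Longrightarrow> (A * B)\<^sup>H = B\<^sup>H * A\<^sup>H"
  by (rule eq_matI) (auto simp: mult_index mult.commute)

lemma adj_add: "dim_row A = dim_row B \<Longrightarrow> dim_col A = dim_col B \<Longrightarrow> (A + B)\<^sup>H = A\<^sup>H + B\<^sup>H"
  by (rule eq_matI) auto

lemma adj_smult: "(c \<cdot>\<^sub>m A)\<^sup>H = cnj c \<cdot>\<^sub>m A\<^sup>H"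
  by (rule eq_matI) auto

lemma adj_one [simp]: "(1\<^sub>m n)\<^sup>H = 1\<^sub>m n"
  by (rule eq_matI) auto

lemma mtrace_mult_comm:
  assumes "dim_col A = dim_row B" "dim_col B = dim_row A"
  shows "mtrace (A * B) = mtrace (B * A)"
proof -
  have "mtrace (A * B) = (\<Sum>i<dim_row A. \<Sum>k<dim_row B. A $$ (i, k) * B $$ (k, i))"
    using assms by (simp add: mtrace_def mult_index)
  also have "\<dots> = (\<Sum>k<dim_row B. \<Sum>i<dim_row A. B $$ (k, i) * A $$ (i, k))"
    by (subst sum.swap) (simp add: mult.commute)
  finally show ?thesis
    using assms by (simp add: mtrace_def mult_index)
qed

lemma mtrace_add: "dim_row A = dim_row B \<Longrightarrow> dim_col B = dim_row B \<Longrightarrow> mtrace (A + B) = mtrace A + mtrace B"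
  by (simp add: mtrace_def sum.distrib)

lemma mtrace_smult: "dim_col A = dim_row A \<Longrightarrow> mtrace (c \<cdot>\<^sub>m A) = c * mtrace A"
  by (simp add: mtrace_def sum_distrib_left)

lemma mtrace_adj: "dim_col A = dim_row A \<Longrightarrow> mtrace (A\<^sup>H) = cnj (mtrace A)"
  by (simp add: mtrace_def)

section \<open>Real diagonal matrices, indexed by functions rather than lists\<close>

definition diagm :: "nat \<Rightarrow> (nat \<Rightarrow> real) \<Rightarrow> complex mat" where
  "diagm n d = mat n n (\<lambda>(i, j). if i = j then complex_of_real (d i) else 0)"

lemma diagm_dim [simp]: "dim_row (diagm n d) = n" "dim_col (diagm n d) = n"
  "diagm n d \<in> carrier_mat n n"
  by (auto simp: diagm_def)

lemma diagm_index [simp]: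
  "i < n \<Longrightarrow> j < n \<Longrightarrow> diagm n d $$ (i, j) = (if i = j then complex_of_real (d i) else 0)"
  by (simp add: diagm_def)

lemma diagm_adj [simp]: "(diagm n d)\<^sup>H = diagm n d"
  by (rule eq_matI) auto

lemma diagm_mult_index:
  assumes "i < n" "dim_row Z = n" "j < dim_col Z"
  shows "(diagm n d * Z) $$ (i, j) = d i * Z $$ (i, j)"
proof -
  have "(diagm n d * Z) $$ (i, j) = (\<Sum>k<n. if k = i then d i * Z $$ (k, j) else 0)"
    using assms by (auto simp: mult_index simp del: sum.delta sum.delta' intro!: sum.cong)
  thus ?thesis using assms by simp
qed

lemma mult_diagm_index:
  assumes "j < n" "dim_col Z = n" "i < dim_row Z"
  shows "(Z * diagm n d) $$ (i, j) = Z $$ (i, j) * d j"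
proof -
  have "(Z * diagm n d) $$ (i, j) = (\<Sum>k<n. if k = j then Z $$ (i, k) * d j else 0)"
    using assms by (auto simp: mult_index simp del: sum.delta sum.delta' intro!: sum.cong)
  thus ?thesis using assms by simp
qed

lemma diagm_mult: "diagm n d * diagm n e = diagm n (\<lambda>i. d i * e i)"
  by (rule eq_matI) (auto simp: diagm_mult_index)

lemma diagm_mult_left: "dim_row Z = n \<Longrightarrow> diagm n d * (diagm n e * Z) = diagm n (\<lambda>i. d i * e i) * Z"
  by (simp add: mult_assoc_dim[symmetric] diagm_mult)

lemma diagm_one: "(\<And>i. i < n \<Longrightarrow> d i = 1) \<Longrightarrow> diagm n d = 1\<^sub>m n"
  by (rule eq_matI) auto

lemma diagm_cong: "(\<And>i. i < n \<Longrightarrow> d i = e i) \<Longrightarrow> diagm n d = diagm n e"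
  by (rule eq_matI) auto

lemma mk_diagonal_index:
  "i < length xs \<Longrightarrow> j < length xs \<Longrightarrow> mk_diagonal xs $$ (i, j) = (if i = j then xs ! i else 0)"
proof (induct xs arbitrary: i j)
  case (Cons x xs)
  have d: "dim_row (diag_block_mat (map (\<lambda>a. mat (Suc 0) (Suc 0) (\<lambda>_. a)) xs)) = length xs"
    "dim_col (diag_block_mat (map (\<lambda>a. mat (Suc 0) (Suc 0) (\<lambda>_. a)) xs)) = length xs"
    using mk_diagonal_dim[of xs] by (simp_all add: mk_diagonal_def)
  show ?case
    using Cons by (cases i; cases j) (auto simp: mk_diagonal_def Let_def d)
qed simp

lemma mk_diagonal_diagm:
  "mk_diagonal (map complex_of_real lam) = diagm (length lam) (\<lambda>i. lam ! i)"
  by (rule eq_matI) (auto simp: mk_diagonal_index mk_diagonal_dim)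

lemma mtrace_diagm: "mtrace (diagm n d) = (\<Sum>i<n. complex_of_real (d i))"
  by (simp add: mtrace_def)

lemma cnj_mult_self: "cnj w * w = complex_of_real ((cmod w)\<^sup>2)"
  by (simp add: complex_norm_square[unfolded of_real_power] mult.commute)

text \<open>One diagonal factor acts on the column index and the other on the row index, so each
  entry just receives the product of the two weights. All later double sums over pairs of
  eigenvalues originate here.\<close>

lemma mtrace_diagm_sandwich:
  assumes "dim_row P = n" "dim_col P = l" "dim_row Q = n" "dim_col Q = l"
  shows "mtrace (diagm l \<alpha> * (P\<^sup>H * (diagm n \<beta> * Q)))
    = (\<Sum>i<l. \<Sum>j<n. complex_of_real (\<alpha> i * \<beta> j) * (cnj (P $$ (j, i)) * Q $$ (j, i)))"
proof -
  have "(diagm l \<alpha> * (P\<^sup>H * (diagm n \<beta> * Q))) $$ (i, i)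
    = (\<Sum>j<n. complex_of_real (\<alpha> i * \<beta> j) * (cnj (P $$ (j, i)) * Q $$ (j, i)))" if "i < l" for i
    using assms that
    by (simp add: diagm_mult_index mult_index[of i "P\<^sup>H"] sum_distrib_left mult_ac
       )
  thus ?thesis using assms by (simp add: mtrace_def)
qed

section \<open>Unitary matrices\<close>

lemma unitaryD:
  assumes "unitary_mat n U"
  shows "dim_row U = n" "dim_col U = n" "U * U\<^sup>H = 1\<^sub>m n" "U\<^sup>H * U = 1\<^sub>m n"
    "dim_row Z = n \<Longrightarrow> U * (U\<^sup>H * Z) = Z" "dim_row Z = n \<Longrightarrow> U\<^sup>H * (U * Z) = Z"
proof -
  show d: "dim_row U = n" "dim_col U = n" and u: "U * U\<^sup>H = 1\<^sub>m n" "U\<^sup>H * U = 1\<^sub>m n"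
    using assms by (auto simp: unitary_mat_def)
  show "dim_row Z = n \<Longrightarrow> U * (U\<^sup>H * Z) = Z" "dim_row Z = n \<Longrightarrow> U\<^sup>H * (U * Z) = Z"
    using mult_assoc_dim[of U "U\<^sup>H" Z] mult_assoc_dim[of "U\<^sup>H" U Z] d u by simp_all
qed

lemma unitary_leftI:
  assumes "dim_row U = n" "dim_col U = n" "U\<^sup>H * U = 1\<^sub>m n"
  shows "unitary_mat n U"
proof -
  have "U \<in> carrier_mat n n" "U\<^sup>H \<in> carrier_mat n n" using assms by (auto intro: carrier_matI)
  thus ?thesis
    using mat_mult_left_right_inverse[of "U\<^sup>H" n U] assms(3) by (simp add: unitary_mat_def)
qed

lemma unitary_mult:
  assumes "unitary_mat n U" "unitary_mat n V"
  shows "unitary_mat n (U * V)"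
  by (rule unitary_leftI)
    (simp_all add: adj_mult mult_assoc_dim unitaryD[OF assms(1)] unitaryD[OF assms(2)])

section \<open>Unitary diagonalization of Hermitian matrices\<close>

definition eig :: "nat \<Rightarrow> complex mat \<Rightarrow> complex mat \<Rightarrow> (nat \<Rightarrow> real) \<Rightarrow> bool" where
  "eig n A U d \<longleftrightarrow> unitary_mat n U \<and> A = U * (diagm n d * U\<^sup>H)"

text \<open>The block sum of the scalar \<open>a\<close> and the matrix \<open>M\<close>: the shape
  of a Hermitian matrix once one eigenvector has been split off.\<close>

definition border :: "nat \<Rightarrow> complex \<Rightarrow> complex mat \<Rightarrow> complex mat" where
  "border n a M = mat (Suc n) (Suc n)
     (\<lambda>(i, j). if i = 0 \<and> j = 0 then a else if i = 0 \<or> j = 0 then 0 else M $$ (i - 1, j - 1))"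

lemma border_dim [simp]: "dim_row (border n a M) = Suc n" "dim_col (border n a M) = Suc n"
  by (auto simp: border_def)

lemma border_index: "border n a M $$ (0, 0) = a"
  "i < n \<Longrightarrow> border n a M $$ (Suc i, 0) = 0" "i < n \<Longrightarrow> border n a M $$ (0, Suc i) = 0"
  "i < n \<Longrightarrow> j < n \<Longrightarrow> border n a M $$ (Suc i, Suc j) = M $$ (i, j)"
  by (auto simp: border_def)

lemma border_mult:
  assumes "dim_row M = n" "dim_col M = n" "dim_row M' = n" "dim_col M' = n"
  shows "border n a M * border n b M' = border n (a * b) (M * M')"
proof (rule eq_matI)
  fix i j assume "i < dim_row (border n (a * b) (M * M'))" "j < dim_col (border n (a * b) (M * M'))"
  thus "(border n a M * border n b M') $$ (i, j) = border n (a * b) (M * M') $$ (i, j)"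
    using assms
    by (cases i; cases j) (auto simp: mult_index sum.lessThan_Suc_shift border_index
        simp del: sum.lessThan_Suc)
qed auto

lemma border_adj: "dim_row M = n \<Longrightarrow> dim_col M = n \<Longrightarrow> (border n a M)\<^sup>H = border n (cnj a) (M\<^sup>H)"
  by (rule eq_matI) (auto simp: border_def)

lemma border_one: "border n 1 (1\<^sub>m n) = 1\<^sub>m (Suc n)"
  by (rule eq_matI) (auto simp: border_def)

lemma border_diagm: "border n (complex_of_real a) (diagm n d) = diagm (Suc n) (\<lambda>i. case i of 0 \<Rightarrow> a | Suc j \<Rightarrow> d j)"
  by (rule eq_matI) (auto simp: border_def split: nat.split)

text \<open>Complete \<open>v\<close> to a basis, apply Gram-Schmidt, which keeps the first vector,
  and normalize the resulting orthogonal columns; \<open>c\<close> is the reciprocal of the norm of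
  \<open>v\<close>.\<close>

lemma unitary_first_col:
  assumes v: "v \<in> carrier_vec n" "v \<noteq> 0\<^sub>v n"
  obtains U c where "unitary_mat n U" "c \<noteq> 0" "\<And>i. i < n \<Longrightarrow> U $$ (i, 0) = c * v $ i"
proof -
  interpret cof_vec_space n "TYPE(complex)" .
  define us where "us = gram_schmidt n (basis_completion v)"
  note bc = basis_completion[OF v]
  note gs = gram_schmidt_result[OF bc(2,4,5) us_def]
  have n0: "n > 0" using v by (cases n) auto
  have len: "length us = n" using gs(4) bc(6) by simp
  have hd: "us ! 0 = v"
  proof -
    obtain vs where "basis_completion v = v # vs"
      using bc(6,7) n0 by (cases "basis_completion v") auto
    hence "hd us = v" unfolding us_def using gram_schmidt_hd[OF v(1)] by simp
    thus ?thesis using len n0 hd_conv_nth[of us] by (cases us) auto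
  qed
  have us_c: "us ! i \<in> carrier_vec n" if "i < n" for i using gs(3) len that by auto
  define nr where "nr i = sqrt (\<Sum>k<n. (cmod (us ! i $ k))\<^sup>2)" for i
  have ip: "us ! j \<bullet>c us ! i = (\<Sum>k<n. cnj (us ! i $ k) * us ! j $ k)" if "i < n" "j < n" for i j
    using us_c[OF that(1)] us_c[OF that(2)]
    by (simp add: scalar_prod_def atLeast0LessThan mult.commute)
  have nr2: "(\<Sum>k<n. cnj (us ! i $ k) * us ! i $ k) = complex_of_real ((nr i)\<^sup>2)" for i
    by (simp add: nr_def sum_nonneg complex_norm_square[unfolded of_real_power] mult.commute)
  have nr0: "nr i \<noteq> 0" if "i < n" for i
    using corthogonalD[OF gs(2), of i i] ip[OF that that] nr2[of i] that len by auto
  define U where "U = mat n n (\<lambda>(k, i). us ! i $ k / complex_of_real (nr i))"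
  have [simp]: "dim_row U = n" "dim_col U = n" by (auto simp: U_def)
  have "U\<^sup>H * U = 1\<^sub>m n"
  proof (rule eq_matI)
    fix i j assume "i < dim_row (1\<^sub>m n :: complex mat)" "j < dim_col (1\<^sub>m n :: complex mat)"
    hence ij: "i < n" "j < n" by auto
    have "(U\<^sup>H * U) $$ (i, j) = (\<Sum>k<n. cnj (us ! i $ k) * us ! j $ k) / (nr i * nr j)"
      using ij by (simp add: mult_index U_def sum_divide_distrib)
    also have "\<dots> = 1\<^sub>m n $$ (i, j)"
    proof (cases "i = j")
      case True
      thus ?thesis using nr2[of i] nr0[OF ij(1)] ij by (simp add: power2_eq_square)
    next
      case False
      thus ?thesis using ip[OF ij] corthogonalD[OF gs(2), of j i] ij len by simp
    qed
    finally show "(U\<^sup>H * U) $$ (i, j) = 1\<^sub>m n $$ (i, j)" .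
  qed auto
  hence "unitary_mat n U" by (intro unitary_leftI) auto
  moreover have "U $$ (i, 0) = complex_of_real (1 / nr 0) * v $ i" if "i < n" for i
    using that n0 hd by (simp add: U_def)
  ultimately show thesis using nr0[OF n0] by (intro that[of U "complex_of_real (1 / nr 0)"]) auto
qed

text \<open>Deflation by induction on the dimension. A unitary \<open>U\<close> whose first column
  is an eigenvector makes the first column of \<open>U\<^sup>H * (A * U)\<close> vanish below the
  corner, and Hermitian symmetry then clears the first row. The remaining minor is Hermitian and is
  diagonalized by the induction hypothesis.\<close>

lemma hermitian_eig:
  "hermitian_mat n A \<Longrightarrow> \<exists>U d. eig n A U d"
proof (induct n arbitrary: A)
  case 0
  hence "A = 1\<^sub>m 0 * (diagm 0 (\<lambda>_. 0) * (1\<^sub>m 0)\<^sup>H)"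
    by (intro eq_matI) (auto simp: hermitian_mat_def)
  thus ?case by (intro exI[of _ "1\<^sub>m 0"] exI[of _ "\<lambda>_. 0"]) (auto simp: eig_def unitary_mat_def)
next
  case (Suc n)
  have A: "A \<in> carrier_mat (Suc n) (Suc n)" "A\<^sup>H = A" using Suc(2) by (auto simp: hermitian_mat_def)
  have Ad [simp]: "dim_row A = Suc n" "dim_col A = Suc n" using A by auto
  from spectrum_non_empty[OF A(1)] obtain k v where "eigenvector A v k"
    by (auto simp: spectrum_def eigenvalue_def)
  hence v: "v \<in> carrier_vec (Suc n)" "v \<noteq> 0\<^sub>v (Suc n)" and Av: "A *\<^sub>v v = k \<cdot>\<^sub>v v"
    by (auto simp: eigenvector_def)
  obtain U c where U: "unitary_mat (Suc n) U" "c \<noteq> 0" "\<And>i. i < Suc n \<Longrightarrow> U $$ (i, 0) = c * v $ i"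
    using unitary_first_col[OF v] by blast
  note Ud = unitaryD[OF U(1)]
  define M where "M = U\<^sup>H * (A * U)"
  have Md [simp]: "dim_row M = Suc n" "dim_col M = Suc n" by (auto simp: M_def Ud)
  have MH: "M\<^sup>H = M" by (simp add: M_def adj_mult Ud A mult_assoc_dim)
  have AU0: "(A * U) $$ (i, 0) = k * U $$ (i, 0)" if i: "i < Suc n" for i
  proof -
    have "(A * U) $$ (i, 0) = c * (A *\<^sub>v v) $ i"
      using i v Ud U(3)
      by (simp add: mult_index scalar_prod_def atLeast0LessThan sum_distrib_left mult_ac
          del: sum.lessThan_Suc)
    thus ?thesis using i v by (simp add: Av U(3))
  qed
  have M0: "M $$ (i, 0) = (if i = 0 then k else 0)" if i: "i < Suc n" for i
  proof -
    have "M $$ (i, 0) = k * (U\<^sup>H * U) $$ (i, 0)"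
      using i Ud(1,2) AU0
      by (simp add: M_def mult_index[of i "U\<^sup>H"] sum_distrib_left mult_ac
          del: sum.lessThan_Suc)
    thus ?thesis using i by (simp add: Ud)
  qed
  have M0': "M $$ (0, i) = cnj (M $$ (i, 0))" if "i < Suc n" for i
    using that by (subst MH[symmetric]) simp
  \<comment> \<open>The corner entry of a Hermitian matrix equals its own conjugate, so the
    eigenvalue is real.\<close>
  have kr: "k = complex_of_real (Re k)"
    using M0[of 0] M0'[of 0] by (simp add: complex_eq_iff)
  define M' where "M' = mat n n (\<lambda>(i, j). M $$ (Suc i, Suc j))"
  have [simp]: "dim_row M' = n" "dim_col M' = n" by (auto simp: M'_def)
  have "M'\<^sup>H = M'"
  proof (rule eq_matI)
    fix i j assume "i < dim_row M'" "j < dim_col M'"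
    thus "M'\<^sup>H $$ (i, j) = M' $$ (i, j)"
      using arg_cong[OF MH, of "\<lambda>M. M $$ (Suc i, Suc j)"] by (simp add: M'_def)
  qed auto
  hence "hermitian_mat n M'" by (auto simp: hermitian_mat_def)
  from Suc(1)[OF this] obtain V d where V: "eig n M' V d" by blast
  hence uV: "unitary_mat n V" and M'V: "M' = V * (diagm n d * V\<^sup>H)" by (auto simp: eig_def)
  note Vd = unitaryD[OF uV]
  have MB: "M = border n (complex_of_real (Re k)) M'"
  proof (rule eq_matI)
    fix i j assume "i < dim_row (border n (complex_of_real (Re k)) M')"
      "j < dim_col (border n (complex_of_real (Re k)) M')"
    thus "M $$ (i, j) = border n (complex_of_real (Re k)) M' $$ (i, j)"
      using M0 M0' kr by (cases i; cases j) (auto simp: border_index M'_def)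
  qed auto
  define W where "W = border n 1 V"
  have Wd [simp]: "dim_row W = Suc n" "dim_col W = Suc n" by (auto simp: W_def)
  have uW: "unitary_mat (Suc n) W"
    using Vd by (intro unitary_leftI) (auto simp: W_def border_adj border_mult border_one)
  have "M = W * (border n (complex_of_real (Re k)) (diagm n d) * W\<^sup>H)"
    unfolding MB M'V W_def using Vd by (simp add: border_adj border_mult)
  hence MW: "M = W * (diagm (Suc n) (\<lambda>i. case i of 0 \<Rightarrow> Re k | Suc j \<Rightarrow> d j) * W\<^sup>H)"
    by (simp add: border_diagm)
  have "A = U * (M * U\<^sup>H)"
    using Ud by (simp add: M_def mult_assoc_dim)
  also have "\<dots> = (U * W) * (diagm (Suc n) (\<lambda>i. case i of 0 \<Rightarrow> Re k | Suc j \<Rightarrow> d j) * (U * W)\<^sup>H)"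
    unfolding MW using Ud by (simp add: mult_assoc_dim adj_mult)
  finally have "eig (Suc n) A (U * W) (\<lambda>i. case i of 0 \<Rightarrow> Re k | Suc j \<Rightarrow> d j)"
    using unitary_mult[OF U(1) uW] unfolding eig_def by blast
  thus ?case by blast
qed

subsection \<open>Functional calculus\<close>

lemma eigD:
  assumes "eig n A U d"
  shows "unitary_mat n U" "A = U * (diagm n d * U\<^sup>H)" "dim_row A = n" "dim_col A = n"
    "A \<in> carrier_mat n n" "A\<^sup>H = A"
proof -
  show u: "unitary_mat n U" and A: "A = U * (diagm n d * U\<^sup>H)" using assms by (auto simp: eig_def)
  show d: "dim_row A = n" "dim_col A = n" using unitaryD(1,2)[OF u] by (auto simp: A)
  show "A \<in> carrier_mat n n" using d by (rule carrier_matI)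
  show "A\<^sup>H = A" using unitaryD(1,2)[OF u] by (simp add: A adj_mult mult_assoc_dim)
qed

lemma eig_hermitian: "eig n A U d \<Longrightarrow> hermitian_mat n A"
  using eigD by (auto simp: hermitian_mat_def)

text \<open>Writing \<open>W = U\<^sup>H V\<close> for two eigenbases, \<open>W\<close> intertwines the two diagonal matrices, so an entry
  \<open>W\<^sub>i\<^sub>j\<close> can only be non-zero where the eigenvalues agree.\<close>

lemma eig_fun_unique:
  assumes U: "eig n A U d" and V: "eig n A V e"
  shows "U * (diagm n (\<lambda>i. f (d i)) * U\<^sup>H) = V * (diagm n (\<lambda>i. f (e i)) * V\<^sup>H)"
proof -
  note u = unitaryD[OF eigD(1)[OF U]] and v = unitaryD[OF eigD(1)[OF V]]
  define W where "W = U\<^sup>H * V"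
  have [simp]: "dim_row W = n" "dim_col W = n" by (auto simp: W_def u v)
  have "U * (diagm n d * U\<^sup>H) = V * (diagm n e * V\<^sup>H)"
    using eigD(2)[OF U] eigD(2)[OF V] by simp
  hence "U\<^sup>H * ((U * (diagm n d * U\<^sup>H)) * V) = U\<^sup>H * ((V * (diagm n e * V\<^sup>H)) * V)" by simp
  hence dW: "diagm n d * W = W * diagm n e"
    by (simp add: mult_assoc_dim u v W_def)
  have ev: "W $$ (i, j) = 0 \<or> d i = e j" if "i < n" "j < n" for i j
    using that arg_cong[OF dW, of "\<lambda>M. M $$ (i, j)"] by (auto simp: diagm_mult_index mult_diagm_index)
  have comm: "diagm n (\<lambda>i. f (d i)) * W = W * diagm n (\<lambda>i. f (e i))"
  proof (rule eq_matI)
    fix i j assume "i < dim_row (W * diagm n (\<lambda>i. f (e i)))" "j < dim_col (W * diagm n (\<lambda>i. f (e i)))"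
    thus "(diagm n (\<lambda>i. f (d i)) * W) $$ (i, j) = (W * diagm n (\<lambda>i. f (e i))) $$ (i, j)"
      using ev[of i j] by (auto simp: diagm_mult_index mult_diagm_index)
  qed auto
  have "U * (diagm n (\<lambda>i. f (d i)) * U\<^sup>H) = U * (diagm n (\<lambda>i. f (d i)) * W * V\<^sup>H)"
    by (simp add: W_def mult_assoc_dim u v)
  also have "\<dots> = V * (diagm n (\<lambda>i. f (e i)) * V\<^sup>H)"
    unfolding comm by (simp add: W_def mult_assoc_dim u v)
  finally show ?thesis .
qed

text \<open>The choice operator in \<open>mat_fun\<close> ranges over all diagonalizations; by
  \<open>eig_fun_unique\<close> every candidate gives the same matrix, so the functional calculus
  may be computed in any eigenbasis.\<close>

lemma mat_fun_eig:
  assumes "eig n A U d"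
  shows "mat_fun f A = U * (diagm n (\<lambda>i. f (d i)) * U\<^sup>H)"
  unfolding mat_fun_def
proof (rule some_equality)
  note u = unitaryD[OF eigD(1)[OF assms]]
  let ?lam = "map d [0..<n]"
  have "mk_diagonal (map complex_of_real ?lam) = diagm n d"
    by (subst mk_diagonal_diagm) (auto intro!: diagm_cong)
  moreover have "mk_diagonal (map (complex_of_real \<circ> f) ?lam) = diagm n (\<lambda>i. f (d i))"
  proof -
    have "mk_diagonal (map (complex_of_real \<circ> f) ?lam) = diagm n (\<lambda>i. map f ?lam ! i)"
      using mk_diagonal_diagm[of "map f ?lam"] by (simp add: comp_assoc)
    also have "\<dots> = diagm n (\<lambda>i. f (d i))" by (intro diagm_cong) simp
    finally show ?thesis .
  qed
  ultimately show "\<exists>U' lam. unitary_mat (dim_row A) U' \<and> length lam = dim_row A \<and>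
      A = U' * mk_diagonal (map complex_of_real lam) * U'\<^sup>H \<and>
      U * (diagm n (\<lambda>i. f (d i)) * U\<^sup>H) = U' * mk_diagonal (map (complex_of_real \<circ> f) lam) * U'\<^sup>H"
    using eigD[OF assms] u(1,2)
    by (intro exI[of _ U] exI[of _ ?lam]) (simp add: mult_assoc_dim)
next
  fix B assume "\<exists>U' lam. unitary_mat (dim_row A) U' \<and> length lam = dim_row A \<and>
      A = U' * mk_diagonal (map complex_of_real lam) * U'\<^sup>H \<and>
      B = U' * mk_diagonal (map (complex_of_real \<circ> f) lam) * U'\<^sup>H"
  then obtain V lam where V: "unitary_mat n V" "length lam = n"
      "A = V * mk_diagonal (map complex_of_real lam) * V\<^sup>H"
      "B = V * mk_diagonal (map complex_of_real (map f lam)) * V\<^sup>H"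
    using eigD(3)[OF assms] by auto
  note v = unitaryD(1,2)[OF V(1)]
  have "eig n A V (\<lambda>i. lam ! i)"
    using V v by (simp add: eig_def mk_diagonal_diagm mult_assoc_dim)
  from eig_fun_unique[OF assms this, of f]
  have "U * (diagm n (\<lambda>i. f (d i)) * U\<^sup>H) = V * (diagm n (\<lambda>i. f (lam ! i)) * V\<^sup>H)" .
  also have "diagm n (\<lambda>i. f (lam ! i)) = diagm n (\<lambda>i. map f lam ! i)"
    using V(2) by (intro diagm_cong) simp
  finally show "B = U * (diagm n (\<lambda>i. f (d i)) * U\<^sup>H)"
    using V v mk_diagonal_diagm[of "map f lam"] by (simp add: mult_assoc_dim)
qed

lemma eig_mat_fun: "eig n A U d \<Longrightarrow> eig n (mat_fun f A) U (\<lambda>i. f (d i))"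
  using mat_fun_eig by (auto simp: eig_def)

lemma mat_fun_comp:
  assumes "hermitian_mat n A"
  shows "mat_fun f (mat_fun g A) = mat_fun (\<lambda>x. f (g x)) A"
proof -
  obtain U d where e: "eig n A U d" using hermitian_eig[OF assms] by blast
  show ?thesis
    unfolding mat_fun_eig[OF eig_mat_fun[OF e, of g], of f] mat_fun_eig[OF e, of "\<lambda>x. f (g x)"] ..
qed

lemma mat_fun_mult:
  assumes "hermitian_mat n A"
  shows "mat_fun f A * mat_fun g A = mat_fun (\<lambda>x. f x * g x) A"
proof -
  obtain U d where e: "eig n A U d" using hermitian_eig[OF assms] by blast
  show ?thesis
    by (simp add: mat_fun_eig[OF e] mult_assoc_dim unitaryD[OF eigD(1)[OF e]] diagm_mult_left)
qed

lemma eig_mtrace: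
  assumes "eig n A U d"
  shows "mtrace A = (\<Sum>i<n. complex_of_real (d i))"
proof -
  note u = unitaryD[OF eigD(1)[OF assms]]
  have "mtrace A = mtrace (diagm n d * U\<^sup>H * U)"
    using u(1,2) by (subst eigD(2)[OF assms], subst mtrace_mult_comm) auto
  thus ?thesis by (simp add: u mult_assoc_dim mtrace_diagm)
qed

lemma unitary_conj_eig:
  assumes e: "eig n A U d" and V: "unitary_mat n V"
  shows "eig n (V * (A * V\<^sup>H)) (V * U) d"
  using unitary_mult[OF V eigD(1)[OF e]] eigD(2)[OF e] unitaryD(1,2)[OF V] unitaryD(1,2)[OF eigD(1)[OF e]]
  by (simp add: eig_def adj_mult mult_assoc_dim)

lemma mat_fun_unitary_conj:
  assumes A: "hermitian_mat n A" and V: "unitary_mat n V"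
  shows "mat_fun f (V * (A * V\<^sup>H)) = V * (mat_fun f A * V\<^sup>H)"
proof -
  obtain U d where e: "eig n A U d" using hermitian_eig[OF A] by blast
  show ?thesis
    using unitaryD(1,2)[OF V] unitaryD(1,2)[OF eigD(1)[OF e]]
    by (simp add: mat_fun_eig[OF unitary_conj_eig[OF e V]] mat_fun_eig[OF e] adj_mult mult_assoc_dim)
qed

text \<open>Writing \<open>Z\<close> and \<open>Z'\<close> in the eigenbases of \<open>A\<close> and
  \<open>X\<close> yields a double sum whose weights depend on neither \<open>\<alpha>\<close> nor
  \<open>\<beta>\<close>. For \<open>Z = Z'\<close> the weights are nonnegative, so a scalar
  inequality between eigenvalues \<open>x i\<close> and \<open>a j\<close> turns into a trace
  inequality.\<close>

lemma mtrace_eig_pair: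
  assumes X: "eig l X V x" and A: "eig n A U a"
    and Z: "dim_row Z = n" "dim_col Z = l" "dim_row Z' = n" "dim_col Z' = l"
  shows "mtrace (mat_fun \<alpha> X * (Z\<^sup>H * (mat_fun \<beta> A * Z')))
    = (\<Sum>i<l. \<Sum>j<n. complex_of_real (\<alpha> (x i) * \<beta> (a j)) *
        (cnj ((U\<^sup>H * (Z * V)) $$ (j, i)) * (U\<^sup>H * (Z' * V)) $$ (j, i)))"
proof -
  note v = unitaryD[OF eigD(1)[OF X]] and u = unitaryD[OF eigD(1)[OF A]]
  have "mtrace (mat_fun \<alpha> X * (Z\<^sup>H * (mat_fun \<beta> A * Z')))
    = mtrace (V * (diagm l (\<lambda>i. \<alpha> (x i)) * (V\<^sup>H * (Z\<^sup>H * (mat_fun \<beta> A * Z')))))"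
    using Z by (simp add: mat_fun_eig[OF X] mat_fun_eig[OF A] mult_assoc_dim u v)
  also have "\<dots> = mtrace (diagm l (\<lambda>i. \<alpha> (x i)) * (V\<^sup>H * (Z\<^sup>H * (mat_fun \<beta> A * Z'))) * V)"
    using Z by (intro mtrace_mult_comm) (simp_all add: u v)
  also have "\<dots> = mtrace (diagm l (\<lambda>i. \<alpha> (x i)) *
      ((U\<^sup>H * (Z * V))\<^sup>H * (diagm n (\<lambda>j. \<beta> (a j)) * (U\<^sup>H * (Z' * V)))))"
    using Z by (simp add: mat_fun_eig[OF A] mult_assoc_dim adj_mult u v)
  finally show ?thesis
    using Z by (subst (asm) mtrace_diagm_sandwich) (simp_all add: u v)
qed

section \<open>Quadratic forms and definiteness\<close>

lemma mtrace_eig_form: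
  assumes A: "eig n A U a" and Z: "dim_row Z = n"
  shows "mtrace (Z\<^sup>H * (A * Z))
    = complex_of_real (\<Sum>i<dim_col Z. \<Sum>j<n. a j * (cmod ((U\<^sup>H * Z) $$ (j, i)))\<^sup>2)"
proof -
  note u = unitaryD[OF eigD(1)[OF A]]
  have "mtrace (Z\<^sup>H * (A * Z))
    = mtrace (diagm (dim_col Z) (\<lambda>_. 1) * ((U\<^sup>H * Z)\<^sup>H * (diagm n a * (U\<^sup>H * Z))))"
    using Z by (subst eigD(2)[OF A]) (simp add: diagm_one mult_assoc_dim adj_mult u)
  also have "\<dots> = (\<Sum>i<dim_col Z. \<Sum>j<n. complex_of_real (1 * a j) *
      (cnj ((U\<^sup>H * Z) $$ (j, i)) * (U\<^sup>H * Z) $$ (j, i)))"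
    by (rule mtrace_diagm_sandwich) (simp_all add: u)
  also have "\<dots> = complex_of_real (\<Sum>i<dim_col Z. \<Sum>j<n. a j * (cmod ((U\<^sup>H * Z) $$ (j, i)))\<^sup>2)"
    by (simp add: complex_norm_square[unfolded of_real_power] mult.commute)
  finally show ?thesis .
qed

text \<open>Vectors are treated as one-column matrices, so that definiteness is expressed by the
  same traces as everything else.\<close>

lemma mtrace_vec_form:
  assumes "v \<in> carrier_vec n" "A \<in> carrier_mat n n"
  shows "mtrace ((mat n 1 (\<lambda>(i, _). v $ i))\<^sup>H * (A * mat n 1 (\<lambda>(i, _). v $ i))) = conjugate v \<bullet> (A *\<^sub>v v)"
  using assms
  by (auto simp: mtrace_def mult_index scalar_prod_def atLeast0LessThan intro!: sum.cong)

lemma posdef_form_pos: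
  assumes "posdef_mat n A" "dim_row Z = n" "dim_col Z = 1" "Z \<noteq> 0\<^sub>m n 1"
  shows "Re (mtrace (Z\<^sup>H * (A * Z))) > 0"
proof -
  define v where "v = col Z 0"
  have v: "v \<in> carrier_vec n" using assms by (auto simp: v_def)
  have Z: "Z = mat n 1 (\<lambda>(i, _). v $ i)" using assms by (intro eq_matI) (auto simp: v_def)
  have "v \<noteq> 0\<^sub>v n" using assms(4) Z by (auto simp: zero_mat_def intro!: eq_matI)
  thus ?thesis using assms(1) v mtrace_vec_form[OF v, of A] Z
    by (simp add: posdef_mat_def hermitian_mat_def)
qed

lemma posdefI:
  assumes "hermitian_mat n A"
    and "\<And>Z. dim_row Z = n \<Longrightarrow> dim_col Z = 1 \<Longrightarrow> Z \<noteq> 0\<^sub>m n 1 \<Longrightarrow> Re (mtrace (Z\<^sup>H * (A * Z))) > 0"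
  shows "posdef_mat n A"
  unfolding posdef_mat_def
proof (intro conjI ballI impI assms(1))
  fix v :: "complex Matrix.vec" assume v: "v \<in> carrier_vec n" "v \<noteq> 0\<^sub>v n"
  have "mat n 1 (\<lambda>(i, _). v $ i) \<noteq> 0\<^sub>m n 1"
  proof
    assume z: "mat n 1 (\<lambda>(i, _). v $ i) = 0\<^sub>m n 1"
    have "v $ i = 0" if "i < n" for i
      using arg_cong[OF z, of "\<lambda>M. M $$ (i, 0)"] that by simp
    thus False using v by (auto intro!: eq_vecI)
  qed
  thus "0 < Re (conjugate v \<bullet> (A *\<^sub>v v))"
    using assms(2)[of "mat n 1 (\<lambda>(i, _). v $ i)"] mtrace_vec_form[OF v(1), of A] assms(1)
    by (simp add: hermitian_mat_def)
qed

lemma possemidef_form_nonneg_col: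
  assumes "possemidef_mat n A" "dim_row Z = n" "dim_col Z = 1"
  shows "Re (mtrace (Z\<^sup>H * (A * Z))) \<ge> 0"
proof -
  have Z: "Z = mat n 1 (\<lambda>(i, _). col Z 0 $ i)" using assms by (intro eq_matI) auto
  have "col Z 0 \<in> carrier_vec n" using assms by auto
  thus ?thesis using assms(1) mtrace_vec_form[of "col Z 0" n A] Z
    by (simp add: possemidef_mat_def hermitian_mat_def)
qed

text \<open>The test column is the \<open>j\<close>-th eigenvector. It converts definiteness of the
  form into a sign condition on each eigenvalue.\<close>

lemma eig_value_form:
  assumes e: "eig n A U a" and j: "j < n"
  defines "Z \<equiv> mat n 1 (\<lambda>(i, _). U $$ (i, j))"
  shows "mtrace (Z\<^sup>H * (A * Z)) = complex_of_real (a j)" "Z \<noteq> 0\<^sub>m n 1"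
proof -
  note u = unitaryD[OF eigD(1)[OF e]]
  have Zd [simp]: "dim_row Z = n" "dim_col Z = 1" by (auto simp: Z_def)
  have ent: "(U\<^sup>H * Z) $$ (i, 0) = (if i = j then 1 else 0)" if i: "i < n" for i
  proof -
    have "(U\<^sup>H * Z) $$ (i, 0) = (U\<^sup>H * U) $$ (i, j)"
      using i j u(1,2) by (simp add: mult_index Z_def)
    thus ?thesis using i j by (simp add: u)
  qed
  have "(\<Sum>k<n. a k * (cmod ((U\<^sup>H * Z) $$ (k, 0)))\<^sup>2) = (\<Sum>k<n. if k = j then a j else 0)"
    by (intro sum.cong) (auto simp: ent)
  thus "mtrace (Z\<^sup>H * (A * Z)) = complex_of_real (a j)"
    using j by (subst mtrace_eig_form[OF e]) simp_all
  show "Z \<noteq> 0\<^sub>m n 1"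
  proof
    assume "Z = 0\<^sub>m n 1"
    hence "(U\<^sup>H * Z) $$ (j, 0) = 0" using j by (simp add: mult_index u)
    thus False using ent[OF j] by simp
  qed
qed

lemma posdef_eig_pos:
  assumes "posdef_mat n A" "eig n A U a" "j < n"
  shows "a j > 0"
  using posdef_form_pos[OF assms(1) _ _ eig_value_form(2)[OF assms(2,3)]] eig_value_form(1)[OF assms(2,3)]
  by simp

lemma possemidef_eig_nonneg:
  assumes "possemidef_mat n A" "eig n A U a" "j < n"
  shows "a j \<ge> 0"
  using possemidef_form_nonneg_col[OF assms(1), of "mat n 1 (\<lambda>(i, _). U $$ (i, j))"]
    eig_value_form(1)[OF assms(2,3)]
  by simp

lemma eig_form_nonneg:
  assumes "eig n A U a" "\<And>j. j < n \<Longrightarrow> a j \<ge> 0" "dim_row Z = n"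
  shows "Re (mtrace (Z\<^sup>H * (A * Z))) \<ge> 0"
  using mtrace_eig_form[OF assms(1,3)] assms(2) by (auto intro!: sum_nonneg)

lemma eig_posdef:
  assumes e: "eig n A U a" and pos: "\<And>j. j < n \<Longrightarrow> a j > 0"
  shows "posdef_mat n A"
proof (rule posdefI[OF eig_hermitian[OF e]])
  fix Z :: "complex mat" assume Z: "dim_row Z = n" "dim_col Z = 1" "Z \<noteq> 0\<^sub>m n 1"
  note u = unitaryD[OF eigD(1)[OF e]]
  have "\<exists>j<n. (U\<^sup>H * Z) $$ (j, 0) \<noteq> 0"
  proof (rule ccontr)
    assume "\<not> ?thesis"
    hence "U\<^sup>H * Z = 0\<^sub>m n 1" using Z by (intro eq_matI) (auto simp: u)
    hence "U * (U\<^sup>H * Z) = 0\<^sub>m n 1" by (intro eq_matI) (auto simp: u mult_index)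
    thus False using Z by (simp add: u)
  qed
  then obtain j where "j < n" "(U\<^sup>H * Z) $$ (j, 0) \<noteq> 0" by blast
  hence "(\<Sum>j<n. a j * (cmod ((U\<^sup>H * Z) $$ (j, 0)))\<^sup>2) > 0"
    using pos by (intro sum_pos2[of _ j]) (auto simp: less_imp_le)
  thus "Re (mtrace (Z\<^sup>H * (A * Z))) > 0"
    using Z by (simp add: mtrace_eig_form[OF e])
qed

lemma posdef_hermitian: "posdef_mat n A \<Longrightarrow> hermitian_mat n A"
  by (simp add: posdef_mat_def)

lemma hermitianD:
  assumes "hermitian_mat n A" shows "dim_row A = n" "dim_col A = n" "A\<^sup>H = A"
  using assms by (auto simp: hermitian_mat_def)

lemma posdef_eig:
  assumes "posdef_mat n A"
  obtains U a where "eig n A U a" "\<And>j. j < n \<Longrightarrow> a j > 0"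
  using hermitian_eig[OF posdef_hermitian[OF assms]] posdef_eig_pos[OF assms] by blast

lemma posdef_form_nonneg:
  assumes "posdef_mat n A" "dim_row Z = n"
  shows "Re (mtrace (Z\<^sup>H * (A * Z))) \<ge> 0"
  using assms(1)
proof (rule posdef_eig)
  fix U a assume "eig n A U a" "\<And>j. j < n \<Longrightarrow> a j > 0"
  thus ?thesis using assms(2) by (intro eig_form_nonneg) (auto intro: less_imp_le)
qed

lemma mat_fun_posdef:
  assumes "posdef_mat n A" "\<And>x. x > 0 \<Longrightarrow> f x > 0"
  shows "posdef_mat n (mat_fun f A)"
  using assms(1)
proof (rule posdef_eig)
  fix U a assume "eig n A U a" "\<And>j. j < n \<Longrightarrow> a j > 0"
  thus ?thesis using assms(2) by (intro eig_posdef[OF eig_mat_fun]) auto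
qed

lemma mat_fun_hermitian: "hermitian_mat n A \<Longrightarrow> hermitian_mat n (mat_fun f A)"
  using hermitian_eig[of n A] eig_mat_fun[of n A _ _ f] eig_hermitian[of n "mat_fun f A"] by blast

lemma mat_fun_cong_pos:
  assumes "posdef_mat n A" "\<And>x. x > 0 \<Longrightarrow> f x = g x"
  shows "mat_fun f A = mat_fun g A"
  using assms(1)
proof (rule posdef_eig)
  fix U a assume "eig n A U a" "\<And>j. j < n \<Longrightarrow> a j > 0"
  thus ?thesis using assms(2) diagm_cong[of n "\<lambda>i. f (a i)" "\<lambda>i. g (a i)"] by (simp add: mat_fun_eig)
qed

lemma mat_fun_id:
  assumes "hermitian_mat n A"
  shows "mat_fun (\<lambda>x. x) A = A"
proof -
  obtain U d where e: "eig n A U d" using hermitian_eig[OF assms] by blast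
  show ?thesis using mat_fun_eig[OF e, of "\<lambda>x. x"] eigD(2)[OF e] by simp
qed

lemma mat_fun_one:
  assumes "hermitian_mat n A"
  shows "mat_fun (\<lambda>_. 1) A = 1\<^sub>m n"
proof -
  obtain U d where e: "eig n A U d" using hermitian_eig[OF assms] by blast
  show ?thesis by (simp add: mat_fun_eig[OF e] diagm_one unitaryD[OF eigD(1)[OF e]])
qed

lemma posdef_convex_comb:
  assumes "posdef_mat n A" "posdef_mat n B" "0 \<le> t" "t \<le> 1"
  shows "posdef_mat n (complex_of_real t \<cdot>\<^sub>m A + complex_of_real (1 - t) \<cdot>\<^sub>m B)"
proof (rule posdefI)
  note A = hermitianD[OF posdef_hermitian[OF assms(1)]]
    and B = hermitianD[OF posdef_hermitian[OF assms(2)]]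
  show "hermitian_mat n (complex_of_real t \<cdot>\<^sub>m A + complex_of_real (1 - t) \<cdot>\<^sub>m B)"
    using A B by (auto simp: hermitian_mat_def adj_add adj_smult intro: carrier_matI)
  fix Z :: "complex mat" assume Z: "dim_row Z = n" "dim_col Z = 1" "Z \<noteq> 0\<^sub>m n 1"
  have "t * Re (mtrace (Z\<^sup>H * (A * Z))) + (1 - t) * Re (mtrace (Z\<^sup>H * (B * Z))) > 0"
    using posdef_form_pos[OF assms(1) Z] posdef_form_pos[OF assms(2) Z] assms(3,4)
    by (cases "t = 0") (auto intro!: add_pos_nonneg)
  thus "Re (mtrace (Z\<^sup>H * ((complex_of_real t \<cdot>\<^sub>m A + complex_of_real (1 - t) \<cdot>\<^sub>m B) * Z))) > 0"
    using A B Z by (simp add: mult_add_dim mult_smult_dim mtrace_add mtrace_smult)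
qed

subsection \<open>Ando convexity and operator concavity of powers\<close>

text \<open>With L and R the commuting operators of left multiplication by \<open>A\<close> and
  right multiplication by \<open>X\<close>, this is the spectral form of the inner product of A Z
  with (\<mu> L + \<nu> R)^(-1) (A Z); \<open>W\<close> is \<open>Z\<close> written in the two
  eigenbases.\<close>

definition quad_over_lin ::
  "real \<Rightarrow> real \<Rightarrow> nat \<Rightarrow> nat \<Rightarrow> (nat \<Rightarrow> real) \<Rightarrow> (nat \<Rightarrow> real) \<Rightarrow> complex mat \<Rightarrow> real" where
  "quad_over_lin \<mu> \<nu> l n x a W =
     (\<Sum>i<l. \<Sum>j<n. (a j)\<^sup>2 / (\<mu> * a j + \<nu> * x i) * (cmod (W $$ (j, i)))\<^sup>2)"

text \<open>The quadratic-over-linear form is the maximum over \<open>Y\<close> of the following expression, which is affine in \<open>(A, X)\<close>.\<close>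

definition quad_dual ::
  "real \<Rightarrow> real \<Rightarrow> complex mat \<Rightarrow> complex mat \<Rightarrow> complex mat \<Rightarrow> complex mat \<Rightarrow> real" where
  "quad_dual \<mu> \<nu> Z Y A X = 2 * Re (mtrace (Y\<^sup>H * (A * Z)))
     - \<mu> * Re (mtrace (Y\<^sup>H * (A * Y))) - \<nu> * Re (mtrace (X * (Y\<^sup>H * Y)))"

lemma quad_dual_eig:
  assumes X: "eig l X V x" and A: "eig n A U a"
    and Z: "dim_row Z = n" "dim_col Z = l" "dim_row Y = n" "dim_col Y = l"
  shows "quad_dual \<mu> \<nu> Z Y A X = (\<Sum>i<l. \<Sum>j<n.
      2 * a j * Re (cnj ((U\<^sup>H * (Y * V)) $$ (j, i)) * (U\<^sup>H * (Z * V)) $$ (j, i))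
      - (\<mu> * a j + \<nu> * x i) * (cmod ((U\<^sup>H * (Y * V)) $$ (j, i)))\<^sup>2)"
proof -
  note Xd = eigD(3,4)[OF X] and Ad = eigD(3,4)[OF A]
  note hX = eig_hermitian[OF X] and hA = eig_hermitian[OF A]
  define y where "y j i = (U\<^sup>H * (Y * V)) $$ (j, i)" for j i
  define z where "z j i = (U\<^sup>H * (Z * V)) $$ (j, i)" for j i
  have 1: "mtrace (Y\<^sup>H * (A * Z)) = (\<Sum>i<l. \<Sum>j<n. complex_of_real (1 * a j) * (cnj (y j i) * z j i))"
    using mtrace_eig_pair[OF X A Z(3,4,1,2), of "\<lambda>_. 1" "\<lambda>x. x"] Z Ad
    by (simp add: mat_fun_one[OF hX] mat_fun_id[OF hA] y_def z_def)
  have 2: "mtrace (Y\<^sup>H * (A * Y)) = (\<Sum>i<l. \<Sum>j<n. complex_of_real (1 * a j) * (cnj (y j i) * y j i))"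
    using mtrace_eig_pair[OF X A Z(3,4,3,4), of "\<lambda>_. 1" "\<lambda>x. x"] Z Ad
    by (simp add: mat_fun_one[OF hX] mat_fun_id[OF hA] y_def)
  have 3: "mtrace (X * (Y\<^sup>H * Y)) = (\<Sum>i<l. \<Sum>j<n. complex_of_real (x i * 1) * (cnj (y j i) * y j i))"
    using mtrace_eig_pair[OF X A Z(3,4,3,4), of "\<lambda>x. x" "\<lambda>_. 1"] Z Xd
    by (simp add: mat_fun_one[OF hA] mat_fun_id[OF hX] y_def)
  show ?thesis
    unfolding quad_dual_def 1 2 3 cnj_mult_self y_def[symmetric] z_def[symmetric]
    by (simp add: sum_distrib_left sum_subtractf sum.distrib algebra_simps)
qed

text \<open>Completing the square entry by entry: with D = \<mu> a + \<nu> x the gap is |D y - a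
  z|^2 / D.\<close>

lemma quad_dual_le:
  assumes X: "eig l X V x" and A: "eig n A U a"
    and Z: "dim_row Z = n" "dim_col Z = l" "dim_row Y = n" "dim_col Y = l"
    and pos: "\<And>i j. i < l \<Longrightarrow> j < n \<Longrightarrow> \<mu> * a j + \<nu> * x i > 0"
  shows "quad_dual \<mu> \<nu> Z Y A X \<le> quad_over_lin \<mu> \<nu> l n x a (U\<^sup>H * (Z * V))"
  unfolding quad_dual_eig[OF X A Z] quad_over_lin_def
proof (intro sum_mono)
  fix i j assume "i \<in> {..<l}" "j \<in> {..<n}"
  hence D: "\<mu> * a j + \<nu> * x i > 0" using pos by auto
  define D where "D = \<mu> * a j + \<nu> * x i"
  define y where "y = (U\<^sup>H * (Y * V)) $$ (j, i)"
  define z where "z = (U\<^sup>H * (Z * V)) $$ (j, i)"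
  have "(a j)\<^sup>2 / D * (cmod z)\<^sup>2 - (2 * a j * Re (cnj y * z) - D * (cmod y)\<^sup>2)
    = (cmod (D * y - a j * z))\<^sup>2 / D"
    using D unfolding D_def[symmetric] cmod_power2 by (simp add: field_simps power2_eq_square)
  also have "\<dots> \<ge> 0" using D by (simp add: D_def)
  finally show "2 * a j * Re (cnj y * z) - D * (cmod y)\<^sup>2 \<le> (a j)\<^sup>2 / D * (cmod z)\<^sup>2" by simp
qed

lemma quad_dual_attained:
  assumes X: "eig l X V x" and A: "eig n A U a"
    and Z: "dim_row Z = n" "dim_col Z = l"
    and pos: "\<And>i j. i < l \<Longrightarrow> j < n \<Longrightarrow> \<mu> * a j + \<nu> * x i > 0"
  obtains Y where "dim_row Y = n" "dim_col Y = l"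
    "quad_dual \<mu> \<nu> Z Y A X = quad_over_lin \<mu> \<nu> l n x a (U\<^sup>H * (Z * V))"
proof -
  note u = unitaryD[OF eigD(1)[OF A]] and v = unitaryD[OF eigD(1)[OF X]]
  define W where "W = U\<^sup>H * (Z * V)"
  \<comment> \<open>The zero of the completed square: each entry of the optimal \<open>Y\<close>, in
    the eigenbases, is that of \<open>Z\<close> scaled by a / (\<mu> a + \<nu> x).\<close>
  define Q where "Q = mat n l (\<lambda>(j, i). complex_of_real (a j / (\<mu> * a j + \<nu> * x i)) * W $$ (j, i))"
  define Y where "Y = U * (Q * V\<^sup>H)"
  have Qd: "dim_row Q = n" "dim_col Q = l" by (auto simp: Q_def)
  have Yd: "dim_row Y = n" "dim_col Y = l" by (auto simp: Y_def u v)
  have Yhat: "U\<^sup>H * (Y * V) = Q" by (simp add: Y_def mult_assoc_dim u v Qd)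
  have "quad_dual \<mu> \<nu> Z Y A X = quad_over_lin \<mu> \<nu> l n x a W"
    unfolding quad_dual_eig[OF X A Z Yd] quad_over_lin_def Yhat W_def[symmetric]
  proof (intro sum.cong refl)
    fix i j assume ij: "i \<in> {..<l}" "j \<in> {..<n}"
    define D where "D = \<mu> * a j + \<nu> * x i"
    have D: "D > 0" using pos ij by (auto simp: D_def)
    have "Q $$ (j, i) = complex_of_real (a j / D) * W $$ (j, i)"
      using ij by (simp add: Q_def D_def)
    hence Q: "Re (Q $$ (j, i)) = a j / D * Re (W $$ (j, i))" "Im (Q $$ (j, i)) = a j / D * Im (W $$ (j, i))"
      by simp_all
    show "2 * a j * Re (cnj (Q $$ (j, i)) * W $$ (j, i)) - (\<mu> * a j + \<nu> * x i) * (cmod (Q $$ (j, i)))\<^sup>2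
      = (a j)\<^sup>2 / (\<mu> * a j + \<nu> * x i) * (cmod (W $$ (j, i)))\<^sup>2"
      unfolding D_def[symmetric] cmod_power2 times_complex.simps cnj.simps Q using D
      by (simp add: field_simps power2_eq_square)
  qed
  with Yd show thesis unfolding W_def by (rule that)
qed

lemma quad_dual_affine:
  assumes "dim_row Z = n" "dim_col Z = l" "dim_row Y = n" "dim_col Y = l"
    "dim_row A1 = n" "dim_col A1 = n" "dim_row A2 = n" "dim_col A2 = n"
    "dim_row X1 = l" "dim_col X1 = l" "dim_row X2 = l" "dim_col X2 = l"
  shows "quad_dual \<mu> \<nu> Z Y (complex_of_real t \<cdot>\<^sub>m A1 + complex_of_real s \<cdot>\<^sub>m A2)
      (complex_of_real t \<cdot>\<^sub>m X1 + complex_of_real s \<cdot>\<^sub>m X2)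
    = t * quad_dual \<mu> \<nu> Z Y A1 X1 + s * quad_dual \<mu> \<nu> Z Y A2 X2"
  using assms
  by (simp add: quad_dual_def mult_add_dim mult_smult_dim mtrace_add mtrace_smult algebra_simps)

text \<open>A maximum of affine functions is convex: the \<open>Y\<close> that is optimal at the
  mixed point is an admissible competitor at both end points.\<close>

lemma quad_over_lin_convex:
  assumes A1: "eig n A1 U1 a1" and A2: "eig n A2 U2 a2"
    and X1: "eig l X1 V1 x1" and X2: "eig l X2 V2 x2"
    and A: "eig n (complex_of_real t \<cdot>\<^sub>m A1 + complex_of_real (1 - t) \<cdot>\<^sub>m A2) U a"
    and X: "eig l (complex_of_real t \<cdot>\<^sub>m X1 + complex_of_real (1 - t) \<cdot>\<^sub>m X2) V x"
    and Z: "dim_row Z = n" "dim_col Z = l" and t: "0 \<le> t" "t \<le> 1"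
    and pos1: "\<And>i j. i < l \<Longrightarrow> j < n \<Longrightarrow> \<mu> * a1 j + \<nu> * x1 i > 0"
    and pos2: "\<And>i j. i < l \<Longrightarrow> j < n \<Longrightarrow> \<mu> * a2 j + \<nu> * x2 i > 0"
    and pos: "\<And>i j. i < l \<Longrightarrow> j < n \<Longrightarrow> \<mu> * a j + \<nu> * x i > 0"
  shows "quad_over_lin \<mu> \<nu> l n x a (U\<^sup>H * (Z * V))
    \<le> t * quad_over_lin \<mu> \<nu> l n x1 a1 (U1\<^sup>H * (Z * V1))
      + (1 - t) * quad_over_lin \<mu> \<nu> l n x2 a2 (U2\<^sup>H * (Z * V2))"
proof -
  obtain Y where Y: "dim_row Y = n" "dim_col Y = l" and eq:
    "quad_dual \<mu> \<nu> Z Y (complex_of_real t \<cdot>\<^sub>m A1 + complex_of_real (1 - t) \<cdot>\<^sub>m A2)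
      (complex_of_real t \<cdot>\<^sub>m X1 + complex_of_real (1 - t) \<cdot>\<^sub>m X2)
      = quad_over_lin \<mu> \<nu> l n x a (U\<^sup>H * (Z * V))"
    using quad_dual_attained[OF X A Z, of \<mu> \<nu>] pos by blast
  show ?thesis
    unfolding eq[symmetric]
      quad_dual_affine[OF Z Y eigD(3,4)[OF A1] eigD(3,4)[OF A2] eigD(3,4)[OF X1] eigD(3,4)[OF X2]]
    using quad_dual_le[OF X1 A1 Z Y pos1] quad_dual_le[OF X2 A2 Z Y pos2] t
    by (intro add_mono mult_left_mono) auto
qed

lemma Re_mtrace_eig_pair:
  assumes X: "eig l X V x" and A: "eig n A U a" and Z: "dim_row Z = n" "dim_col Z = l"
  shows "Re (mtrace (mat_fun \<alpha> X * (Z\<^sup>H * (mat_fun \<beta> A * Z))))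
    = (\<Sum>i<l. \<Sum>j<n. \<alpha> (x i) * \<beta> (a j) * (cmod ((U\<^sup>H * (Z * V)) $$ (j, i)))\<^sup>2)"
  unfolding mtrace_eig_pair[OF X A Z Z] cnj_mult_self by simp

text \<open>In eigenvalues the trace is a sum of a^p x^(1-p) = a (a/x)^r with r = p - 1. Inserting u
  = a/x into the integral representation gives a u / (u + s) = a^2 / (a + s x), the form
  \<open>quad_over_lin\<close> with \<open>\<mu> = 1\<close> and \<open>\<nu> = s\<close>, for each
  s.\<close>

theorem ando_convexity:
  assumes p: "1 < p" "p \<le> 2"
    and A1: "posdef_mat n A1" and A2: "posdef_mat n A2"
    and X1: "posdef_mat l X1" and X2: "posdef_mat l X2"
    and Z: "dim_row Z = n" "dim_col Z = l" and t: "0 \<le> t" "t \<le> 1"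
  defines "F \<equiv> \<lambda>A X. Re (mtrace (mat_powr X (1 - p) * (Z\<^sup>H * (mat_powr A p * Z))))"
  shows "F (complex_of_real t \<cdot>\<^sub>m A1 + complex_of_real (1 - t) \<cdot>\<^sub>m A2)
      (complex_of_real t \<cdot>\<^sub>m X1 + complex_of_real (1 - t) \<cdot>\<^sub>m X2)
    \<le> t * F A1 X1 + (1 - t) * F A2 X2"
proof -
  let ?A = "complex_of_real t \<cdot>\<^sub>m A1 + complex_of_real (1 - t) \<cdot>\<^sub>m A2"
  let ?X = "complex_of_real t \<cdot>\<^sub>m X1 + complex_of_real (1 - t) \<cdot>\<^sub>m X2"
  obtain U1 a1 where e1: "eig n A1 U1 a1" "\<And>j. j < n \<Longrightarrow> a1 j > 0" using posdef_eig[OF A1] by blast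
  obtain U2 a2 where e2: "eig n A2 U2 a2" "\<And>j. j < n \<Longrightarrow> a2 j > 0" using posdef_eig[OF A2] by blast
  obtain U a where e: "eig n ?A U a" "\<And>j. j < n \<Longrightarrow> a j > 0"
    using posdef_eig[OF posdef_convex_comb[OF A1 A2 t]] by blast
  obtain V1 x1 where f1: "eig l X1 V1 x1" "\<And>j. j < l \<Longrightarrow> x1 j > 0" using posdef_eig[OF X1] by blast
  obtain V2 x2 where f2: "eig l X2 V2 x2" "\<And>j. j < l \<Longrightarrow> x2 j > 0" using posdef_eig[OF X2] by blast
  obtain V x where f: "eig l ?X V x" "\<And>j. j < l \<Longrightarrow> x j > 0"
    using posdef_eig[OF posdef_convex_comb[OF X1 X2 t]] by blast
  define S where "S x a W = (\<Sum>i<l. \<Sum>j<n. x i powr (1 - p) * a j powr p * (cmod (W $$ (j, i)))\<^sup>2)"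
    for x a :: "nat \<Rightarrow> real" and W :: "complex mat"
  have F: "F ?A ?X = S x a (U\<^sup>H * (Z * V))" "F A1 X1 = S x1 a1 (U1\<^sup>H * (Z * V1))"
    "F A2 X2 = S x2 a2 (U2\<^sup>H * (Z * V2))"
    unfolding F_def S_def mat_powr_def
    by (rule Re_mtrace_eig_pair[OF f(1) e(1) Z] Re_mtrace_eig_pair[OF f1(1) e1(1) Z]
        Re_mtrace_eig_pair[OF f2(1) e2(1) Z])+
  have quad: "quad_over_lin \<mu> \<nu> l n x a (U\<^sup>H * (Z * V))
    \<le> t * quad_over_lin \<mu> \<nu> l n x1 a1 (U1\<^sup>H * (Z * V1))
      + (1 - t) * quad_over_lin \<mu> \<nu> l n x2 a2 (U2\<^sup>H * (Z * V2))" if "\<mu> \<ge> 0" "\<nu> > 0" for \<mu> \<nu>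
    using that e(2) e1(2) e2(2) f(2) f1(2) f2(2)
    by (intro quad_over_lin_convex[OF e1(1) e2(1) f1(1) f2(1) e(1) f(1) Z t] add_nonneg_pos mult_nonneg_nonneg mult_pos_pos)
      (auto intro: less_imp_le)
  show ?thesis
  proof (cases "p = 2")
    \<comment> \<open>Here r = 1 lies outside the range of the integral representation, but a^2 / x
      is itself the quadratic form with \<open>\<mu> = 0\<close> and
      \<open>\<nu> = 1\<close>.\<close>
    case True
    have "S x a W = quad_over_lin 0 1 l n x a W"
      if "\<And>i. i < l \<Longrightarrow> x i > 0" "\<And>j. j < n \<Longrightarrow> a j > 0" for x a W
      unfolding S_def quad_over_lin_def True
    proof (intro sum.cong refl)
      fix i j assume "i \<in> {..<l}" "j \<in> {..<n}"
      hence "x i > 0" "a j > 0" using that by auto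
      thus "x i powr (1 - 2) * a j powr 2 * (cmod (W $$ (j, i)))\<^sup>2
        = (a j)\<^sup>2 / (0 * a j + 1 * x i) * (cmod (W $$ (j, i)))\<^sup>2"
        by (simp add: powr_numeral powr_neg_one)
    qed
    with quad[of 0 1] e(2) e1(2) e2(2) f(2) f1(2) f2(2) show ?thesis unfolding F by simp
  next
    case False
    define r where "r = p - 1"
    have r: "0 < r" "r < 1" using False p by (auto simp: r_def)
    obtain c where c: "c > 0" "\<And>u. u > 0 \<Longrightarrow>
        ((\<lambda>s. s powr (r - 1) * (u / (u + s))) has_integral c * u powr r) {0<..}"
      using powr_integral_representation[OF r] by blast
    have int: "((\<lambda>s. s powr (r - 1) * quad_over_lin 1 s l n x a W) has_integral c * S x a W) {0<..}"
      if pos: "\<And>i. i < l \<Longrightarrow> x i > 0" "\<And>j. j < n \<Longrightarrow> a j > 0" for x a W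
    proof -
      have "((\<lambda>s. \<Sum>i<l. \<Sum>j<n. (a j * (cmod (W $$ (j, i)))\<^sup>2) *
          (s powr (r - 1) * ((a j / x i) / (a j / x i + s)))) has_integral
          (\<Sum>i<l. \<Sum>j<n. (a j * (cmod (W $$ (j, i)))\<^sup>2) * (c * (a j / x i) powr r))) {0<..}"
        using pos by (intro has_integral_sum has_integral_mult_right c) auto
      also have "(\<Sum>i<l. \<Sum>j<n. (a j * (cmod (W $$ (j, i)))\<^sup>2) * (c * (a j / x i) powr r)) = c * S x a W"
        unfolding S_def sum_distrib_left
      proof (intro sum.cong refl)
        fix i j assume "i \<in> {..<l}" "j \<in> {..<n}"
        hence pos': "x i > 0" "a j > 0" using pos by auto
        have "a j * (a j / x i) powr r = x i powr (1 - p) * a j powr p"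
          using pos' powr_mult_base[of "a j" r] powr_minus[of "x i" r]
          by (simp add: powr_divide r_def inverse_eq_divide)
        thus "a j * (cmod (W $$ (j, i)))\<^sup>2 * (c * (a j / x i) powr r)
          = c * (x i powr (1 - p) * a j powr p * (cmod (W $$ (j, i)))\<^sup>2)"
          by (metis mult.assoc mult.commute)
      qed
      finally show ?thesis
      proof (rule has_integral_eq[rotated])
        fix s :: real assume s: "s \<in> {0<..}"
        show "(\<Sum>i<l. \<Sum>j<n. (a j * (cmod (W $$ (j, i)))\<^sup>2) *
          (s powr (r - 1) * ((a j / x i) / (a j / x i + s)))) = s powr (r - 1) * quad_over_lin 1 s l n x a W"
          unfolding quad_over_lin_def sum_distrib_left
        proof (intro sum.cong refl)
          fix i j assume "i \<in> {..<l}" "j \<in> {..<n}"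
          hence pos': "x i > 0" "a j > 0" using pos by auto
          have eq: "(a j / x i) / (a j / x i + s) = a j / (1 * a j + s * x i)"
            using pos' s by (simp add: field_simps)
          show "(a j * (cmod (W $$ (j, i)))\<^sup>2) * (s powr (r - 1) * ((a j / x i) / (a j / x i + s)))
            = s powr (r - 1) * ((a j)\<^sup>2 / (1 * a j + s * x i) * (cmod (W $$ (j, i)))\<^sup>2)"
            unfolding eq by (simp add: power2_eq_square)
        qed
      qed
    qed
    have "c * S x a (U\<^sup>H * (Z * V))
      \<le> t * (c * S x1 a1 (U1\<^sup>H * (Z * V1))) + (1 - t) * (c * S x2 a2 (U2\<^sup>H * (Z * V2)))"
    proof (rule has_integral_le)
      show "((\<lambda>s. s powr (r - 1) * quad_over_lin 1 s l n x a (U\<^sup>H * (Z * V))) has_integral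
        c * S x a (U\<^sup>H * (Z * V))) {0<..}"
        using e(2) f(2) by (rule int[rotated])
      show "((\<lambda>s. t * (s powr (r - 1) * quad_over_lin 1 s l n x1 a1 (U1\<^sup>H * (Z * V1)))
          + (1 - t) * (s powr (r - 1) * quad_over_lin 1 s l n x2 a2 (U2\<^sup>H * (Z * V2)))) has_integral
        t * (c * S x1 a1 (U1\<^sup>H * (Z * V1))) + (1 - t) * (c * S x2 a2 (U2\<^sup>H * (Z * V2)))) {0<..}"
        using e1(2) f1(2) e2(2) f2(2) by (intro has_integral_add has_integral_mult_right int) auto
      fix s :: real assume "s \<in> {0<..}"
      thus "s powr (r - 1) * quad_over_lin 1 s l n x a (U\<^sup>H * (Z * V))
        \<le> t * (s powr (r - 1) * quad_over_lin 1 s l n x1 a1 (U1\<^sup>H * (Z * V1)))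
          + (1 - t) * (s powr (r - 1) * quad_over_lin 1 s l n x2 a2 (U2\<^sup>H * (Z * V2)))"
        using mult_left_mono[OF quad[of 1 s], of "s powr (r - 1)"] by (simp add: algebra_simps)
    qed
    hence "c * S x a (U\<^sup>H * (Z * V))
      \<le> c * (t * S x1 a1 (U1\<^sup>H * (Z * V1)) + (1 - t) * S x2 a2 (U2\<^sup>H * (Z * V2)))"
      by (simp add: algebra_simps)
    thus ?thesis unfolding F using c(1) by simp
  qed
qed

text \<open>The quadratic form is reused with the identity in the slot of \<open>A\<close> and
  \<open>B\<close> in the slot of \<open>X\<close>, which is why \<open>Z\<close> appears there
  through its adjoint. It gives convexity of 1 / (1 + \<nu> b), hence concavity of b / (b + s) = 1 -
  1 / (1 + b/s), and integration over s gives the powers strictly between 0 and 1.\<close>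

theorem powr_form_concave:
  assumes r: "0 \<le> r" "r \<le> 1" and B1: "posdef_mat m B1" and B2: "posdef_mat m B2"
    and Z: "dim_row Z = m" and t: "0 \<le> t" "t \<le> 1"
  defines "F \<equiv> \<lambda>B. Re (mtrace (Z\<^sup>H * (mat_powr B r * Z)))"
  shows "t * F B1 + (1 - t) * F B2 \<le> F (complex_of_real t \<cdot>\<^sub>m B1 + complex_of_real (1 - t) \<cdot>\<^sub>m B2)"
proof -
  let ?B = "complex_of_real t \<cdot>\<^sub>m B1 + complex_of_real (1 - t) \<cdot>\<^sub>m B2"
  define k where "k = dim_col Z"
  note h1 = posdef_hermitian[OF B1] and h2 = posdef_hermitian[OF B2]
  note h = posdef_hermitian[OF posdef_convex_comb[OF B1 B2 t]]
  obtain V1 b1 where e1: "eig m B1 V1 b1" "\<And>j. j < m \<Longrightarrow> b1 j > 0" using posdef_eig[OF B1] by blast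
  obtain V2 b2 where e2: "eig m B2 V2 b2" "\<And>j. j < m \<Longrightarrow> b2 j > 0" using posdef_eig[OF B2] by blast
  obtain V b where e: "eig m ?B V b" "\<And>j. j < m \<Longrightarrow> b j > 0"
    using posdef_eig[OF posdef_convex_comb[OF B1 B2 t]] by blast
  have one: "eig k (1\<^sub>m k) (1\<^sub>m k) (\<lambda>_. 1)"
    by (simp add: eig_def unitary_mat_def diagm_one)
  have one_comb: "complex_of_real t \<cdot>\<^sub>m 1\<^sub>m k + complex_of_real (1 - t) \<cdot>\<^sub>m 1\<^sub>m k = 1\<^sub>m k"
    by (intro eq_matI) auto
  define w where "w V i = (\<Sum>j<k. (cmod (((1\<^sub>m k)\<^sup>H * (Z\<^sup>H * V)) $$ (j, i)))\<^sup>2)" for V i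
  define S where "S g b V = (\<Sum>i<m. g (b i) * w V i)" for g :: "real \<Rightarrow> real" and b V
  have tr: "Re (mtrace (Z\<^sup>H * (mat_fun g B * Z))) = S g b V" if "eig m B V b" for g B V b
  proof -
    note hB = eig_hermitian[OF that]
    have "mtrace (Z\<^sup>H * (mat_fun g B * Z)) = mtrace (mat_fun g B * (Z * Z\<^sup>H))"
      using Z hermitianD[OF mat_fun_hermitian[OF hB, of g]]
      by (subst mtrace_mult_comm) (simp_all add: mult_assoc_dim)
    also have "\<dots> = mtrace (mat_fun g B * ((Z\<^sup>H)\<^sup>H * (mat_fun (\<lambda>_. 1) (1\<^sub>m k) * Z\<^sup>H)))"
      using mat_fun_one[OF eig_hermitian[OF one]] by (simp add: k_def)
    finally show ?thesis
      using Re_mtrace_eig_pair[OF that one, of "Z\<^sup>H" g "\<lambda>_. 1"] Z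
      by (simp add: S_def w_def k_def sum_distrib_left)
  qed
  have tot: "S (\<lambda>_. 1) b V = Re (mtrace (Z\<^sup>H * Z))" if "eig m B V b" for B V b
    using tr[OF that, of "\<lambda>_. 1"] Z by (simp add: mat_fun_one[OF eig_hermitian[OF that]])
  have quad: "S (\<lambda>b. 1 / (1 + \<nu> * b)) b V
      \<le> t * S (\<lambda>b. 1 / (1 + \<nu> * b)) b1 V1 + (1 - t) * S (\<lambda>b. 1 / (1 + \<nu> * b)) b2 V2" if "\<nu> > 0" for \<nu>
  proof -
    have "quad_over_lin 1 \<nu> m k b (\<lambda>_. 1) ((1\<^sub>m k)\<^sup>H * (Z\<^sup>H * V))
      \<le> t * quad_over_lin 1 \<nu> m k b1 (\<lambda>_. 1) ((1\<^sub>m k)\<^sup>H * (Z\<^sup>H * V1))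
        + (1 - t) * quad_over_lin 1 \<nu> m k b2 (\<lambda>_. 1) ((1\<^sub>m k)\<^sup>H * (Z\<^sup>H * V2))"
      using that e(2) e1(2) e2(2) Z one_comb one
      by (intro quad_over_lin_convex[OF one one e1(1) e2(1) _ e(1)] t)
        (auto simp: k_def intro!: add_pos_pos)
    thus ?thesis by (simp add: quad_over_lin_def S_def w_def sum_distrib_left)
  qed
  consider "r = 0" | "r = 1" | "0 < r" "r < 1" using r by force
  hence "t * S (\<lambda>x. x powr r) b1 V1 + (1 - t) * S (\<lambda>x. x powr r) b2 V2 \<le> S (\<lambda>x. x powr r) b V"
  proof cases
    case 1
    \<comment> \<open>Positivity of the eigenvalues matters, since \<open>0 powr 0 = 0\<close>; the
      form is then the constant \<open>mtrace (Z\<^sup>H * Z)\<close>.\<close>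
    have "S (\<lambda>x. x powr r) b V = S (\<lambda>_. 1) b V" if "\<And>j. j < m \<Longrightarrow> b j > 0" for b V
      unfolding S_def 1 using that by (intro sum.cong refl) (simp, metis less_irrefl)
    thus ?thesis using e(2) e1(2) e2(2) tot[OF e(1)] tot[OF e1(1)] tot[OF e2(1)]
      by (simp add: algebra_simps)
  next
    case 2
    have "S (\<lambda>x. x powr r) b V = S (\<lambda>x. x) b V" if "\<And>j. j < m \<Longrightarrow> b j > 0" for b V
      unfolding S_def 2 using that by (intro sum.cong refl) (simp add: less_imp_le)
    moreover have "S (\<lambda>x. x) b V = t * S (\<lambda>x. x) b1 V1 + (1 - t) * S (\<lambda>x. x) b2 V2"
      using tr[OF e(1), of "\<lambda>x. x", unfolded mat_fun_id[OF h]] tr[OF e1(1), of "\<lambda>x. x"] tr[OF e2(1), of "\<lambda>x. x"]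
        Z hermitianD[OF h1] hermitianD[OF h2]
      by (simp add: mat_fun_id[OF h1] mat_fun_id[OF h2]
          mult_add_dim mult_smult_dim mtrace_add mtrace_smult)
    ultimately show ?thesis using e(2) e1(2) e2(2) by simp
  next
    case 3
    obtain c where c: "c > 0" "\<And>u. u > 0 \<Longrightarrow>
        ((\<lambda>s. s powr (r - 1) * (u / (u + s))) has_integral c * u powr r) {0<..}"
      using powr_integral_representation[OF 3] by blast
    have int: "((\<lambda>s. s powr (r - 1) * S (\<lambda>b. b / (b + s)) b V) has_integral c * S (\<lambda>x. x powr r) b V) {0<..}"
      if pos: "\<And>j. j < m \<Longrightarrow> b j > 0" for b V
    proof -
      have "((\<lambda>s. \<Sum>i<m. w V i * (s powr (r - 1) * (b i / (b i + s)))) has_integral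
          (\<Sum>i<m. w V i * (c * b i powr r))) {0<..}"
        using pos by (intro has_integral_sum has_integral_mult_right c) auto
      thus ?thesis by (simp add: S_def sum_distrib_left mult_ac)
    qed
    have res: "t * S (\<lambda>b. b / (b + s)) b1 V1 + (1 - t) * S (\<lambda>b. b / (b + s)) b2 V2
      \<le> S (\<lambda>b. b / (b + s)) b V" if s: "s > 0" for s
    proof -
      have eq: "S (\<lambda>b. b / (b + s)) b V = Re (mtrace (Z\<^sup>H * Z)) - S (\<lambda>b. 1 / (1 + (1 / s) * b)) b V"
        if e: "eig m B V b" and pos: "\<And>j. j < m \<Longrightarrow> b j > 0" for B V b
      proof -
        have "S (\<lambda>b. b / (b + s)) b V + S (\<lambda>b. 1 / (1 + (1 / s) * b)) b V = S (\<lambda>_. 1) b V"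
          unfolding S_def sum.distrib[symmetric]
        proof (intro sum.cong refl)
          fix i assume "i \<in> {..<m}"
          hence "b i > 0" using pos by auto
          moreover from this have "1 / (1 + 1 / s * b i) = s / (b i + s)"
            using s by (simp add: field_simps)
          ultimately have "b i / (b i + s) + 1 / (1 + 1 / s * b i) = 1"
            using s by (simp add: add_divide_distrib[symmetric])
          thus "b i / (b i + s) * w V i + 1 / (1 + 1 / s * b i) * w V i = 1 * w V i"
            by (metis distrib_right)
        qed
        thus ?thesis using tot[OF e] by simp
      qed
      show ?thesis
        using quad[of "1 / s"] s unfolding eq[OF e, simplified] eq[OF e1, simplified] eq[OF e2, simplified]
        by (simp add: algebra_simps)
    qed
    have "t * (c * S (\<lambda>x. x powr r) b1 V1) + (1 - t) * (c * S (\<lambda>x. x powr r) b2 V2)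
      \<le> c * S (\<lambda>x. x powr r) b V"
    proof (rule has_integral_le)
      show "((\<lambda>s. t * (s powr (r - 1) * S (\<lambda>b. b / (b + s)) b1 V1)
          + (1 - t) * (s powr (r - 1) * S (\<lambda>b. b / (b + s)) b2 V2)) has_integral
        t * (c * S (\<lambda>x. x powr r) b1 V1) + (1 - t) * (c * S (\<lambda>x. x powr r) b2 V2)) {0<..}"
        using e1(2) e2(2) by (intro has_integral_add has_integral_mult_right int) auto
      show "((\<lambda>s. s powr (r - 1) * S (\<lambda>b. b / (b + s)) b V) has_integral c * S (\<lambda>x. x powr r) b V) {0<..}"
        using e(2) by (rule int)
      fix s :: real assume "s \<in> {0<..}"
      thus "t * (s powr (r - 1) * S (\<lambda>b. b / (b + s)) b1 V1)
          + (1 - t) * (s powr (r - 1) * S (\<lambda>b. b / (b + s)) b2 V2)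
        \<le> s powr (r - 1) * S (\<lambda>b. b / (b + s)) b V"
        using mult_left_mono[OF res[of s], of "s powr (r - 1)"] by (simp add: algebra_simps)
    qed
    hence "c * (t * S (\<lambda>x. x powr r) b1 V1 + (1 - t) * S (\<lambda>x. x powr r) b2 V2)
      \<le> c * S (\<lambda>x. x powr r) b V"
      by (simp add: algebra_simps)
    thus ?thesis using c(1) by simp
  qed
  thus ?thesis unfolding F_def mat_powr_def tr[OF e(1)] tr[OF e1(1)] tr[OF e2(1)] .
qed

subsection \<open>Positive maps\<close>

lemma mat_powr_dim:
  assumes "posdef_mat n A"
  shows "dim_row (mat_powr A a) = n" "dim_col (mat_powr A a) = n" "(mat_powr A a)\<^sup>H = mat_powr A a"
    "mat_powr A a \<in> carrier_mat n n"
proof -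
  have "hermitian_mat n (mat_powr A a)"
    unfolding mat_powr_def using mat_fun_hermitian[OF posdef_hermitian[OF assms]] .
  thus "dim_row (mat_powr A a) = n" "dim_col (mat_powr A a) = n" "(mat_powr A a)\<^sup>H = mat_powr A a"
    "mat_powr A a \<in> carrier_mat n n"
    by (auto simp: hermitian_mat_def)
qed

lemma mat_powr_posdef: "posdef_mat n A \<Longrightarrow> posdef_mat n (mat_powr A a)"
  unfolding mat_powr_def by (rule mat_fun_posdef) auto

lemma mat_powr_one: "posdef_mat n A \<Longrightarrow> mat_powr A 1 = A"
  unfolding mat_powr_def
  using mat_fun_cong_pos[of n A "\<lambda>x. x powr 1" "\<lambda>x. x"] mat_fun_id[OF posdef_hermitian] by auto

lemma mat_powr_zero: "posdef_mat n A \<Longrightarrow> mat_powr A 0 = 1\<^sub>m n"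
  unfolding mat_powr_def
  using mat_fun_cong_pos[of n A "\<lambda>x. x powr 0" "\<lambda>x. 1"] mat_fun_one[OF posdef_hermitian] by auto

lemma mat_powr_add: "posdef_mat n A \<Longrightarrow> mat_powr A a * mat_powr A b = mat_powr A (a + b)"
  unfolding mat_powr_def
  using mat_fun_mult[OF posdef_hermitian, of n A "\<lambda>x. x powr a" "\<lambda>x. x powr b"] by (simp add: powr_add)

lemma mat_powr_add_left:
  "posdef_mat n A \<Longrightarrow> dim_row Z = n \<Longrightarrow> mat_powr A a * (mat_powr A b * Z) = mat_powr A (a + b) * Z"
  using mat_powr_dim[of n A] by (simp add: mult_assoc_dim[symmetric] mat_powr_add)

lemma mat_powr_powr: "posdef_mat n A \<Longrightarrow> mat_powr (mat_powr A a) b = mat_powr A (a * b)"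
  unfolding mat_powr_def
  using mat_fun_comp[OF posdef_hermitian, of n A "\<lambda>x. x powr b" "\<lambda>x. x powr a"] by (simp add: powr_powr)

lemma mat_powr_inverse:
  assumes "posdef_mat n A"
  shows "A * mat_powr A (-1) = 1\<^sub>m n" "mat_powr A (-1) * A = 1\<^sub>m n"
    "dim_row Z = n \<Longrightarrow> A * (mat_powr A (-1) * Z) = Z" "dim_row Z = n \<Longrightarrow> mat_powr A (-1) * (A * Z) = Z"
proof -
  note d = mat_powr_dim[OF assms] and d' = hermitianD[OF posdef_hermitian[OF assms]]
  show 1: "A * mat_powr A (-1) = 1\<^sub>m n" "mat_powr A (-1) * A = 1\<^sub>m n"
    using mat_powr_add[OF assms, of 1 "-1"] mat_powr_add[OF assms, of "-1" 1]
    by (simp_all add: mat_powr_one[OF assms] mat_powr_zero[OF assms])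
  show "dim_row Z = n \<Longrightarrow> A * (mat_powr A (-1) * Z) = Z" "dim_row Z = n \<Longrightarrow> mat_powr A (-1) * (A * Z) = Z"
    using 1 d d' by (simp_all add: mult_assoc_dim[symmetric])
qed

lemma posdef_one: "posdef_mat n (1\<^sub>m n)"
  by (rule eig_posdef[of n _ "1\<^sub>m n" "\<lambda>_. 1"]) (simp_all add: eig_def unitary_mat_def diagm_one)

lemma mtrace_gram_nonneg: "Re (mtrace (Y\<^sup>H * Y)) \<ge> 0"
  using posdef_form_nonneg[OF posdef_one, of Y "dim_row Y"] by simp

text \<open>The passage to the limit as \<open>e\<close> tends to 0. It serves to go from strictly
  positive to positive matrices, and from strictly positive to nonnegative subgradients.\<close>

lemma nonneg_if_nonneg_perturbed:
  fixes x y :: real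
  assumes "\<And>e. e > 0 \<Longrightarrow> 0 \<le> x + e * y"
  shows "0 \<le> x"
proof (rule ccontr)
  assume x: "\<not> 0 \<le> x"
  define e where "e = - x / (\<bar>y\<bar> + 1)"
  have e: "e > 0" using x by (simp add: e_def divide_neg_pos)
  have "e * y < e * (\<bar>y\<bar> + 1)" using e by (intro mult_strict_left_mono) auto
  also have "\<dots> = - x" by (simp add: e_def)
  finally show False using assms[OF e] by simp
qed

section \<open>Linear maps and traces on finite sums, written entrywise so that an empty sum is the
  zero matrix of the right size\<close>

lemma mat_sum_insert:
  assumes "finite I" "x \<notin> I" "F x \<in> carrier_mat m m"
  shows "mat m m (\<lambda>(a, b). \<Sum>k\<in>insert x I. c k * F k $$ (a, b))
    = c x \<cdot>\<^sub>m F x + mat m m (\<lambda>(a, b). \<Sum>k\<in>I. c k * F k $$ (a, b))"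
  using assms by (intro eq_matI) auto

lemma linear_map_sum:
  assumes lin: "linear_mat_map m l \<Psi>" and I: "finite I" "\<And>k. k \<in> I \<Longrightarrow> F k \<in> carrier_mat m m"
  shows "\<Psi> (mat m m (\<lambda>(a, b). \<Sum>k\<in>I. c k * F k $$ (a, b)))
    = mat l l (\<lambda>(a, b). \<Sum>k\<in>I. c k * \<Psi> (F k) $$ (a, b))"
  using I
proof (induct I rule: finite_induct)
  case empty
  \<comment> \<open>The zero matrix is written as 0 times the identity so that homogeneity of
    \<open>\<Psi>\<close> applies.\<close>
  have z: "mat m m (\<lambda>(a, b). \<Sum>k\<in>{}. c k * F k $$ (a, b)) = 0 \<cdot>\<^sub>m (1\<^sub>m m :: complex mat)"
    by (intro eq_matI) auto
  have "\<Psi> (0 \<cdot>\<^sub>m 1\<^sub>m m) = 0 \<cdot>\<^sub>m \<Psi> (1\<^sub>m m)" "\<Psi> (1\<^sub>m m) \<in> carrier_mat l l"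
    using lin one_carrier_mat[of m] unfolding linear_mat_map_def by blast+
  thus ?case unfolding z by (intro eq_matI) auto
next
  case (insert x I)
  have Fx: "F x \<in> carrier_mat m m" and \<Psi>Fx: "\<Psi> (F x) \<in> carrier_mat l l"
    using insert lin by (auto simp: linear_mat_map_def)
  have "\<Psi> (c x \<cdot>\<^sub>m F x + mat m m (\<lambda>(a, b). \<Sum>k\<in>I. c k * F k $$ (a, b)))
    = c x \<cdot>\<^sub>m \<Psi> (F x) + \<Psi> (mat m m (\<lambda>(a, b). \<Sum>k\<in>I. c k * F k $$ (a, b)))"
    using lin Fx by (simp add: linear_mat_map_def)
  also have "\<Psi> (mat m m (\<lambda>(a, b). \<Sum>k\<in>I. c k * F k $$ (a, b)))
    = mat l l (\<lambda>(a, b). \<Sum>k\<in>I. c k * \<Psi> (F k) $$ (a, b))"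
    using insert by blast
  finally show ?case
    unfolding mat_sum_insert[of I x F m, OF insert(1,2) Fx]
      mat_sum_insert[of I x "\<lambda>k. \<Psi> (F k)" l, OF insert(1,2) \<Psi>Fx] .
qed

lemma mtrace_form_sum:
  assumes I: "finite I" "\<And>k. k \<in> I \<Longrightarrow> F k \<in> carrier_mat l l"
    and d: "dim_row P = l" "dim_row Q = l" "dim_col P = dim_col Q"
  shows "mtrace (P\<^sup>H * (mat l l (\<lambda>(a, b). \<Sum>k\<in>I. c k * F k $$ (a, b)) * Q))
    = (\<Sum>k\<in>I. c k * mtrace (P\<^sup>H * (F k * Q)))"
  using I
proof (induct I rule: finite_induct)
  case empty
  have z: "mat l l (\<lambda>(a, b). \<Sum>k\<in>{}. c k * F k $$ (a, b)) = 0 \<cdot>\<^sub>m (1\<^sub>m l :: complex mat)"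
    by (intro eq_matI) auto
  show ?case unfolding z using d by (simp add: mult_smult_dim mtrace_smult)
next
  case (insert x I)
  have Fx: "F x \<in> carrier_mat l l" using insert by auto
  let ?M = "mat l l (\<lambda>(a, b). \<Sum>k\<in>I. c k * F k $$ (a, b))"
  have "mtrace (P\<^sup>H * ((c x \<cdot>\<^sub>m F x + ?M) * Q)) = c x * mtrace (P\<^sup>H * (F x * Q)) + mtrace (P\<^sup>H * (?M * Q))"
    using Fx d by (simp add: mult_add_dim mult_smult_dim mtrace_add mtrace_smult)
  also have "mtrace (P\<^sup>H * (?M * Q)) = (\<Sum>k\<in>I. c k * mtrace (P\<^sup>H * (F k * Q)))"
    using insert by blast
  finally show ?case
    unfolding mat_sum_insert[of I x F l, OF insert(1,2) Fx]
    unfolding sum.insert[OF insert(1,2)] .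
qed

lemma mtrace_diagm_form:
  assumes "dim_row G = m" "dim_col G = m" "dim_row Z = m"
  shows "Re (mtrace (Z\<^sup>H * ((G\<^sup>H * (diagm m d * G)) * Z)))
    = (\<Sum>i<dim_col Z. \<Sum>j<m. d j * (cmod ((G * Z) $$ (j, i)))\<^sup>2)"
proof -
  have "mtrace (Z\<^sup>H * ((G\<^sup>H * (diagm m d * G)) * Z))
    = mtrace (diagm (dim_col Z) (\<lambda>_. 1) * ((G * Z)\<^sup>H * (diagm m d * (G * Z))))"
    using assms by (simp add: diagm_one mult_assoc_dim adj_mult)
  also have "\<dots> = (\<Sum>i<dim_col Z. \<Sum>j<m. complex_of_real (1 * d j) *
      (cnj ((G * Z) $$ (j, i)) * (G * Z) $$ (j, i)))"
    using assms by (intro mtrace_diagm_sandwich) simp_all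
  finally show ?thesis unfolding cnj_mult_self by simp
qed

text \<open>Strict positivity speaks only about positive definite matrices, so it is applied to
  \<open>M\<close> plus a small multiple of the identity; linearity makes the resulting form affine
  in \<open>e\<close>, and \<open>e\<close> tends to 0.\<close>

lemma positive_map_form:
  assumes lin: "linear_mat_map m l \<Psi>" and pos: "strictly_positive_map m l \<Psi>"
    and M: "hermitian_mat m M"
    and nn: "\<And>Z. dim_row Z = m \<Longrightarrow> dim_col Z = 1 \<Longrightarrow> Re (mtrace (Z\<^sup>H * (M * Z))) \<ge> 0"
  shows "dim_row Z = l \<Longrightarrow> Re (mtrace (Z\<^sup>H * (\<Psi> M * Z))) \<ge> 0" "(\<Psi> M)\<^sup>H = \<Psi> M"
proof -
  note Md = hermitianD[OF M]
  have Mc: "M \<in> carrier_mat m m" using M by (simp add: hermitian_mat_def)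
  have \<Psi>d: "\<Psi> M \<in> carrier_mat l l" "\<Psi> (1\<^sub>m m) \<in> carrier_mat l l"
    using lin Mc by (auto simp: linear_mat_map_def)
  have pd: "posdef_mat l (\<Psi> M + complex_of_real e \<cdot>\<^sub>m \<Psi> (1\<^sub>m m))" if e: "e > 0" for e
  proof -
    have "posdef_mat m (M + complex_of_real e \<cdot>\<^sub>m 1\<^sub>m m)"
    proof (rule posdefI)
      show "hermitian_mat m (M + complex_of_real e \<cdot>\<^sub>m 1\<^sub>m m)"
        using Md by (auto simp: hermitian_mat_def adj_add adj_smult intro: carrier_matI)
      fix Z :: "complex mat" assume Z: "dim_row Z = m" "dim_col Z = 1" "Z \<noteq> 0\<^sub>m m 1"
      show "Re (mtrace (Z\<^sup>H * ((M + complex_of_real e \<cdot>\<^sub>m 1\<^sub>m m) * Z))) > 0"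
        using nn[OF Z(1,2)] posdef_form_pos[OF posdef_one Z] e Z Md
        by (simp add: mult_add_dim mult_smult_dim mtrace_add mtrace_smult add_nonneg_pos)
    qed
    moreover have "\<Psi> (M + complex_of_real e \<cdot>\<^sub>m 1\<^sub>m m) = \<Psi> M + complex_of_real e \<cdot>\<^sub>m \<Psi> (1\<^sub>m m)"
      using lin Mc by (simp add: linear_mat_map_def)
    ultimately show ?thesis using pos by (metis strictly_positive_map_def)
  qed
  show "Re (mtrace (Z\<^sup>H * (\<Psi> M * Z))) \<ge> 0" if Z: "dim_row Z = l"
  proof (rule nonneg_if_nonneg_perturbed)
    fix e :: real assume e: "e > 0"
    show "0 \<le> Re (mtrace (Z\<^sup>H * (\<Psi> M * Z))) + e * Re (mtrace (Z\<^sup>H * (\<Psi> (1\<^sub>m m) * Z)))"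
      using posdef_form_nonneg[OF pd[OF e] Z] Z \<Psi>d
      by (simp add: mult_add_dim mult_smult_dim mtrace_add mtrace_smult)
  qed
  have "posdef_mat l (\<Psi> (1\<^sub>m m))" using pos posdef_one by (simp add: strictly_positive_map_def)
  hence h1: "(\<Psi> (1\<^sub>m m))\<^sup>H = \<Psi> (1\<^sub>m m)" using hermitianD posdef_hermitian by blast
  \<comment> \<open>At \<open>e = 1\<close> the perturbed image is positive definite, hence
    Hermitian; cancelling the Hermitian matrix \<open>\<Psi> (1\<^sub>m m)\<close> leaves
    \<open>\<Psi> M\<close>.\<close>
  have "(\<Psi> M + 1 \<cdot>\<^sub>m \<Psi> (1\<^sub>m m))\<^sup>H = \<Psi> M + 1 \<cdot>\<^sub>m \<Psi> (1\<^sub>m m)"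
    using hermitianD(3)[OF posdef_hermitian[OF pd[of 1]]] by simp
  hence eq: "(\<Psi> M)\<^sup>H + 1 \<cdot>\<^sub>m \<Psi> (1\<^sub>m m) = \<Psi> M + 1 \<cdot>\<^sub>m \<Psi> (1\<^sub>m m)"
    using \<Psi>d h1 by (simp add: adj_add adj_smult)
  show "(\<Psi> M)\<^sup>H = \<Psi> M"
  proof (rule eq_matI)
    fix i j assume "i < dim_row (\<Psi> M)" "j < dim_col (\<Psi> M)"
    thus "(\<Psi> M)\<^sup>H $$ (i, j) = \<Psi> M $$ (i, j)"
      using arg_cong[OF eq, of "\<lambda>M. M $$ (i, j)"] \<Psi>d by simp
  qed (use \<Psi>d in auto)
qed

text \<open>Each summand \<open>d\<^sub>j v - u\<close> is tested against the positive matrix \<open>\<Psi>(G\<^sup>H E\<^sub>j\<^sub>j G)\<close>;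
  plain positivity of \<open>\<Psi>\<close> therefore suffices.\<close>

lemma kadison_diag:
  assumes lin: "linear_mat_map m l \<Psi>" and pos: "strictly_positive_map m l \<Psi>"
    and G: "dim_row G = m" "dim_col G = m"
    and uv: "dim_row u = l" "dim_row v = l" "dim_col u = dim_col v"
  shows "2 * Re (mtrace (u\<^sup>H * (\<Psi> (G\<^sup>H * (diagm m d * G)) * v)))
    \<le> Re (mtrace (v\<^sup>H * (\<Psi> (G\<^sup>H * (diagm m (\<lambda>j. (d j)\<^sup>2) * G)) * v)))
      + Re (mtrace (u\<^sup>H * (\<Psi> (G\<^sup>H * G) * u)))"
proof -
  define R where "R j = G\<^sup>H * (diagm m (\<lambda>k. if k = j then 1 else 0) * G)" for j
  have Rd: "R j \<in> carrier_mat m m" for j using G by (auto simp: R_def intro: carrier_matI)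
  have \<Psi>R: "\<Psi> (R j) \<in> carrier_mat l l" for j using lin Rd by (auto simp: linear_mat_map_def)
  have Rent: "R j $$ (a, b) = cnj (G $$ (j, a)) * G $$ (j, b)" if "a < m" "b < m" "j < m" for a b j
  proof -
    have "R j $$ (a, b) = (\<Sum>k<m. if k = j then cnj (G $$ (j, a)) * G $$ (j, b) else 0)"
      unfolding R_def using G that
      by (auto simp: mult_index[of a "G\<^sup>H"] diagm_mult_index simp del: sum.delta sum.delta' intro!: sum.cong)
    thus ?thesis using that by simp
  qed
  have decomp: "G\<^sup>H * (diagm m e * G) = mat m m (\<lambda>(a, b). \<Sum>j<m. complex_of_real (e j) * R j $$ (a, b))" for e
  proof (rule eq_matI)
    fix a b assume "a < dim_row (mat m m (\<lambda>(a, b). \<Sum>j<m. complex_of_real (e j) * R j $$ (a, b)))"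
      "b < dim_col (mat m m (\<lambda>(a, b). \<Sum>j<m. complex_of_real (e j) * R j $$ (a, b)))"
    thus "(G\<^sup>H * (diagm m e * G)) $$ (a, b)
      = mat m m (\<lambda>(a, b). \<Sum>j<m. complex_of_real (e j) * R j $$ (a, b)) $$ (a, b)"
      using G by (simp add: mult_index[of a "G\<^sup>H"] diagm_mult_index Rent mult_ac)
  qed (use G in auto)
  have tr: "mtrace (P\<^sup>H * (\<Psi> (G\<^sup>H * (diagm m e * G)) * Q))
    = (\<Sum>j<m. complex_of_real (e j) * mtrace (P\<^sup>H * (\<Psi> (R j) * Q)))"
    if "dim_row P = l" "dim_row Q = l" "dim_col P = dim_col Q" for e P Q
    unfolding decomp linear_map_sum[OF lin finite_lessThan Rd]
    using that \<Psi>R by (intro mtrace_form_sum) auto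
  have GG: "G\<^sup>H * G = G\<^sup>H * (diagm m (\<lambda>_. 1) * G)" using G by (simp add: diagm_one)
  have pos_term: "0 \<le> (d j)\<^sup>2 * Re (mtrace (v\<^sup>H * (\<Psi> (R j) * v))) - 2 * d j * Re (mtrace (u\<^sup>H * (\<Psi> (R j) * v)))
      + Re (mtrace (u\<^sup>H * (\<Psi> (R j) * u)))" for j
  proof -
    have nnR: "Re (mtrace (Z\<^sup>H * (R j * Z))) \<ge> 0" if "dim_row Z = m" for Z
      unfolding R_def mtrace_diagm_form[OF G that] by (intro sum_nonneg) auto
    have hR: "hermitian_mat m (R j)"
      using Rd[of j] G by (simp add: hermitian_mat_def) (simp add: R_def adj_mult mult_assoc_dim)
    note pf = positive_map_form[OF lin pos hR nnR]
    let ?w = "complex_of_real (d j) \<cdot>\<^sub>m v + (- 1) \<cdot>\<^sub>m u"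
    have "mtrace (v\<^sup>H * (\<Psi> (R j) * u)) = mtrace ((u\<^sup>H * (\<Psi> (R j) * v))\<^sup>H)"
      using uv \<Psi>R[of j] pf(2) by (simp add: adj_mult mult_assoc_dim)
    also have "\<dots> = cnj (mtrace (u\<^sup>H * (\<Psi> (R j) * v)))"
      using uv \<Psi>R[of j] by (intro mtrace_adj) auto
    finally have sym: "Re (mtrace (v\<^sup>H * (\<Psi> (R j) * u))) = Re (mtrace (u\<^sup>H * (\<Psi> (R j) * v)))" by simp
    have "0 \<le> Re (mtrace (?w\<^sup>H * (\<Psi> (R j) * ?w)))"
      using uv by (intro pf(1)) auto
    also have "\<dots> = (d j)\<^sup>2 * Re (mtrace (v\<^sup>H * (\<Psi> (R j) * v))) - d j * Re (mtrace (u\<^sup>H * (\<Psi> (R j) * v)))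
      - d j * Re (mtrace (v\<^sup>H * (\<Psi> (R j) * u))) + Re (mtrace (u\<^sup>H * (\<Psi> (R j) * u)))"
      using uv \<Psi>R[of j]
      by (simp add: adj_add adj_smult mult_add_dim mult_smult_dim mtrace_add mtrace_smult
          algebra_simps power2_eq_square)
    finally show ?thesis unfolding sym by simp
  qed
  have "0 \<le> (\<Sum>j<m. (d j)\<^sup>2 * Re (mtrace (v\<^sup>H * (\<Psi> (R j) * v))) - 2 * d j * Re (mtrace (u\<^sup>H * (\<Psi> (R j) * v)))
      + Re (mtrace (u\<^sup>H * (\<Psi> (R j) * u))))"
    by (intro sum_nonneg pos_term)
  thus ?thesis
    unfolding GG using uv
    by (simp add: tr sum.distrib sum_subtractf sum_distrib_left mult.assoc)
qed

text \<open>A congruence diagonalizes all three arguments at once: if \<open>U\<close> diagonalizes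
  D^(1/2) H D^(1/2) with eigenvalues \<open>d\<close> and G is the adjoint of \<open>U\<close> times
  D^(-1/2), then D^(-1), H and H D H are the matrices \<open>G\<^sup>H * (diagm m e * G)\<close>
  with e equal to 1, \<open>d\<close> and the square of \<open>d\<close>. This is the case treated
  by \<open>kadison_diag\<close>.\<close>

lemma kadison_inequality:
  assumes lin: "linear_mat_map m l \<Psi>" and pos: "strictly_positive_map m l \<Psi>"
    and D: "posdef_mat m D" and H: "hermitian_mat m H"
    and uv: "dim_row u = l" "dim_row v = l" "dim_col u = dim_col v"
  shows "2 * Re (mtrace (u\<^sup>H * (\<Psi> H * v)))
    \<le> Re (mtrace (v\<^sup>H * (\<Psi> (H * (D * H)) * v))) + Re (mtrace (u\<^sup>H * (\<Psi> (mat_powr D (-1)) * u)))"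
proof -
  define S where "S = mat_powr D (1/2)"
  define S' where "S' = mat_powr D (-1/2)"
  note Sd = mat_powr_dim[OF D, of "1/2", folded S_def] and S'd = mat_powr_dim[OF D, of "-1/2", folded S'_def]
  note Hd = hermitianD[OF H]
  have SS: "S' * S' = mat_powr D (-1)" "S * S = D" "S' * S = 1\<^sub>m m" "S * S' = 1\<^sub>m m"
    unfolding S_def S'_def by (simp_all add: mat_powr_add[OF D] mat_powr_one[OF D] mat_powr_zero[OF D])
  have SSl: "S' * (S * Z) = Z" "S * (S' * Z) = Z" if "dim_row Z = m" for Z
    using that SS Sd S'd by (simp_all add: mult_assoc_dim[symmetric])
  have "hermitian_mat m (S * (H * S))"
    using Sd Hd by (auto simp: hermitian_mat_def adj_mult mult_assoc_dim intro: carrier_matI)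
  then obtain U d where e: "eig m (S * (H * S)) U d" using hermitian_eig by blast
  note u = unitaryD[OF eigD(1)[OF e]]
  define G where "G = U\<^sup>H * S'"
  have Gd: "dim_row G = m" "dim_col G = m" by (auto simp: G_def u S'd)
  have 1: "G\<^sup>H * G = mat_powr D (-1)"
    using S'd by (simp add: G_def adj_mult mult_assoc_dim u SS)
  have "G\<^sup>H * (diagm m d * G) = S' * ((U * (diagm m d * U\<^sup>H)) * S')"
    using S'd by (simp add: G_def adj_mult mult_assoc_dim u)
  also have "\<dots> = H"
    unfolding eigD(2)[OF e, symmetric] using Sd S'd Hd by (simp add: mult_assoc_dim SS SSl)
  finally have 2: "G\<^sup>H * (diagm m d * G) = H" .
  have "G\<^sup>H * (diagm m (\<lambda>j. (d j)\<^sup>2) * G)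
    = S' * ((U * (diagm m d * U\<^sup>H)) * ((U * (diagm m d * U\<^sup>H)) * S'))"
    using S'd by (simp add: G_def adj_mult mult_assoc_dim u diagm_mult_left power2_eq_square)
  also have "\<dots> = H * (S * S * H)"
    unfolding eigD(2)[OF e, symmetric] using Sd S'd Hd by (simp add: mult_assoc_dim SS(4) SSl)
  also have "\<dots> = H * (D * H)" by (simp add: SS)
  finally have 3: "G\<^sup>H * (diagm m (\<lambda>j. (d j)\<^sup>2) * G) = H * (D * H)" .
  show ?thesis
    using kadison_diag[OF lin pos Gd uv, of d] unfolding 1 2 3 .
qed

text \<open>Testing \<open>powr_form_concave\<close> on \<open>H * Y\<close> shows that the
  concavity gap, sandwiched between two copies of \<open>H\<close>, is positive semidefinite, and
  \<open>\<Psi>\<close> preserves this. The factor \<open>H\<close> is there for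
  \<open>positive_map_powr_inverse_concave\<close>; with the identity for \<open>H\<close> it is
  plain concavity.\<close>

lemma positive_map_powr_concave:
  assumes lin: "linear_mat_map m l \<Psi>" and pos: "strictly_positive_map m l \<Psi>"
    and r: "0 \<le> r" "r \<le> 1" and B1: "posdef_mat m B1" and B2: "posdef_mat m B2"
    and t: "0 \<le> t" "t \<le> 1" and H: "hermitian_mat m H" and Z: "dim_row Z = l"
  defines "B \<equiv> complex_of_real t \<cdot>\<^sub>m B1 + complex_of_real (1 - t) \<cdot>\<^sub>m B2"
  shows "t * Re (mtrace (Z\<^sup>H * (\<Psi> (H * (mat_powr B1 r * H)) * Z)))
      + (1 - t) * Re (mtrace (Z\<^sup>H * (\<Psi> (H * (mat_powr B2 r * H)) * Z)))
    \<le> Re (mtrace (Z\<^sup>H * (\<Psi> (H * (mat_powr B r * H)) * Z)))"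
proof -
  have B: "posdef_mat m B" unfolding B_def by (rule posdef_convex_comb[OF B1 B2 t])
  note d = mat_powr_dim[OF B, of r] mat_powr_dim[OF B1, of r] mat_powr_dim[OF B2, of r] hermitianD[OF H]
  define M0 where "M0 B = H * (mat_powr B r * H)" for B
  have M0c: "M0 B \<in> carrier_mat m m" "M0 B1 \<in> carrier_mat m m" "M0 B2 \<in> carrier_mat m m"
    using d by (auto simp: M0_def intro!: carrier_matI)
  have M0h: "(M0 B)\<^sup>H = M0 B" "(M0 B1)\<^sup>H = M0 B1" "(M0 B2)\<^sup>H = M0 B2"
    using d by (simp_all add: M0_def adj_mult mult_assoc_dim)
  have \<Psi>c: "\<Psi> (M0 B) \<in> carrier_mat l l" "\<Psi> (M0 B1) \<in> carrier_mat l l" "\<Psi> (M0 B2) \<in> carrier_mat l l"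
    using lin M0c by (auto simp: linear_mat_map_def)
  define M where "M = M0 B + (complex_of_real (- t) \<cdot>\<^sub>m M0 B1 + complex_of_real (- (1 - t)) \<cdot>\<^sub>m M0 B2)"
  have hM: "hermitian_mat m M"
    using M0c M0h by (auto simp: M_def hermitian_mat_def adj_add adj_smult)
  have nn: "Re (mtrace (Y\<^sup>H * (M * Y))) \<ge> 0" if Y: "dim_row Y = m" for Y
  proof -
    have "Re (mtrace (Y\<^sup>H * (M * Y))) = Re (mtrace ((H * Y)\<^sup>H * (mat_powr B r * (H * Y))))
      - t * Re (mtrace ((H * Y)\<^sup>H * (mat_powr B1 r * (H * Y))))
      - (1 - t) * Re (mtrace ((H * Y)\<^sup>H * (mat_powr B2 r * (H * Y))))"
      using d Y
      by (simp add: M_def M0_def mult_add_dim mult_smult_dim mtrace_add mtrace_smult adj_mult mult_assoc_dim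
          algebra_simps)
    thus ?thesis
      using powr_form_concave[OF r B1 B2 _ t, of "H * Y"] d Y unfolding B_def[symmetric] by simp
  qed
  have "\<Psi> M = \<Psi> (M0 B) + (complex_of_real (- t) \<cdot>\<^sub>m \<Psi> (M0 B1) + complex_of_real (- (1 - t)) \<cdot>\<^sub>m \<Psi> (M0 B2))"
    using lin M0c unfolding M_def linear_mat_map_def by simp
  hence "Re (mtrace (Z\<^sup>H * (\<Psi> M * Z))) = Re (mtrace (Z\<^sup>H * (\<Psi> (M0 B) * Z)))
      - t * Re (mtrace (Z\<^sup>H * (\<Psi> (M0 B1) * Z))) - (1 - t) * Re (mtrace (Z\<^sup>H * (\<Psi> (M0 B2) * Z)))"
    using \<Psi>c Z by (simp add: mult_add_dim mult_smult_dim mtrace_add mtrace_smult algebra_simps)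
  thus ?thesis
    using positive_map_form(1)[OF lin pos hM nn Z] unfolding M0_def by simp
qed

text \<open>A concave majorant touching at the mixed point \<open>B\<close>. With H = B^q and v =
  \<Psi>(H)^(-1) Z held fixed, the Kadison inequality for D = B'^(-q) and u =
  \<open>C B' * Z\<close> bounds the form of \<open>C B'\<close> by that of \<Psi>(H B'^(-q) H) at
  \<open>v\<close>. This bound is concave in B' because 0 \<le> -q \<le> 1, and at B' = B it is an
  equality.\<close>

lemma positive_map_powr_inverse_concave:
  assumes lin: "linear_mat_map m l \<Psi>" and pos: "strictly_positive_map m l \<Psi>"
    and q: "-1 \<le> q" "q \<le> 0" and B1: "posdef_mat m B1" and B2: "posdef_mat m B2"
    and t: "0 \<le> t" "t \<le> 1" and Z: "dim_row Z = l"
  defines "B \<equiv> complex_of_real t \<cdot>\<^sub>m B1 + complex_of_real (1 - t) \<cdot>\<^sub>m B2"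
  defines "C \<equiv> \<lambda>B. mat_powr (\<Psi> (mat_powr B q)) (-1)"
  shows "t * Re (mtrace (Z\<^sup>H * (C B1 * Z))) + (1 - t) * Re (mtrace (Z\<^sup>H * (C B2 * Z)))
    \<le> Re (mtrace (Z\<^sup>H * (C B * Z)))"
proof -
  have B: "posdef_mat m B" unfolding B_def by (rule posdef_convex_comb[OF B1 B2 t])
  have \<Psi>pos: "posdef_mat l (\<Psi> (mat_powr B' q))" if "posdef_mat m B'" for B'
    using pos mat_powr_posdef[OF that] by (auto simp: strictly_positive_map_def)
  define H where "H = mat_powr B q"
  have H: "posdef_mat m H" unfolding H_def by (rule mat_powr_posdef[OF B])
  have \<Psi>H: "posdef_mat l (\<Psi> H)" unfolding H_def by (rule \<Psi>pos[OF B])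
  note Cd = mat_powr_dim[OF \<Psi>H, of "-1"]
  note \<Psi>Hd = hermitianD[OF posdef_hermitian[OF \<Psi>H]]
  define v where "v = mat_powr (\<Psi> H) (-1) * Z"
  have vd: "dim_row v = l" "dim_col v = dim_col Z" using Cd by (auto simp: v_def)
  have main: "Re (mtrace (Z\<^sup>H * (C B' * Z))) \<le> Re (mtrace (v\<^sup>H * (\<Psi> (H * (mat_powr B' (-q) * H)) * v)))"
    if B': "posdef_mat m B'" for B'
  proof -
    note \<Psi>B = \<Psi>pos[OF B']
    note C'd = mat_powr_dim[OF \<Psi>B, of "-1", folded C_def]
    note \<Psi>Bd = hermitianD[OF posdef_hermitian[OF \<Psi>B]]
    define u where "u = C B' * Z"
    have ud: "dim_row u = l" "dim_col u = dim_col Z" using C'd by (auto simp: u_def C_def)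
    have inv: "mat_powr (mat_powr B' (-q)) (-1) = mat_powr B' q" by (simp add: mat_powr_powr[OF B'])
    have "2 * Re (mtrace (u\<^sup>H * (\<Psi> H * v)))
      \<le> Re (mtrace (v\<^sup>H * (\<Psi> (H * (mat_powr B' (-q) * H)) * v)))
        + Re (mtrace (u\<^sup>H * (\<Psi> (mat_powr (mat_powr B' (-q)) (-1)) * u)))"
      using ud vd by (intro kadison_inequality[OF lin pos mat_powr_posdef[OF B'] posdef_hermitian[OF H]]) auto
    moreover have "u\<^sup>H * (\<Psi> H * v) = Z\<^sup>H * (C B' * Z)"
      using C'd Cd Z \<Psi>Hd
      by (simp add: u_def v_def C_def adj_mult mult_assoc_dim mat_powr_inverse[OF \<Psi>H])
    moreover have "u\<^sup>H * (\<Psi> (mat_powr B' q) * u) = Z\<^sup>H * (C B' * Z)"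
      using C'd Z \<Psi>Bd
      by (simp add: u_def C_def adj_mult mult_assoc_dim mat_powr_inverse[OF \<Psi>B])
    ultimately show ?thesis unfolding inv by simp
  qed
  have "t * Re (mtrace (Z\<^sup>H * (C B1 * Z))) + (1 - t) * Re (mtrace (Z\<^sup>H * (C B2 * Z)))
    \<le> t * Re (mtrace (v\<^sup>H * (\<Psi> (H * (mat_powr B1 (-q) * H)) * v)))
      + (1 - t) * Re (mtrace (v\<^sup>H * (\<Psi> (H * (mat_powr B2 (-q) * H)) * v)))"
    using main[OF B1] main[OF B2] t by (intro add_mono mult_left_mono) auto
  also have "\<dots> \<le> Re (mtrace (v\<^sup>H * (\<Psi> (H * (mat_powr B (-q) * H)) * v)))"
    unfolding B_def using q
    by (intro positive_map_powr_concave[OF lin pos _ _ B1 B2 t posdef_hermitian[OF H]] vd) auto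
  \<comment> \<open>At the mixed point the majorant collapses, since B^q B^(-q) B^q = B^q.\<close>
  also have "H * (mat_powr B (-q) * H) = H"
    using mat_powr_dim[OF B] mat_powr_add[OF B, of "-q" q]
    by (simp add: H_def mat_powr_zero[OF B])
  also have "v\<^sup>H * (\<Psi> H * v) = Z\<^sup>H * (C B * Z)"
    using Cd Z \<Psi>Hd
    by (simp add: v_def C_def H_def[symmetric] adj_mult mult_assoc_dim mat_powr_inverse[OF \<Psi>H])
  finally show ?thesis .
qed

subsection \<open>Completely positive maps\<close>

text \<open>The Kraus operators are read off an eigenbasis of the Choi matrix \<open>(id \<otimes> \<Phi>)(w w\<^sup>H)\<close>, \<open>w = \<Sum>\<^sub>i e\<^sub>i \<otimes> e\<^sub>i\<close>.\<close>

lemma kraus_decomposition: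
  assumes lin: "linear_mat_map n l \<Phi>" and cp: "completely_positive_map n l \<Phi>"
  obtains N :: nat and V where "\<And>k. V k \<in> carrier_mat n l"
    "\<And>P. P \<in> carrier_mat n n \<Longrightarrow>
      \<Phi> P = mat l l (\<lambda>(a, b). \<Sum>k<N. 1 * ((V k)\<^sup>H * (P * V k)) $$ (a, b))"
proof -
  \<comment> \<open>Index \<open>r\<close> encodes the pair (\<open>r div n\<close>,
    \<open>r mod n\<close>), and \<open>w\<close> is 1 on the diagonal pairs. Block (i, j) of
    \<open>w * w\<^sup>H\<close> is therefore the matrix unit \<open>E i j\<close>, and the
    ampliation collects the images of all matrix units.\<close>
  define w :: "complex mat" where "w = mat (n * n) 1 (\<lambda>(r, _). if r div n = r mod n then 1 else 0)"
  define M where "M = w * w\<^sup>H"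
  have wd: "dim_row w = n * n" "dim_col w = 1" by (auto simp: w_def)
  have Md: "M \<in> carrier_mat (n * n) (n * n)" using wd by (auto simp: M_def intro: carrier_matI)
  have "possemidef_mat (n * n) M"
    unfolding possemidef_mat_def
  proof (intro conjI ballI)
    show "hermitian_mat (n * n) M"
      using Md by (auto simp: hermitian_mat_def) (simp add: M_def adj_mult wd)
    fix v :: "complex Matrix.vec" assume v: "v \<in> carrier_vec (n * n)"
    let ?Z = "mat (n * n) 1 (\<lambda>(i, _). v $ i)"
    have "?Z\<^sup>H * (M * ?Z) = (w\<^sup>H * ?Z)\<^sup>H * (w\<^sup>H * ?Z)"
      by (simp add: M_def adj_mult mult_assoc_dim wd)
    thus "0 \<le> Re (conjugate v \<bullet> (M *\<^sub>v v))"
      unfolding mtrace_vec_form[OF v Md, symmetric] using mtrace_gram_nonneg by simp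
  qed
  hence C_psd: "possemidef_mat (n * l) (ampliation n n l \<Phi> M)"
    using cp by (simp add: completely_positive_map_def)
  define C where "C = ampliation n n l \<Phi> M"
  define E where "E i j = (mat n n (\<lambda>(a, b). if a = i \<and> b = j then 1 else 0) :: complex mat)" for i j
  have idx: "i * k + a < n * k" if "i < n" "a < k" for i a k :: nat
    using that mult_le_mono1[of "Suc i" n k] by simp
  have block: "mat_block n M i j = E i j" if "i < n" "j < n" for i j
    using that idx by (intro eq_matI) (auto simp: mat_block_def E_def M_def mult_index wd w_def)
  have C_entry: "C $$ (i * l + a, j * l + b) = \<Phi> (E i j) $$ (a, b)"
    if "i < n" "j < n" "a < l" "b < l" for i j a b
    using that idx block by (simp add: C_def ampliation_def)
  obtain U d where e: "eig (n * l) C U d"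
    using C_psd hermitian_eig unfolding C_def possemidef_mat_def by blast
  have dnn: "d k \<ge> 0" if "k < n * l" for k
    using possemidef_eig_nonneg[OF C_psd[folded C_def] e that] .
  note u = unitaryD[OF eigD(1)[OF e]]
  have C_sum: "C $$ (r, s) = (\<Sum>k<n * l. d k * (U $$ (r, k) * cnj (U $$ (s, k))))"
    if "r < n * l" "s < n * l" for r s
    unfolding eigD(2)[OF e]
    using that u(1,2) by (simp add: mult_index[of r U] diagm_mult_index mult_ac)
  \<comment> \<open>The \<open>k\<close>-th eigenvector of the Choi matrix, cut into
    \<open>n\<close> rows of length \<open>l\<close>. The conjugate makes the unconjugated entries
    appear in the adjoint factor, and the square root is legitimate by \<open>dnn\<close>.\<close>
  define V where "V k = mat n l (\<lambda>(j, b). complex_of_real (sqrt (d k)) * cnj (U $$ (j * l + b, k)))" for k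
  have Vd: "V k \<in> carrier_mat n l" for k by (simp add: V_def)
  have "\<Phi> P = mat l l (\<lambda>(a, b). \<Sum>k<n * l. 1 * ((V k)\<^sup>H * (P * V k)) $$ (a, b))"
    if P: "P \<in> carrier_mat n n" for P
  proof -
    have "P = mat n n (\<lambda>(a, b). \<Sum>x\<in>{..<n} \<times> {..<n}. P $$ x * E (fst x) (snd x) $$ (a, b))"
    proof (rule eq_matI)
      fix a b assume "a < dim_row (mat n n (\<lambda>(a, b). \<Sum>x\<in>{..<n} \<times> {..<n}. P $$ x * E (fst x) (snd x) $$ (a, b)))"
        "b < dim_col (mat n n (\<lambda>(a, b). \<Sum>x\<in>{..<n} \<times> {..<n}. P $$ x * E (fst x) (snd x) $$ (a, b)))"
      hence ab: "a < n" "b < n" by auto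
      have "(\<Sum>x\<in>{..<n} \<times> {..<n}. P $$ x * E (fst x) (snd x) $$ (a, b))
        = (\<Sum>x\<in>{..<n} \<times> {..<n}. if x = (a, b) then P $$ (a, b) else 0)"
        using ab by (intro sum.cong refl) (auto simp: E_def)
      thus "P $$ (a, b) = mat n n (\<lambda>(a, b). \<Sum>x\<in>{..<n} \<times> {..<n}. P $$ x * E (fst x) (snd x) $$ (a, b)) $$ (a, b)"
        using ab by simp
    qed (use P in auto)
    hence "\<Phi> P = \<Phi> (mat n n (\<lambda>(a, b). \<Sum>x\<in>{..<n} \<times> {..<n}. P $$ x * E (fst x) (snd x) $$ (a, b)))"
      by (rule arg_cong)
    also have "\<dots> = mat l l (\<lambda>(a, b). \<Sum>x\<in>{..<n} \<times> {..<n}. P $$ x * \<Phi> (E (fst x) (snd x)) $$ (a, b))"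
      by (rule linear_map_sum[OF lin]) (auto simp: E_def)
    also have "\<dots> = mat l l (\<lambda>(a, b). \<Sum>k<n * l. 1 * ((V k)\<^sup>H * (P * V k)) $$ (a, b))"
    proof (rule eq_matI)
      fix a b assume "a < dim_row (mat l l (\<lambda>(a, b). \<Sum>k<n * l. 1 * ((V k)\<^sup>H * (P * V k)) $$ (a, b)))"
        "b < dim_col (mat l l (\<lambda>(a, b). \<Sum>k<n * l. 1 * ((V k)\<^sup>H * (P * V k)) $$ (a, b)))"
      hence ab: "a < l" "b < l" by auto
      have "((V k)\<^sup>H * (P * V k)) $$ (a, b)
        = (\<Sum>i<n. \<Sum>j<n. P $$ (i, j) * (d k * (U $$ (i * l + a, k) * cnj (U $$ (j * l + b, k)))))"
        if k: "k < n * l" for k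
      proof -
        have "complex_of_real (sqrt (d k)) * complex_of_real (sqrt (d k)) = d k"
          using dnn[OF k] by (simp flip: of_real_mult)
        hence sq: "complex_of_real (sqrt (d k)) * (complex_of_real (sqrt (d k)) * z) = d k * z" for z :: complex
          by (simp flip: mult.assoc)
        show ?thesis
          using ab P Vd[of k]
          by (simp add: mult_index V_def sum_distrib_left sum_distrib_right mult_ac) (simp only: sq)
      qed
      hence "(\<Sum>k<n * l. ((V k)\<^sup>H * (P * V k)) $$ (a, b))
        = (\<Sum>k<n * l. \<Sum>i<n. \<Sum>j<n. P $$ (i, j) * (d k * (U $$ (i * l + a, k) * cnj (U $$ (j * l + b, k)))))"
        by simp
      also have "\<dots> = (\<Sum>i<n. \<Sum>j<n. \<Sum>k<n * l. P $$ (i, j) * (d k * (U $$ (i * l + a, k) * cnj (U $$ (j * l + b, k)))))"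
        by (subst sum.swap) (intro sum.cong refl sum.swap)
      also have "\<dots> = (\<Sum>i<n. \<Sum>j<n. P $$ (i, j) * \<Phi> (E i j) $$ (a, b))"
        using ab idx by (intro sum.cong refl) (simp add: C_entry[symmetric] C_sum sum_distrib_left)
      also have "\<dots> = (\<Sum>x\<in>{..<n} \<times> {..<n}. P $$ x * \<Phi> (E (fst x) (snd x)) $$ (a, b))"
        by (simp add: sum.cartesian_product case_prod_unfold)
      finally show "mat l l (\<lambda>(a, b). \<Sum>x\<in>{..<n} \<times> {..<n}. P $$ x * \<Phi> (E (fst x) (snd x)) $$ (a, b)) $$ (a, b)
        = mat l l (\<lambda>(a, b). \<Sum>k<n * l. 1 * ((V k)\<^sup>H * (P * V k)) $$ (a, b)) $$ (a, b)"
        using ab by simp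
    qed auto
    finally show ?thesis .
  qed
  with Vd show thesis by (rule that)
qed

text \<open>Each Kraus operator contributes one Ando trace with \<open>V k * Z\<close> in place of
  \<open>Z\<close> and the same \<open>X\<close>, so joint convexity holds summand by
  summand.\<close>

lemma completely_positive_ando:
  assumes lin: "linear_mat_map n l \<Phi>" and cp: "completely_positive_map n l \<Phi>"
    and p: "1 < p" "p \<le> 2"
    and A1: "posdef_mat n A1" and A2: "posdef_mat n A2"
    and X1: "posdef_mat l X1" and X2: "posdef_mat l X2"
    and Z: "dim_row Z = l" "dim_col Z = l" and t: "0 \<le> t" "t \<le> 1"
  defines "F \<equiv> \<lambda>A X. Re (mtrace (mat_powr X (1 - p) * (Z\<^sup>H * (\<Phi> (mat_powr A p) * Z))))"
  shows "F (complex_of_real t \<cdot>\<^sub>m A1 + complex_of_real (1 - t) \<cdot>\<^sub>m A2)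
      (complex_of_real t \<cdot>\<^sub>m X1 + complex_of_real (1 - t) \<cdot>\<^sub>m X2)
    \<le> t * F A1 X1 + (1 - t) * F A2 X2"
proof -
  obtain N :: nat and V where V: "\<And>k. V k \<in> carrier_mat n l"
    and kraus: "\<And>P. P \<in> carrier_mat n n \<Longrightarrow>
      \<Phi> P = mat l l (\<lambda>(a, b). \<Sum>k<N. 1 * ((V k)\<^sup>H * (P * V k)) $$ (a, b))"
    by (rule kraus_decomposition[OF lin cp]) (rule that, assumption+)
  define F' where "F' k A X = Re (mtrace (mat_powr X (1 - p) * ((V k * Z)\<^sup>H * (mat_powr A p * (V k * Z)))))"
    for k A X
  have F: "F A X = (\<Sum>k<N. F' k A X)" if A: "posdef_mat n A" and X: "posdef_mat l X" for A X
  proof -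
    note d = mat_powr_dim[OF A, of p] mat_powr_dim[OF X, of "1 - p"]
    have Vd: "dim_row (V k) = n" "dim_col (V k) = l" for k using V[of k] by auto
    \<comment> \<open>Absorbing the power of \<open>X\<close> into the left factor turns the trace
      into a sesquilinear form, to which \<open>mtrace_form_sum\<close> applies.\<close>
    define Y where "Y = Z * mat_powr X (1 - p)"
    have Y: "dim_row Y = l" "dim_col Y = l" using Z d by (auto simp: Y_def)
    have \<Phi>c: "\<Phi> (mat_powr A p) \<in> carrier_mat l l"
      using lin d by (simp add: linear_mat_map_def)
    have YH: "Y\<^sup>H = mat_powr X (1 - p) * Z\<^sup>H" using Z d by (simp add: Y_def adj_mult)
    have "mtrace (mat_powr X (1 - p) * (Z\<^sup>H * (\<Phi> (mat_powr A p) * Z))) = mtrace (Y\<^sup>H * (\<Phi> (mat_powr A p) * Z))"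
      using Z d \<Phi>c by (simp add: YH mult_assoc_dim)
    also have "\<dots> = (\<Sum>k<N. 1 * mtrace (Y\<^sup>H * (((V k)\<^sup>H * (mat_powr A p * V k)) * Z)))"
      unfolding kraus[OF d(4)] using Y Z V Vd d
      by (intro mtrace_form_sum) (auto intro!: carrier_matI)
    also have "\<dots> = (\<Sum>k<N. mtrace (mat_powr X (1 - p) * ((V k * Z)\<^sup>H * (mat_powr A p * (V k * Z)))))"
      using Z d by (simp add: YH mult_assoc_dim adj_mult Vd)
    finally show ?thesis by (simp add: F_def F'_def)
  qed
  have "F' k (complex_of_real t \<cdot>\<^sub>m A1 + complex_of_real (1 - t) \<cdot>\<^sub>m A2)
      (complex_of_real t \<cdot>\<^sub>m X1 + complex_of_real (1 - t) \<cdot>\<^sub>m X2)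
    \<le> t * F' k A1 X1 + (1 - t) * F' k A2 X2" for k
    unfolding F'_def using V[of k] Z by (intro ando_convexity[OF p A1 A2 X1 X2 _ _ t]) auto
  thus ?thesis
    unfolding F[OF A1 X1] F[OF A2 X2] F[OF posdef_convex_comb[OF A1 A2 t] posdef_convex_comb[OF X1 X2 t]]
      sum_distrib_left sum.distrib[symmetric]
    by (intro sum_mono)
qed

subsection \<open>The variational argument\<close>

lemma posdef_congruence:
  assumes K: "posdef_mat n K" and G: "dim_row G = n" "dim_col G = n"
    and inv: "G' * G = 1\<^sub>m n" "dim_col G' = n"
  shows "posdef_mat n (G\<^sup>H * (K * G))"
proof (rule posdefI)
  note Kd = hermitianD[OF posdef_hermitian[OF K]]
  show "hermitian_mat n (G\<^sup>H * (K * G))"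
    using G Kd by (auto simp: hermitian_mat_def adj_mult mult_assoc_dim intro: carrier_matI)
  fix Z :: "complex mat" assume Z: "dim_row Z = n" "dim_col Z = 1" "Z \<noteq> 0\<^sub>m n 1"
  have G'd: "dim_row G' = n" using arg_cong[OF inv(1), of dim_row] by simp
  have "G * Z \<noteq> 0\<^sub>m n 1"
  proof
    assume "G * Z = 0\<^sub>m n 1"
    hence "G' * (G * Z) = 0\<^sub>m n 1" using G'd inv(2) by (intro eq_matI) (auto simp: mult_index)
    moreover have "G' * (G * Z) = Z"
      using inv G Z by (simp add: mult_assoc_dim[symmetric])
    ultimately show False using Z(3) by simp
  qed
  hence "Re (mtrace ((G * Z)\<^sup>H * (K * (G * Z)))) > 0"
    using G Z by (intro posdef_form_pos[OF K]) auto
  thus "Re (mtrace (Z\<^sup>H * (G\<^sup>H * (K * G) * Z))) > 0"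
    using G Z Kd by (simp add: adj_mult mult_assoc_dim)
qed

definition conj_quot :: "complex mat \<Rightarrow> complex mat \<Rightarrow> complex mat" where
  "conj_quot T C = mat_powr T (1/2) * (mat_powr C (-1) * mat_powr T (1/2))"

text \<open>The second equation solves for \<open>C\<close>. With S = T^(1/2) Z it turns the form of
  \<open>C\<close> at \<open>Z\<close> into that of N^(-1) at S, while the form of \<open>T\<close>
  at \<open>Z\<close> becomes \<open>S\<^sup>H * S\<close>; then only N and S remain.\<close>

lemma conj_quot:
  assumes T: "posdef_mat l T" and C: "posdef_mat l C"
  shows "posdef_mat l (conj_quot T C)"
    "C = mat_powr T (1/2) * (mat_powr (conj_quot T C) (-1) * mat_powr T (1/2))"
proof -
  define R where "R = mat_powr T (1/2)"
  define R' where "R' = mat_powr T (-1/2)"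
  note Rd = mat_powr_dim[OF T, of "1/2", folded R_def] and R'd = mat_powr_dim[OF T, of "-1/2", folded R'_def]
  have RR: "R' * R = 1\<^sub>m l" "R * R' = 1\<^sub>m l"
    unfolding R_def R'_def by (simp_all add: mat_powr_add[OF T] mat_powr_zero[OF T])
  have RRl: "R' * (R * Z) = Z" "R * (R' * Z) = Z" if "dim_row Z = l" for Z
    using that RR Rd R'd by (simp_all add: mult_assoc_dim[symmetric])
  note Cd = hermitianD[OF posdef_hermitian[OF C]] and C'd = mat_powr_dim[OF C, of "-1"]
  define N where "N = conj_quot T C"
  have N_eq: "N = R * (mat_powr C (-1) * R)" by (simp add: N_def conj_quot_def R_def)
  have Npd: "posdef_mat l N"
    using posdef_congruence[OF mat_powr_posdef[OF C, of "-1"] Rd(1,2) RR(1) R'd(2)] Rd(3)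
    by (simp add: N_eq)
  note Nd = mat_powr_dim[OF Npd, of "-1"] and Nd' = hermitianD[OF posdef_hermitian[OF Npd]]
  have "N * (R' * (C * R')) = 1\<^sub>m l"
    using Rd R'd Cd C'd by (simp add: N_eq mult_assoc_dim RRl mat_powr_inverse[OF C] RR)
  hence "mat_powr N (-1) * (N * (R' * (C * R'))) = mat_powr N (-1)" using Nd by simp
  hence "mat_powr N (-1) = R' * (C * R')"
    using R'd Cd mat_powr_inverse(4)[OF Npd, of "R' * (C * R')"] by simp
  hence "R * (mat_powr N (-1) * R) = C"
    using Rd R'd Cd by (simp add: mult_assoc_dim RRl RR)
  with Npd show "posdef_mat l (conj_quot T C)"
    "C = mat_powr T (1/2) * (mat_powr (conj_quot T C) (-1) * mat_powr T (1/2))"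
    by (simp_all add: N_def R_def)
qed

lemma mat_powr_half_sq:
  assumes "posdef_mat l T" "dim_row Z = l"
  shows "Z\<^sup>H * (T * Z) = (mat_powr T (1/2) * Z)\<^sup>H * (mat_powr T (1/2) * Z)"
  using assms mat_powr_dim[OF assms(1), of "1/2"]
  by (simp add: adj_mult mult_assoc_dim mat_powr_add_left[OF assms(1)] mat_powr_one[OF assms(1)])

text \<open>This is \<open>powr_neg_ge_tangent\<close> at x/s with exponent p - 1, multiplied by d s
  / (p - 1). Equality holds at x = s, which is what makes the chosen \<open>Z\<close>
  optimal.\<close>

lemma powr_tangent_bound:
  fixes x s p d :: real
  assumes "x > 0" "s > 0" "p > 1" "d \<ge> 0"
  shows "d * s / (p - 1) \<le> x powr (1 - p) * (d * s powr p / (p - 1)) + d * (x - s)"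
proof -
  have "s - (p - 1) * (x - s) = s * (1 - (p - 1) * (x / s - 1))"
    using assms by (simp add: field_simps)
  also have "\<dots> \<le> s * (x / s) powr (- (p - 1))"
    using assms by (intro mult_left_mono powr_neg_ge_tangent) auto
  also have "(x / s) powr (- (p - 1)) = x powr (1 - p) * s powr (p - 1)"
    using assms by (simp add: powr_divide powr_minus field_simps powr_diff)
  also have "s * (x powr (1 - p) * s powr (p - 1)) = x powr (1 - p) * s powr p"
    using assms powr_mult_base[of s "p - 1"] by (simp add: mult.left_commute)
  finally have "s - (p - 1) * (x - s) \<le> x powr (1 - p) * s powr p" .
  hence "(d / (p - 1)) * (s - (p - 1) * (x - s)) \<le> (d / (p - 1)) * (x powr (1 - p) * s powr p)"
    using assms by (intro mult_left_mono) auto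
  moreover have "(d / (p - 1)) * (s - (p - 1) * (x - s)) = d * s / (p - 1) - d * (x - s)"
    using assms by (simp add: field_simps)
  ultimately show ?thesis by (simp add: algebra_simps)
qed

text \<open>For Z = T^(-1/2) s(N) both forms of \<open>Z\<close> become functions of N, namely
  s(\<nu>)^2 and s(\<nu>)^2 / \<nu>. The claim then reduces to a scalar inequality between an
  eigenvalue of \<open>X\<close> and one of N. Positivity of \<open>d\<close> keeps s(N)
  invertible.\<close>

lemma variational_upper:
  assumes T: "posdef_mat l T" and C: "posdef_mat l C" and p: "1 < p"
    and d: "\<And>x. x > 0 \<Longrightarrow> d x > 0"
    and sub: "\<And>x y. x > 0 \<Longrightarrow> y > 0 \<Longrightarrow> f (y powr (p - 1)) \<ge> f (x powr (p - 1)) + d x * (y - x)"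
  obtains Z Z' where "dim_row Z = l" "dim_col Z = l" "dim_col Z' = l" "Z' * Z = 1\<^sub>m l"
    "\<And>X. posdef_mat l X \<Longrightarrow> Re (mtrace (mat_fun f (conj_quot T C)))
      \<le> Re (mtrace (mat_powr X (1 - p) * (Z\<^sup>H * (T * Z))))
        + Re (mtrace (mat_fun (\<lambda>x. f (x powr (p - 1))) X)) - Re (mtrace (Z\<^sup>H * (C * Z)))"
proof -
  define N where "N = conj_quot T C"
  note Npd = conj_quot(1)[OF T C, folded N_def] and C_eq = conj_quot(2)[OF T C, folded N_def]
  note Nh = posdef_hermitian[OF Npd]
  define sg where "sg \<nu> = \<nu> powr (1 / (p - 1))" for \<nu> :: real
  have sg: "sg \<nu> > 0" "sg \<nu> powr (p - 1) = \<nu>" if "\<nu> > 0" for \<nu>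
    using that p by (auto simp: sg_def powr_powr)
  \<comment> \<open>Stationarity: this value of s^2 makes the derivative of x^(1-p) s^2 + g x vanish
    at x = \<open>sg \<nu>\<close>, with \<open>d\<close> in the role of the derivative of
    g.\<close>
  define s where "s \<nu> = sqrt (d (sg \<nu>) * sg \<nu> powr p / (p - 1))" for \<nu>
  have s_pos: "s \<nu> > 0" and s_sq: "s \<nu> * s \<nu> = d (sg \<nu>) * sg \<nu> powr p / (p - 1)" if "\<nu> > 0" for \<nu>
    using d[OF sg(1)[OF that]] sg(1)[OF that] p by (auto simp: s_def)
  define S where "S = mat_fun s N"
  define S' where "S' = mat_fun (\<lambda>\<nu>. 1 / s \<nu>) N"
  note Sd = hermitianD[OF mat_fun_hermitian[OF Nh, of s], folded S_def]
    and S'd = hermitianD[OF mat_fun_hermitian[OF Nh, of "\<lambda>\<nu>. 1 / s \<nu>"], folded S'_def]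
  have S'S: "S' * S = 1\<^sub>m l"
    unfolding S_def S'_def mat_fun_mult[OF Nh]
    using mat_fun_cong_pos[OF Npd, of "\<lambda>x. 1 / s x * s x" "\<lambda>_. 1"] s_pos mat_fun_one[OF Nh]
    by (simp add: less_imp_neq[THEN not_sym])
  define R where "R = mat_powr T (1/2)"
  define R' where "R' = mat_powr T (-1/2)"
  note Rd = mat_powr_dim[OF T, of "1/2", folded R_def] and R'd = mat_powr_dim[OF T, of "-1/2", folded R'_def]
  have RR: "R * R' = 1\<^sub>m l"
    unfolding R_def R'_def by (simp_all add: mat_powr_add[OF T] mat_powr_zero[OF T])
  have RRl: "R * (R' * Z) = Z" if "dim_row Z = l" for Z
    using that RR Rd R'd by (simp add: mult_assoc_dim[symmetric])
  define Z where "Z = R' * S"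
  have Zd: "dim_row Z = l" "dim_col Z = l" using R'd Sd by (auto simp: Z_def)
  have RZ: "R * Z = S" using Sd by (simp add: Z_def RRl)
  have inv: "(S' * R) * Z = 1\<^sub>m l" using S'd Rd Zd by (simp add: mult_assoc_dim RZ S'S)
  have TZ: "Z\<^sup>H * (T * Z) = mat_fun (\<lambda>\<nu>. s \<nu> * s \<nu>) N"
    using mat_powr_half_sq[OF T Zd(1)] Sd unfolding R_def[symmetric] RZ
    by (simp add: S_def mat_fun_mult[OF Nh])
  have "Z\<^sup>H * (C * Z) = (R * Z)\<^sup>H * (mat_powr N (-1) * (R * Z))"
    using Zd Rd mat_powr_dim[OF Npd, of "-1"] by (subst C_eq) (simp add: adj_mult mult_assoc_dim R_def[symmetric])
  also have "\<dots> = mat_fun (\<lambda>\<nu>. s \<nu> * (\<nu> powr (-1) * s \<nu>)) N"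
    unfolding RZ Sd(3) by (simp add: S_def mat_powr_def mat_fun_mult[OF Nh])
  finally have CZ: "Z\<^sup>H * (C * Z) = mat_fun (\<lambda>\<nu>. s \<nu> * (\<nu> powr (-1) * s \<nu>)) N" .
  have main: "Re (mtrace (mat_fun f N)) \<le> Re (mtrace (mat_powr X (1 - p) * (Z\<^sup>H * (T * Z))))
        + Re (mtrace (mat_fun (\<lambda>x. f (x powr (p - 1))) X)) - Re (mtrace (Z\<^sup>H * (C * Z)))"
    if X: "posdef_mat l X" for X
  proof -
    note Xh = posdef_hermitian[OF X]
    obtain V x where eX: "eig l X V x" "\<And>i. i < l \<Longrightarrow> x i > 0" using posdef_eig[OF X] by blast
    obtain U \<nu> where eN: "eig l N U \<nu>" "\<And>i. i < l \<Longrightarrow> \<nu> i > 0" using posdef_eig[OF Npd] by blast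
    define w where "w i j = (cmod ((U\<^sup>H * (1\<^sub>m l * V)) $$ (j, i)))\<^sup>2" for i j
    have pair: "Re (mtrace (mat_fun \<alpha> X * mat_fun \<beta> N)) = (\<Sum>i<l. \<Sum>j<l. \<alpha> (x i) * \<beta> (\<nu> j) * w i j)" for \<alpha> \<beta>
      using Re_mtrace_eig_pair[OF eX(1) eN(1), of "1\<^sub>m l" \<alpha> \<beta>]
        hermitianD[OF mat_fun_hermitian[OF Nh, of \<beta>]] by (simp add: w_def)
    \<comment> \<open>Pairing with the constant function 1 writes the trace of a function of one
      matrix with the same weights \<open>w\<close>, so all terms can be compared entry by
      entry.\<close>
    have pairN: "Re (mtrace (mat_fun \<beta> N)) = (\<Sum>i<l. \<Sum>j<l. \<beta> (\<nu> j) * w i j)" for \<beta>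
      using pair[of "\<lambda>_. 1" \<beta>] hermitianD[OF mat_fun_hermitian[OF Nh, of \<beta>]]
      by (simp add: mat_fun_one[OF Xh])
    have pairX: "Re (mtrace (mat_fun \<alpha> X)) = (\<Sum>i<l. \<Sum>j<l. \<alpha> (x i) * w i j)" for \<alpha>
      using pair[of \<alpha> "\<lambda>_. 1"] hermitianD[OF mat_fun_hermitian[OF Xh, of \<alpha>]]
      by (simp add: mat_fun_one[OF Nh])
    have "(\<Sum>i<l. \<Sum>j<l. f (\<nu> j) * w i j)
      \<le> (\<Sum>i<l. \<Sum>j<l. x i powr (1 - p) * (s (\<nu> j) * s (\<nu> j)) * w i j + f (x i powr (p - 1)) * w i j
        - s (\<nu> j) * (\<nu> j powr (-1) * s (\<nu> j)) * w i j)"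
    proof (intro sum_mono)
      fix i j assume "i \<in> {..<l}" "j \<in> {..<l}"
      hence pos: "x i > 0" "\<nu> j > 0" using eX eN by auto
      note sgj = sg[OF pos(2)]
      define D where "D = d (sg (\<nu> j))"
      have D: "D > 0" using d[OF sgj(1)] by (simp add: D_def)
      have "s (\<nu> j) * (\<nu> j powr (-1) * s (\<nu> j)) = (s (\<nu> j) * s (\<nu> j)) / \<nu> j"
        using pos by (simp add: powr_neg_one)
      also have "\<dots> = D * (sg (\<nu> j) powr p / sg (\<nu> j) powr (p - 1)) / (p - 1)"
        unfolding s_sq[OF pos(2)] sgj(2) D_def by simp
      also have "sg (\<nu> j) powr p / sg (\<nu> j) powr (p - 1) = sg (\<nu> j)"
        using sgj(1) by (simp add: powr_diff[symmetric])
      finally have 1: "s (\<nu> j) * (\<nu> j powr (-1) * s (\<nu> j)) = D * sg (\<nu> j) / (p - 1)" .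
      have 2: "f (\<nu> j) + D * (x i - sg (\<nu> j)) \<le> f (x i powr (p - 1))"
        using sub[OF sgj(1) pos(1)] unfolding sgj(2) D_def .
      have 3: "D * sg (\<nu> j) / (p - 1) \<le> x i powr (1 - p) * (s (\<nu> j) * s (\<nu> j)) + D * (x i - sg (\<nu> j))"
        unfolding s_sq[OF pos(2)] D_def[symmetric]
        using powr_tangent_bound[OF pos(1) sgj(1) p, of D] D by simp
      \<comment> \<open>The subgradient inequality and the tangent bound both carry the term
        \<open>D * (x i - sg (\<nu> j))\<close>, which is eliminated between them.\<close>
      have "f (\<nu> j) \<le> x i powr (1 - p) * (s (\<nu> j) * s (\<nu> j)) + f (x i powr (p - 1))
        - s (\<nu> j) * (\<nu> j powr (-1) * s (\<nu> j))"
        unfolding 1 using 2 3 by linarith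
      from mult_right_mono[OF this, of "w i j"]
      show "f (\<nu> j) * w i j \<le> x i powr (1 - p) * (s (\<nu> j) * s (\<nu> j)) * w i j + f (x i powr (p - 1)) * w i j
        - s (\<nu> j) * (\<nu> j powr (-1) * s (\<nu> j)) * w i j"
        by (simp add: w_def algebra_simps)
    qed
    thus ?thesis
      unfolding TZ CZ mat_powr_def pair pairN pairX by (simp add: sum.distrib sum_subtractf)
  qed
  show thesis
    by (rule that[OF Zd _ inv main[unfolded N_def]]) (simp_all add: Rd)
qed

text \<open>\<open>U\<close> is the unitary factor of \<open>S\<^sup>H\<close>, namely
  \<open>S\<^sup>H\<close> times (S S^H)^(-1/2). It exchanges \<open>S\<^sup>H * S\<close>, which
  stands beside X, for \<open>S * S\<^sup>H\<close>, which stands beside N.\<close>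

lemma polar_unitary:
  assumes S: "dim_row S = n" "dim_col S = n" and inv: "S' * S\<^sup>H = 1\<^sub>m n" "dim_col S' = n"
  obtains U where "unitary_mat n U" "U\<^sup>H * (S\<^sup>H * (S * U)) = S * S\<^sup>H"
proof -
  define P where "P = S * S\<^sup>H"
  have P: "posdef_mat n P"
    using posdef_congruence[OF posdef_one, of "S\<^sup>H" n S'] S inv by (simp add: P_def)
  define Q where "Q = mat_powr P (-1/2)"
  note Qd = mat_powr_dim[OF P, of "-1/2", folded Q_def]
  have PQ: "P * mat_powr P a = mat_powr P (1 + a)" for a
    using mat_powr_add[OF P, of 1 a] by (simp add: mat_powr_one[OF P])
  define U where "U = S\<^sup>H * Q"
  have Ud: "dim_row U = n" "dim_col U = n" using S Qd by (auto simp: U_def)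
  have "U\<^sup>H * U = Q * (P * Q)" using S Qd by (simp add: U_def P_def adj_mult mult_assoc_dim)
  also have "\<dots> = 1\<^sub>m n"
    unfolding Q_def by (simp add: PQ mat_powr_add[OF P] mat_powr_zero[OF P])
  finally have u: "unitary_mat n U" using Ud by (intro unitary_leftI) auto
  have "U\<^sup>H * (S\<^sup>H * (S * U)) = Q * (P * (P * Q))"
    using S Qd by (simp add: U_def P_def adj_mult mult_assoc_dim)
  also have "\<dots> = P"
    unfolding Q_def by (simp add: PQ mat_powr_add[OF P] mat_powr_one[OF P])
  finally show thesis using that[OF u] by (simp add: P_def)
qed

text \<open>For X = U N^(1/(p-1)) U^H one has X^(1-p) = U N^(-1) U^H. By the polar identity for S =
  T^(1/2) Z the first trace becomes that of N^(-1) S S^H, which equals the trace of the form of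
  \<open>C\<close>, so these two cancel. The exponent 1/(p-1) turns the remaining trace into that of
  f(N).\<close>

lemma variational_lower:
  assumes T: "posdef_mat l T" and C: "posdef_mat l C" and p: "1 < p"
    and Z: "dim_row Z = l" "dim_col Z = l" and inv: "Z' * Z = 1\<^sub>m l" "dim_col Z' = l"
  obtains X where "posdef_mat l X"
    "Re (mtrace (mat_powr X (1 - p) * (Z\<^sup>H * (T * Z))))
      + Re (mtrace (mat_fun (\<lambda>x. f (x powr (p - 1))) X)) - Re (mtrace (Z\<^sup>H * (C * Z)))
      = Re (mtrace (mat_fun f (conj_quot T C)))"
proof -
  define N where "N = conj_quot T C"
  note Npd = conj_quot(1)[OF T C, folded N_def] and C_eq = conj_quot(2)[OF T C, folded N_def]
  note Nh = posdef_hermitian[OF Npd]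
  define R where "R = mat_powr T (1/2)"
  define R' where "R' = mat_powr T (-1/2)"
  note Rd = mat_powr_dim[OF T, of "1/2", folded R_def] and R'd = mat_powr_dim[OF T, of "-1/2", folded R'_def]
  have RR: "R * R' = 1\<^sub>m l"
    unfolding R_def R'_def by (simp_all add: mat_powr_add[OF T] mat_powr_zero[OF T])
  have RRl: "R * (R' * Z) = Z" if "dim_row Z = l" for Z
    using that RR Rd R'd by (simp add: mult_assoc_dim[symmetric])
  define S where "S = R * Z"
  have Sd: "dim_row S = l" "dim_col S = l" using Rd Z by (auto simp: S_def)
  have Z'd: "dim_row Z' = l" using arg_cong[OF inv(1), of dim_row] by simp
  have "Z * Z' = 1\<^sub>m l"
    using Z Z'd inv by (intro mat_mult_left_right_inverse[of Z' l Z]) (auto intro: carrier_matI)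
  hence ZZ: "Z * (Z' * Y) = Y" if "dim_row Y = l" for Y
    using that Z Z'd inv(2) by (simp add: mult_assoc_dim[symmetric])
  have "S * (Z' * R') = 1\<^sub>m l"
    using Rd R'd Z Z'd inv(2) by (simp add: S_def mult_assoc_dim ZZ RR)
  hence "(S * (Z' * R'))\<^sup>H = 1\<^sub>m l" by simp
  hence S_inv: "(Z' * R')\<^sup>H * S\<^sup>H = 1\<^sub>m l" "dim_col ((Z' * R')\<^sup>H) = l"
    using Sd Z'd R'd by (auto simp: adj_mult)
  obtain U where U: "unitary_mat l U" and polar: "U\<^sup>H * (S\<^sup>H * (S * U)) = S * S\<^sup>H"
    using polar_unitary[OF Sd S_inv] by blast
  note u = unitaryD[OF U]
  define N1 where "N1 = mat_powr N (1 / (p - 1))"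
  have N1: "posdef_mat l N1" unfolding N1_def by (rule mat_powr_posdef[OF Npd])
  define X where "X = U * (N1 * U\<^sup>H)"
  have X: "posdef_mat l X"
    using posdef_congruence[OF N1, of "U\<^sup>H" U] u by (simp add: X_def)
  have fX: "mat_fun g X = U * (mat_fun g N1 * U\<^sup>H)" for g
    unfolding X_def by (rule mat_fun_unitary_conj[OF posdef_hermitian[OF N1] U])
  have Xp: "mat_powr X (1 - p) = U * (mat_powr N (-1) * U\<^sup>H)"
  proof -
    have "1 / (p - 1) * (1 - p) = -1" using p by (simp add: field_simps)
    thus ?thesis unfolding mat_powr_def[of X] fX
      by (simp add: mat_powr_def[symmetric] N1_def mat_powr_powr[OF Npd])
  qed
  note N'd = mat_powr_dim[OF Npd, of "-1"]
  have gN1: "mat_fun (\<lambda>x. f (x powr (p - 1))) N1 = mat_fun f N"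
    unfolding N1_def mat_powr_def mat_fun_comp[OF Nh]
    using p by (intro mat_fun_cong_pos[OF Npd]) (simp add: powr_powr)
  note fNd = hermitianD[OF mat_fun_hermitian[OF Nh, of f]]
  have 1: "mtrace (mat_fun (\<lambda>x. f (x powr (p - 1))) X) = mtrace (mat_fun f N)"
    unfolding fX gN1 using u fNd by (subst mtrace_mult_comm) (simp_all add: mult_assoc_dim)
  have "mtrace (mat_powr X (1 - p) * (Z\<^sup>H * (T * Z))) = mtrace (U * (mat_powr N (-1) * (U\<^sup>H * (S\<^sup>H * S))))"
    unfolding Xp mat_powr_half_sq[OF T Z(1)] R_def[symmetric] S_def[symmetric]
    using u N'd Sd by (simp add: mult_assoc_dim)
  also have "\<dots> = mtrace ((mat_powr N (-1) * (U\<^sup>H * (S\<^sup>H * S))) * U)"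
    using u N'd Sd by (intro mtrace_mult_comm) auto
  also have "\<dots> = mtrace (mat_powr N (-1) * (S * S\<^sup>H))"
    unfolding polar[symmetric] using u N'd Sd by (simp add: mult_assoc_dim)
  also have "\<dots> = mtrace (S\<^sup>H * (mat_powr N (-1) * S))"
    using N'd Sd by (subst mtrace_mult_comm[of "S\<^sup>H"]) (simp_all add: mult_assoc_dim)
  also have "S\<^sup>H * (mat_powr N (-1) * S) = Z\<^sup>H * (C * Z)"
    using Z Rd N'd by (subst C_eq) (simp add: S_def adj_mult mult_assoc_dim R_def[symmetric])
  finally have 2: "mtrace (mat_powr X (1 - p) * (Z\<^sup>H * (T * Z))) = mtrace (Z\<^sup>H * (C * Z))" .
  show thesis by (rule that[OF X]) (simp add: 1 2 N_def)
qed

text \<open>Klein's inequality gives a supporting functional at \<open>X\<close>: Tr g(Y) \<ge> Tr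
  g(X) + Tr d(X)(Y - X). Averaging over Y = \<open>X1\<close> and Y = \<open>X2\<close> cancels the
  linear terms, because \<open>X\<close> is their mixture.\<close>

lemma mtrace_fun_convex:
  assumes X1: "posdef_mat l X1" and X2: "posdef_mat l X2" and t: "0 \<le> t" "t \<le> 1"
    and sub: "\<And>x y. x > 0 \<Longrightarrow> y > 0 \<Longrightarrow> g y \<ge> g x + d x * (y - x)"
  defines "X \<equiv> complex_of_real t \<cdot>\<^sub>m X1 + complex_of_real (1 - t) \<cdot>\<^sub>m X2"
  shows "Re (mtrace (mat_fun g X)) \<le> t * Re (mtrace (mat_fun g X1)) + (1 - t) * Re (mtrace (mat_fun g X2))"
proof -
  have X: "posdef_mat l X" unfolding X_def by (rule posdef_convex_comb[OF X1 X2 t])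
  note Xh = posdef_hermitian[OF X]
  obtain U x where e: "eig l X U x" "\<And>i. i < l \<Longrightarrow> x i > 0" using posdef_eig[OF X] by blast
  note dd = hermitianD[OF mat_fun_hermitian[OF Xh, of d]]
  have klein: "Re (mtrace (mat_fun g X)) + Re (mtrace (mat_fun d X * Y))
      - Re (mtrace (mat_fun d X * X)) \<le> Re (mtrace (mat_fun g Y))" if Y: "posdef_mat l Y" for Y
  proof -
    note Yh = posdef_hermitian[OF Y]
    obtain V y where eY: "eig l Y V y" "\<And>i. i < l \<Longrightarrow> y i > 0" using posdef_eig[OF Y] by blast
    define w where "w i j = (cmod ((V\<^sup>H * (1\<^sub>m l * U)) $$ (j, i)))\<^sup>2" for i j
    have pair: "Re (mtrace (mat_fun \<alpha> X * mat_fun \<beta> Y)) = (\<Sum>i<l. \<Sum>j<l. \<alpha> (x i) * \<beta> (y j) * w i j)" for \<alpha> \<beta>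
      using Re_mtrace_eig_pair[OF e(1) eY(1), of "1\<^sub>m l" \<alpha> \<beta>]
        hermitianD[OF mat_fun_hermitian[OF Yh, of \<beta>]] by (simp add: w_def)
    have pairX: "Re (mtrace (mat_fun \<alpha> X)) = (\<Sum>i<l. \<Sum>j<l. \<alpha> (x i) * w i j)" for \<alpha>
      using pair[of \<alpha> "\<lambda>_. 1"] hermitianD[OF mat_fun_hermitian[OF Xh, of \<alpha>]]
      by (simp add: mat_fun_one[OF Yh])
    have pairY: "Re (mtrace (mat_fun \<beta> Y)) = (\<Sum>i<l. \<Sum>j<l. \<beta> (y j) * w i j)" for \<beta>
      using pair[of "\<lambda>_. 1" \<beta>] hermitianD[OF mat_fun_hermitian[OF Yh, of \<beta>]]
      by (simp add: mat_fun_one[OF Xh])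
    have dX: "mat_fun d X * X = mat_fun (\<lambda>x. d x * x) X"
      using mat_fun_mult[OF Xh, of d "\<lambda>x. x"] by (simp add: mat_fun_id[OF Xh])
    have dY: "Re (mtrace (mat_fun d X * Y)) = (\<Sum>i<l. \<Sum>j<l. d (x i) * y j * w i j)"
      using pair[of d "\<lambda>x. x"] by (simp add: mat_fun_id[OF Yh])
    have "(\<Sum>i<l. \<Sum>j<l. g (x i) * w i j + d (x i) * y j * w i j - d (x i) * x i * w i j)
      \<le> (\<Sum>i<l. \<Sum>j<l. g (y j) * w i j)"
    proof (intro sum_mono)
      fix i j assume "i \<in> {..<l}" "j \<in> {..<l}"
      hence "g (x i) + d (x i) * (y j - x i) \<le> g (y j)" using e eY by (intro sub) auto
      from mult_right_mono[OF this, of "w i j"]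
      show "g (x i) * w i j + d (x i) * y j * w i j - d (x i) * x i * w i j \<le> g (y j) * w i j"
        by (simp add: w_def algebra_simps)
    qed
    thus ?thesis unfolding dX dY pairX pairY by (simp add: sum.distrib sum_subtractf)
  qed
  have "Re (mtrace (mat_fun d X * X)) = t * Re (mtrace (mat_fun d X * X1)) + (1 - t) * Re (mtrace (mat_fun d X * X2))"
    using dd hermitianD[OF posdef_hermitian[OF X1]] hermitianD[OF posdef_hermitian[OF X2]]
    by (subst (2) X_def) (simp add: mult_add_dim mult_smult_dim mtrace_add mtrace_smult)
  moreover have "t * (Re (mtrace (mat_fun g X)) + Re (mtrace (mat_fun d X * X1)) - Re (mtrace (mat_fun d X * X)))
    \<le> t * Re (mtrace (mat_fun g X1))" using t by (intro mult_left_mono klein[OF X1])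
  moreover have "(1 - t) * (Re (mtrace (mat_fun g X)) + Re (mtrace (mat_fun d X * X2)) - Re (mtrace (mat_fun d X * X)))
    \<le> (1 - t) * Re (mtrace (mat_fun g X2))" using t by (intro mult_left_mono klein[OF X2]) auto
  ultimately show ?thesis by (simp add: algebra_simps)
qed

text \<open>Strictly positive subgradients make the optimal \<open>Z\<close> invertible; the general case follows by perturbing \<open>g\<close> to \<open>g x + e x\<close>.\<close>

lemma conj_quot_convex_strict:
  assumes p: "1 < p" and t: "0 \<le> t" "t \<le> 1"
    and d: "\<And>x. x > 0 \<Longrightarrow> d x > 0"
    and sub: "\<And>x y. x > 0 \<Longrightarrow> y > 0 \<Longrightarrow> f (y powr (p - 1)) \<ge> f (x powr (p - 1)) + d x * (y - x)"
    and T: "posdef_mat l T" "posdef_mat l T1" "posdef_mat l T2"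
    and C: "posdef_mat l C" "posdef_mat l C1" "posdef_mat l C2"
    and ando: "\<And>Z X1 X2. dim_row Z = l \<Longrightarrow> dim_col Z = l \<Longrightarrow> posdef_mat l X1 \<Longrightarrow> posdef_mat l X2 \<Longrightarrow>
      Re (mtrace (mat_powr (complex_of_real t \<cdot>\<^sub>m X1 + complex_of_real (1 - t) \<cdot>\<^sub>m X2) (1 - p) * (Z\<^sup>H * (T * Z))))
      \<le> t * Re (mtrace (mat_powr X1 (1 - p) * (Z\<^sup>H * (T1 * Z))))
        + (1 - t) * Re (mtrace (mat_powr X2 (1 - p) * (Z\<^sup>H * (T2 * Z))))"
    and conc: "\<And>Z. dim_row Z = l \<Longrightarrow> t * Re (mtrace (Z\<^sup>H * (C1 * Z))) + (1 - t) * Re (mtrace (Z\<^sup>H * (C2 * Z)))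
      \<le> Re (mtrace (Z\<^sup>H * (C * Z)))"
  shows "Re (mtrace (mat_fun f (conj_quot T C)))
    \<le> t * Re (mtrace (mat_fun f (conj_quot T1 C1))) + (1 - t) * Re (mtrace (mat_fun f (conj_quot T2 C2)))"
proof -
  let ?g = "\<lambda>x. f (x powr (p - 1))"
  obtain Z Z' where Z: "dim_row Z = l" "dim_col Z = l" and inv: "Z' * Z = 1\<^sub>m l" "dim_col Z' = l"
    and up: "\<And>X. posdef_mat l X \<Longrightarrow> Re (mtrace (mat_fun f (conj_quot T C)))
      \<le> Re (mtrace (mat_powr X (1 - p) * (Z\<^sup>H * (T * Z))))
        + Re (mtrace (mat_fun ?g X)) - Re (mtrace (Z\<^sup>H * (C * Z)))"
    by (rule variational_upper[where d = d and f = f, OF T(1) C(1) p d sub]) (assumption | rule that)+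
  \<comment> \<open>The same \<open>Z\<close> is kept at both end points; only \<open>X\<close> is
    adapted to \<open>T1\<close>, \<open>C1\<close> and to \<open>T2\<close>,
    \<open>C2\<close>.\<close>
  obtain X1 where X1: "posdef_mat l X1" and l1: "Re (mtrace (mat_powr X1 (1 - p) * (Z\<^sup>H * (T1 * Z))))
      + Re (mtrace (mat_fun ?g X1)) - Re (mtrace (Z\<^sup>H * (C1 * Z)))
      = Re (mtrace (mat_fun f (conj_quot T1 C1)))"
    by (rule variational_lower[OF T(2) C(2) p Z inv, of f])
  obtain X2 where X2: "posdef_mat l X2" and l2: "Re (mtrace (mat_powr X2 (1 - p) * (Z\<^sup>H * (T2 * Z))))
      + Re (mtrace (mat_fun ?g X2)) - Re (mtrace (Z\<^sup>H * (C2 * Z)))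
      = Re (mtrace (mat_fun f (conj_quot T2 C2)))"
    by (rule variational_lower[OF T(3) C(3) p Z inv, of f])
  have comb: "u \<le> t * (a1 + g1 - c1) + (1 - t) * (a2 + g2 - c2)"
    if "u \<le> a + g - c" "a \<le> t * a1 + (1 - t) * a2" "g \<le> t * g1 + (1 - t) * g2"
      "t * c1 + (1 - t) * c2 \<le> c" for u a g c a1 a2 g1 g2 c1 c2 :: real
    using that by (simp add: algebra_simps)
  show ?thesis
    unfolding l1[symmetric] l2[symmetric]
    by (rule comb[OF up[OF posdef_convex_comb[OF X1 X2 t]] ando[OF Z X1 X2]
          mtrace_fun_convex[of l X1 X2 t ?g d, OF X1 X2 t sub] conc[OF Z(1)]])
qed

lemma conj_quot_convex:
  assumes p: "1 < p" and t: "0 \<le> t" "t \<le> 1"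
    and f_mono: "mono_on {0<..} f" and f_conv: "convex_on {0<..} (\<lambda>x. f (x powr (p - 1)))"
    and T: "posdef_mat l T" "posdef_mat l T1" "posdef_mat l T2"
    and C: "posdef_mat l C" "posdef_mat l C1" "posdef_mat l C2"
    and ando: "\<And>Z X1 X2. dim_row Z = l \<Longrightarrow> dim_col Z = l \<Longrightarrow> posdef_mat l X1 \<Longrightarrow> posdef_mat l X2 \<Longrightarrow>
      Re (mtrace (mat_powr (complex_of_real t \<cdot>\<^sub>m X1 + complex_of_real (1 - t) \<cdot>\<^sub>m X2) (1 - p) * (Z\<^sup>H * (T * Z))))
      \<le> t * Re (mtrace (mat_powr X1 (1 - p) * (Z\<^sup>H * (T1 * Z))))
        + (1 - t) * Re (mtrace (mat_powr X2 (1 - p) * (Z\<^sup>H * (T2 * Z))))"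
    and conc: "\<And>Z. dim_row Z = l \<Longrightarrow> t * Re (mtrace (Z\<^sup>H * (C1 * Z))) + (1 - t) * Re (mtrace (Z\<^sup>H * (C2 * Z)))
      \<le> Re (mtrace (Z\<^sup>H * (C * Z)))"
  shows "Re (mtrace (mat_fun f (conj_quot T C)))
    \<le> t * Re (mtrace (mat_fun f (conj_quot T1 C1))) + (1 - t) * Re (mtrace (mat_fun f (conj_quot T2 C2)))"
proof -
  let ?g = "\<lambda>x. f (x powr (p - 1))"
  have "mono_on {0<..} ?g"
  proof (rule mono_onI)
    fix r s :: real assume "r \<in> {0<..}" "s \<in> {0<..}" "r \<le> s"
    thus "?g r \<le> ?g s" using p by (intro mono_onD[OF f_mono]) (auto intro!: powr_mono2)
  qed
  from convex_subgradient_exists[OF f_conv this] obtain d where d: "\<And>x. x > 0 \<Longrightarrow> d x \<ge> 0"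
    and sub: "\<And>x y. x > 0 \<Longrightarrow> y > 0 \<Longrightarrow> ?g y \<ge> ?g x + d x * (y - x)"
    by auto
  \<comment> \<open>Chosen so that \<open>k (x powr (p - 1)) = x\<close>: adding
    \<open>e * k\<close> to \<open>f\<close> adds the line \<open>e * x\<close> to \<open>?g\<close>
    and raises every subgradient by \<open>e\<close>.\<close>
  define k where "k x = x powr (1 / (p - 1))" for x :: real
  define F where "F f T C = Re (mtrace (mat_fun f (conj_quot T C)))" for f T C
  \<comment> \<open>The trace is linear in the scalar function, so the perturbed inequality is
    affine in \<open>e\<close> and survives the limit.\<close>
  have lin: "F (\<lambda>x. f x + e * k x) T C = F f T C + e * F k T C"
    if TC: "posdef_mat l T" "posdef_mat l C" for e T C
  proof -
    obtain U a where "eig l (conj_quot T C) U a"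
      using hermitian_eig[OF posdef_hermitian[OF conj_quot(1)[OF TC]]] by blast
    thus ?thesis
      unfolding F_def using eig_mtrace[OF eig_mat_fun] by (simp add: sum.distrib sum_distrib_left)
  qed
  have "F (\<lambda>x. f x + e * k x) T C
    \<le> t * F (\<lambda>x. f x + e * k x) T1 C1 + (1 - t) * F (\<lambda>x. f x + e * k x) T2 C2" if e: "e > 0" for e
    unfolding F_def
  proof (rule conj_quot_convex_strict[OF p t _ _ T C ando conc, where d = "\<lambda>x. d x + e"])
    show "d x + e > 0" if "x > 0" for x using d[OF that] e by simp
    have k: "k (x powr (p - 1)) = x" if "x > 0" for x using that p by (simp add: k_def powr_powr)
    show "f (x powr (p - 1)) + e * k (x powr (p - 1)) + (d x + e) * (y - x)
      \<le> f (y powr (p - 1)) + e * k (y powr (p - 1))" if "x > 0" "y > 0" for x y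
      using sub[OF that] by (simp add: k that algebra_simps)
  qed
  hence "0 \<le> (t * F f T1 C1 + (1 - t) * F f T2 C2 - F f T C)
      + e * (t * F k T1 C1 + (1 - t) * F k T2 C2 - F k T C)" if "e > 0" for e
    using that by (simp add: lin T C algebra_simps)
  from nonneg_if_nonneg_perturbed[OF this] show ?thesis by (simp add: F_def)
qed

subsection \<open>Joint convexity\<close>

lemma mat_inv_eqI:
  assumes "A \<in> carrier_mat n n" "B \<in> carrier_mat n n" "A * B = 1\<^sub>m n"
  shows "mat_inv A = B"
  unfolding mat_inv_def
proof (rule the_equality)
  have BA: "B * A = 1\<^sub>m n" using mat_mult_left_right_inverse[OF assms] .
  show "B \<in> carrier_mat (dim_row A) (dim_row A) \<and> A * B = 1\<^sub>m (dim_row A) \<and> B * A = 1\<^sub>m (dim_row A)"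
    using assms BA by auto
  fix B' assume "B' \<in> carrier_mat (dim_row A) (dim_row A) \<and> A * B' = 1\<^sub>m (dim_row A) \<and> B' * A = 1\<^sub>m (dim_row A)"
  hence B': "B' \<in> carrier_mat n n" "A * B' = 1\<^sub>m n" using assms by auto
  have "B' = B * A * B'" using BA B' by simp
  also have "\<dots> = B * (A * B')" using B' assms by (intro mult_assoc_dim) auto
  finally show "B' = B" using B' assms by simp
qed

theorem theorem5p4:
  fixes n m l :: nat
    and \<Phi> \<Psi> :: "complex mat \<Rightarrow> complex mat"
    and f :: "real \<Rightarrow> real"
    and p q :: real
  assumes lin_Phi: "linear_mat_map n l \<Phi>"
    and lin_Psi: "linear_mat_map m l \<Psi>"
    and pos_Phi: "strictly_positive_map n l \<Phi>"
    and pos_Psi: "strictly_positive_map m l \<Psi>"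
    and f_mono: "mono_on {0<..} f"
    and p: "1 < p" "p \<le> 2"
    and f_conv: "convex_on {0<..} (\<lambda>x. f (x powr (p - 1)))"
    and q: "-1 \<le> q" "q \<le> 0"
  shows "(completely_positive_map n l \<Phi> \<longrightarrow>
           jointly_convex_on_posdef n m (\<lambda>A B.
             Re (mtrace (mat_fun f
               (mat_powr (\<Phi> (mat_powr A p)) (1/2) * \<Psi> (mat_powr B q)
                * mat_powr (\<Phi> (mat_powr A p)) (1/2))))))
       \<and> ((n = l \<and> (\<forall>X \<in> carrier_mat n n. \<Phi> X = X)) \<longrightarrow>
           jointly_convex_on_posdef n m (\<lambda>A B.
             Re (mtrace (mat_fun f (mat_inv
               (mat_powr (\<Phi> (mat_powr A (-p))) (1/2) * \<Psi> (mat_powr B (-q))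
                * mat_powr (\<Phi> (mat_powr A (-p))) (1/2)))))))"
proof (intro conjI impI)
  have Psi_pd: "posdef_mat l (\<Psi> (mat_powr B a))" if "posdef_mat m B" for B a
    using pos_Psi mat_powr_posdef[OF that] by (auto simp: strictly_positive_map_def)
  have Phi_pd: "posdef_mat l (\<Phi> (mat_powr A a))" if "posdef_mat n A" for A a
    using pos_Phi mat_powr_posdef[OF that] by (auto simp: strictly_positive_map_def)
  {
    assume cp: "completely_positive_map n l \<Phi>"
    let ?T = "\<lambda>A. \<Phi> (mat_powr A p)" and ?C = "\<lambda>B. mat_powr (\<Psi> (mat_powr B q)) (-1)"
    \<comment> \<open>Since \<open>conj_quot\<close> inverts its second argument, \<open>?C\<close>
      is the inverse of \<Psi>(B^q).\<close>
    have eq: "mat_powr (?T A) (1/2) * \<Psi> (mat_powr B q) * mat_powr (?T A) (1/2) = conj_quot (?T A) (?C B)"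
      if "posdef_mat n A" "posdef_mat m B" for A B
      using mat_powr_dim[OF Phi_pd[OF that(1)], of p "1/2"]
        hermitianD[OF posdef_hermitian[OF Psi_pd[OF that(2)]], of q]
      by (simp add: conj_quot_def mat_powr_powr[OF Psi_pd[OF that(2)]] mat_powr_one[OF Psi_pd[OF that(2)]]
          mult_assoc_dim)
    show "jointly_convex_on_posdef n m (\<lambda>A B. Re (mtrace (mat_fun f
        (mat_powr (?T A) (1/2) * \<Psi> (mat_powr B q) * mat_powr (?T A) (1/2)))))"
      unfolding jointly_convex_on_posdef_def
    proof (intro allI impI)
      fix A1 A2 B1 B2 :: "complex mat" and t :: real
      assume A: "posdef_mat n A1" "posdef_mat n A2" and B: "posdef_mat m B1" "posdef_mat m B2"
        and t: "0 \<le> t" "t \<le> 1"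
      let ?A = "complex_of_real t \<cdot>\<^sub>m A1 + complex_of_real (1 - t) \<cdot>\<^sub>m A2"
      let ?B = "complex_of_real t \<cdot>\<^sub>m B1 + complex_of_real (1 - t) \<cdot>\<^sub>m B2"
      have A': "posdef_mat n ?A" and B': "posdef_mat m ?B"
        using posdef_convex_comb[OF A t] posdef_convex_comb[OF B t] .
      have "Re (mtrace (mat_fun f (conj_quot (?T ?A) (?C ?B))))
        \<le> t * Re (mtrace (mat_fun f (conj_quot (?T A1) (?C B1))))
          + (1 - t) * Re (mtrace (mat_fun f (conj_quot (?T A2) (?C B2))))"
        by (rule conj_quot_convex[OF p(1) t f_mono f_conv Phi_pd[OF A'] Phi_pd[OF A(1)] Phi_pd[OF A(2)]
              mat_powr_posdef[OF Psi_pd[OF B']] mat_powr_posdef[OF Psi_pd[OF B(1)]]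
              mat_powr_posdef[OF Psi_pd[OF B(2)]] completely_positive_ando[OF lin_Phi cp p A _ _ _ _ t]
              positive_map_powr_inverse_concave[OF lin_Psi pos_Psi q B t]])
      thus "Re (mtrace (mat_fun f (mat_powr (?T ?A) (1/2) * \<Psi> (mat_powr ?B q) * mat_powr (?T ?A) (1/2))))
        \<le> t * Re (mtrace (mat_fun f (mat_powr (?T A1) (1/2) * \<Psi> (mat_powr B1 q) * mat_powr (?T A1) (1/2))))
          + (1 - t) * Re (mtrace (mat_fun f (mat_powr (?T A2) (1/2) * \<Psi> (mat_powr B2 q) * mat_powr (?T A2) (1/2))))"
        unfolding eq[OF A' B'] eq[OF A(1) B(1)] eq[OF A(2) B(2)] .
    qed
  }
  {
    assume id: "n = l \<and> (\<forall>X \<in> carrier_mat n n. \<Phi> X = X)"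
    let ?C = "\<lambda>B. \<Psi> (mat_powr B (-q))"
    let ?M = "\<lambda>A B. mat_powr (\<Phi> (mat_powr A (-p))) (1/2) * ?C B * mat_powr (\<Phi> (mat_powr A (-p))) (1/2)"
    \<comment> \<open>Inverting A^(-p/2) C A^(-p/2) gives A^(p/2) C^(-1) A^(p/2). Because
      \<open>\<Phi>\<close> is the identity, the outer factors are powers of \<open>A\<close>
      itself, and Ando's theorem applies with T = A^p.\<close>
    have eq: "mat_inv (?M A B) = conj_quot (mat_powr A p) (?C B)"
      if A: "posdef_mat n A" and B: "posdef_mat m B" for A B
    proof (rule mat_inv_eqI[where n = l])
      have Al: "posdef_mat l A" using A id by simp
      have Phi_id: "\<Phi> (mat_powr A (-p)) = mat_powr A (-p)" using id mat_powr_dim(4)[OF A, of "-p"] by blast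
      define R where "R = mat_powr A (p / 2)"
      define R' where "R' = mat_powr A (-p / 2)"
      note Rd = mat_powr_dim[OF Al, of "p / 2", folded R_def]
        and R'd = mat_powr_dim[OF Al, of "-p / 2", folded R'_def]
      have RR: "R' * R = 1\<^sub>m l" unfolding R_def R'_def by (simp add: mat_powr_add[OF Al] mat_powr_zero[OF Al])
      have RRl: "R' * (R * Z) = Z" if "dim_row Z = l" for Z
        using that RR Rd R'd by (simp add: mult_assoc_dim[symmetric])
      note C = Psi_pd[OF B, of "-q"]
      note Cd = hermitianD[OF posdef_hermitian[OF C]] mat_powr_dim[OF C, of "-1"]
      have M: "?M A B = R' * (?C B * R')"
        using R'd Cd by (simp add: Phi_id mat_powr_powr[OF Al] R'_def mult_assoc_dim)
      have N: "conj_quot (mat_powr A p) (?C B) = R * (mat_powr (?C B) (-1) * R)"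
        by (simp add: conj_quot_def mat_powr_powr[OF Al] R_def)
      show "?M A B \<in> carrier_mat l l" unfolding M using R'd Cd by (auto intro!: carrier_matI)
      show "conj_quot (mat_powr A p) (?C B) \<in> carrier_mat l l"
        unfolding N using Rd Cd by (auto intro!: carrier_matI)
      show "?M A B * conj_quot (mat_powr A p) (?C B) = 1\<^sub>m l"
        unfolding M N using Rd R'd Cd by (simp add: mult_assoc_dim RRl mat_powr_inverse[OF C] RR)
    qed
    show "jointly_convex_on_posdef n m (\<lambda>A B. Re (mtrace (mat_fun f (mat_inv (?M A B)))))"
      unfolding jointly_convex_on_posdef_def
    proof (intro allI impI)
      fix A1 A2 B1 B2 :: "complex mat" and t :: real
      assume A: "posdef_mat n A1" "posdef_mat n A2" and B: "posdef_mat m B1" "posdef_mat m B2"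
        and t: "0 \<le> t" "t \<le> 1"
      let ?A = "complex_of_real t \<cdot>\<^sub>m A1 + complex_of_real (1 - t) \<cdot>\<^sub>m A2"
      let ?B = "complex_of_real t \<cdot>\<^sub>m B1 + complex_of_real (1 - t) \<cdot>\<^sub>m B2"
      have A': "posdef_mat n ?A" and B': "posdef_mat m ?B"
        using posdef_convex_comb[OF A t] posdef_convex_comb[OF B t] .
      have Al: "posdef_mat l A1" "posdef_mat l A2" "posdef_mat l ?A" using A A' id by auto
      have r: "0 \<le> - q" "- q \<le> 1" using q by auto
      \<comment> \<open>With the identity as \<open>H\<close>,
        \<open>positive_map_powr_concave\<close> is concavity of \<Psi>(B^(-q)) itself, as 0 \<le>
        -q \<le> 1.\<close>
      have one: "1\<^sub>m m * (mat_powr B a * 1\<^sub>m m) = mat_powr B a" if "posdef_mat m B" for B a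
        using mat_powr_dim[OF that] by simp
      have conc: "t * Re (mtrace (Z\<^sup>H * (?C B1 * Z))) + (1 - t) * Re (mtrace (Z\<^sup>H * (?C B2 * Z)))
        \<le> Re (mtrace (Z\<^sup>H * (?C ?B * Z)))" if "dim_row Z = l" for Z
        using positive_map_powr_concave[OF lin_Psi pos_Psi r B t posdef_hermitian[OF posdef_one] that]
        unfolding one[OF B(1)] one[OF B(2)] one[OF B'] .
      have "Re (mtrace (mat_fun f (conj_quot (mat_powr ?A p) (?C ?B))))
        \<le> t * Re (mtrace (mat_fun f (conj_quot (mat_powr A1 p) (?C B1))))
          + (1 - t) * Re (mtrace (mat_fun f (conj_quot (mat_powr A2 p) (?C B2))))"
        by (rule conj_quot_convex[OF p(1) t f_mono f_conv mat_powr_posdef[OF Al(3)] mat_powr_posdef[OF Al(1)]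
              mat_powr_posdef[OF Al(2)] Psi_pd[OF B'] Psi_pd[OF B(1)] Psi_pd[OF B(2)]
              ando_convexity[OF p Al(1,2) _ _ _ _ t] conc])
      thus "Re (mtrace (mat_fun f (mat_inv (?M ?A ?B))))
        \<le> t * Re (mtrace (mat_fun f (mat_inv (?M A1 B1)))) + (1 - t) * Re (mtrace (mat_fun f (mat_inv (?M A2 B2))))"
        unfolding eq[OF A' B'] eq[OF A(1) B(1)] eq[OF A(2) B(2)] .
    qed
  }
qed

end
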